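(* Let $f$ be either independent of time with $f\in L^2(\Omega)$, or $f\in L^\infty(0,\infty;L^2(\Omega))$. The semidiscrete problem: find $u_h(t)\in V_h$, $t>0$, such that $$(u_{ht},\chi)+\left(1+\|\nabla u_h\|^2\right)(\nabla u_h,\nabla\chi)=(f,\chi)\qquad\forall\chi\in V_h,\qquad u_h(0)=u_{0h}\in V_h,$$ has a global attractor $\mathcal{A}_h\subset V_h$ which attracts bounded sets in $V_h$.
   Context: $\Omega\subset\mathbb{R}^d$ ($d=2$ or $3$) is a bounded convex polygonal or polyhedral domain; $(\cdot,\cdot)$ and $\|\cdot\|$ are the $L^2(\Omega)$ inner product and norm. $\mathcal{T}_h$ is a regular triangulation of $\overline\Omega$, and $V_h=\{v_h\in C^0(\overline\Omega): v_h|_K\in\mathcal{P}_1(K)\ \forall K\in\mathcal{T}_h,\ v_h=0\text{ on }\partial\Omega\}$ is the space of continuous piecewise linear functions vanishing on $\partial\Omega$. A global attractor in $V_h$ is a compact set $\mathcal{A}_h\subset V_h$ attracting every bounded set: for every bounded $B\subset V_h$, $\sup_{u_{0h}\in B}\operatorname{dist}(u_h(t),\mathcal{A}_h)\to0$ as $t\to\infty$, where $u_h$ is the solution with $u_h(0)=u_{0h}$; when $f$ is independent of time it is moreover invariant under the solution semigroup. *)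

theory Defs
  imports "HOL-Analysis.Analysis"
begin

text \<open>Open convex domains with polygonal or polyhedral boundary; boundedness is part of
  \<^const>\<open>polytope\<close>.\<close>

definition convex_polytopal_domain :: "'a::euclidean_space set \<Rightarrow> bool" where
  "convex_polytopal_domain \<Omega> \<longleftrightarrow>
     open \<Omega> \<and> \<Omega> \<noteq> {} \<and> convex \<Omega> \<and> polytope (closure \<Omega>)"

text \<open>Regular triangulations in the sense of conforming ones: the library's \<^const>\<open>triangulation\<close>
  says that finitely many simplices meet only in common (possibly empty) faces. Shape regularity
  restricts a family of meshes only: a single finite mesh of nondegenerate simplices always has it.\<close>

definition regular_triangulation :: "'a::euclidean_space set \<Rightarrow> 'a set set \<Rightarrow> bool" where
  "regular_triangulation \<Omega> \<T> \<longleftrightarrow>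
     triangulation \<T> \<and> (\<forall>K\<in>\<T>. int DIM('a) simplex K) \<and> \<Union>\<T> = closure \<Omega>"

text \<open>A function on the closure of \<open>\<Omega>\<close> vanishing on the boundary is represented by its extension
  by zero to the whole space, so that equality of functions is equality in \<open>V\<^sub>h\<close>.\<close>

definition Vh :: "'a::euclidean_space set \<Rightarrow> 'a set set \<Rightarrow> ('a \<Rightarrow> real) set" where
  "Vh \<Omega> \<T> = {v. continuous_on (closure \<Omega>) v \<and>
     (\<forall>K\<in>\<T>. \<exists>a c. \<forall>x\<in>K. v x = a \<bullet> x + c) \<and>
     (\<forall>x. x \<notin> \<Omega> \<longrightarrow> v x = 0)}"

text \<open>Functions, not classes of functions modulo null sets.\<close>

definition L2 :: "'a::euclidean_space set \<Rightarrow> ('a \<Rightarrow> real) set" where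
  "L2 \<Omega> = {g \<in> borel_measurable (lebesgue_on \<Omega>). integrable (lebesgue_on \<Omega>) (\<lambda>x. (g x)\<^sup>2)}"

definition L2_inner :: "'a::euclidean_space set \<Rightarrow> ('a \<Rightarrow> real) \<Rightarrow> ('a \<Rightarrow> real) \<Rightarrow> real" where
  "L2_inner \<Omega> v w = (LINT x|lebesgue_on \<Omega>. v x * w x)"

definition L2_norm :: "'a::euclidean_space set \<Rightarrow> ('a \<Rightarrow> real) \<Rightarrow> real" where
  "L2_norm \<Omega> v = sqrt (L2_inner \<Omega> v v)"

definition L2_dist :: "'a::euclidean_space set \<Rightarrow> ('a \<Rightarrow> real) \<Rightarrow> ('a \<Rightarrow> real) \<Rightarrow> real" where
  "L2_dist \<Omega> v w = L2_norm \<Omega> (\<lambda>x. v x - w x)"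

text \<open>Functions in \<open>V\<^sub>h\<close> are differentiable in the interior of each simplex, and there the pointwise
  gradient is the weak one; the null set formed by the boundaries of the simplices, where the
  description may be improper, does not affect the integrals below.\<close>

definition grad :: "('a::euclidean_space \<Rightarrow> real) \<Rightarrow> 'a \<Rightarrow> 'a" where
  "grad v x = (THE D. GDERIV v x :> D)"

definition grad_inner :: "'a::euclidean_space set \<Rightarrow> ('a \<Rightarrow> real) \<Rightarrow> ('a \<Rightarrow> real) \<Rightarrow> real" where
  "grad_inner \<Omega> v w = (LINT x|lebesgue_on \<Omega>. grad v x \<bullet> grad w x)"

definition grad_norm :: "'a::euclidean_space set \<Rightarrow> ('a \<Rightarrow> real) \<Rightarrow> real" where
  "grad_norm \<Omega> v = sqrt (grad_inner \<Omega> v v)"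

text \<open>\<open>L\<^sup>\<infinity>(0,\<infinity>; L\<^sup>2(\<Omega>))\<close>: strongly (Bochner) measurable, i.e. an almost everywhere limit of simple
  functions with values in \<open>L\<^sup>2(\<Omega>)\<close>, and essentially bounded.\<close>

definition Linf_L2 :: "'a::euclidean_space set \<Rightarrow> (real \<Rightarrow> 'a \<Rightarrow> real) set" where
  "Linf_L2 \<Omega> = {f.
     (AE t in lebesgue_on {0<..}. f t \<in> L2 \<Omega>) \<and>
     (\<exists>s. (\<forall>n. simple_function (lebesgue_on {0<..}) (s n) \<and> s n ` {0<..} \<subseteq> L2 \<Omega>) \<and>
          (AE t in lebesgue_on {0<..}. (\<lambda>n. L2_dist \<Omega> (s n t) (f t)) \<longlonglongrightarrow> 0)) \<and>
     (\<exists>C. AE t in lebesgue_on {0<..}. L2_norm \<Omega> (f t) \<le> C)}"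

text \<open>The differential equation at time \<open>t\<close> with right-hand side \<open>g = f(t)\<close>; \<open>w\<close> is the time
  derivative of \<open>u\<close> at \<open>t\<close>, as a limit of difference quotients in the normed space \<open>V\<^sub>h\<close>.\<close>

definition semidiscrete_eq_at ::
  "'a::euclidean_space set \<Rightarrow> 'a set set \<Rightarrow> ('a \<Rightarrow> real) \<Rightarrow> (real \<Rightarrow> 'a \<Rightarrow> real) \<Rightarrow> real \<Rightarrow> bool" where
  "semidiscrete_eq_at \<Omega> \<T> g u t \<longleftrightarrow>
     (\<exists>w\<in>Vh \<Omega> \<T>.
        ((\<lambda>s. L2_norm \<Omega> (\<lambda>x. (u s x - u t x) / (s - t) - w x)) \<longlongrightarrow> 0) (at t) \<and>
        (\<forall>\<psi>\<in>Vh \<Omega> \<T>.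
           L2_inner \<Omega> w \<psi> + (1 + (grad_norm \<Omega> (u t))\<^sup>2) * grad_inner \<Omega> (u t) \<psi> = L2_inner \<Omega> g \<psi>))"

text \<open>Solutions are functions of time of which only the restriction to \<open>[0,\<infinity>)\<close> matters. For a
  right-hand side \<open>F\<close> independent of time the equation holds for all \<open>t > 0\<close>.\<close>

definition classical_solution ::
  "'a::euclidean_space set \<Rightarrow> 'a set set \<Rightarrow> ('a \<Rightarrow> real) \<Rightarrow> ('a \<Rightarrow> real) \<Rightarrow> (real \<Rightarrow> 'a \<Rightarrow> real) \<Rightarrow> bool" where
  "classical_solution \<Omega> \<T> F u0 u \<longleftrightarrow>
     (\<forall>t\<ge>0. u t \<in> Vh \<Omega> \<T>) \<and> u 0 = u0 \<and>
     continuous_map (top_of_set {0..}) (Metric_space.mtopology (Vh \<Omega> \<T>) (L2_dist \<Omega>)) u \<and>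
     (\<forall>t>0. semidiscrete_eq_at \<Omega> \<T> F u t)"

text \<open>Absolute continuity on every interval \<open>[0,b]\<close>; the members of \<open>D\<close> are non-overlapping compact
  intervals \<open>[Inf K, Sup K]\<close>.\<close>

definition locally_absolutely_continuous :: "('b \<Rightarrow> 'b \<Rightarrow> real) \<Rightarrow> (real \<Rightarrow> 'b) \<Rightarrow> bool" where
  "locally_absolutely_continuous d u \<longleftrightarrow>
     (\<forall>b>0. \<forall>\<epsilon>>0. \<exists>\<delta>>0. \<forall>D. D division_of \<Union>D \<and> \<Union>D \<subseteq> {0..b} \<and> (\<Sum>K\<in>D. Sup K - Inf K) < \<delta>
        \<longrightarrow> (\<Sum>K\<in>D. d (u (Inf K)) (u (Sup K))) < \<epsilon>)"

text \<open>For \<open>f \<in> L\<^sup>\<infinity>(0,\<infinity>; L\<^sup>2(\<Omega>))\<close>, whose values are determined only for almost every \<open>t\<close>, solutions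
  are understood in the sense of Caratheodory.\<close>

definition caratheodory_solution ::
  "'a::euclidean_space set \<Rightarrow> 'a set set \<Rightarrow> (real \<Rightarrow> 'a \<Rightarrow> real) \<Rightarrow> ('a \<Rightarrow> real) \<Rightarrow> (real \<Rightarrow> 'a \<Rightarrow> real) \<Rightarrow> bool"
  where
  "caratheodory_solution \<Omega> \<T> f u0 u \<longleftrightarrow>
     (\<forall>t\<ge>0. u t \<in> Vh \<Omega> \<T>) \<and> u 0 = u0 \<and>
     locally_absolutely_continuous (L2_dist \<Omega>) u \<and>
     (AE t in lebesgue_on {0<..}. semidiscrete_eq_at \<Omega> \<T> (f t) u t)"

text \<open>Below, \<open>sol u0 u\<close> says that \<open>u\<close> is a solution with initial value \<open>u0\<close>.\<close>

definition uniquely_solvable :: "'b set \<Rightarrow> ('b \<Rightarrow> (real \<Rightarrow> 'b) \<Rightarrow> bool) \<Rightarrow> bool" where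
  "uniquely_solvable V sol \<longleftrightarrow>
     (\<forall>u0\<in>V. \<exists>u. sol u0 u \<and> (\<forall>v. sol u0 v \<longrightarrow> (\<forall>t\<ge>0. v t = u t)))"

definition solution_operator :: "('b \<Rightarrow> (real \<Rightarrow> 'b) \<Rightarrow> bool) \<Rightarrow> real \<Rightarrow> 'b \<Rightarrow> 'b" where
  "solution_operator sol t u0 = (THE w. \<exists>u. sol u0 u \<and> u t = w)"

text \<open>The distance to \<open>A\<close> and its supremum over \<open>B\<close> are taken in \<^typ>\<open>ennreal\<close>, where the distance to
  the empty set is \<open>\<infinity>\<close> and a supremum of unbounded values is not an arbitrary real number. The
  carrier of \<open>mtopology\<close> is \<open>V\<close>, so \<open>compactin\<close> includes \<open>A \<subseteq> V\<close>, and \<open>mbounded\<close> likewise \<open>B \<subseteq> V\<close>.\<close>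

definition global_attractor ::
  "'b set \<Rightarrow> ('b \<Rightarrow> 'b \<Rightarrow> real) \<Rightarrow> (real \<Rightarrow> 'b \<Rightarrow> 'b) \<Rightarrow> 'b set \<Rightarrow> bool" where
  "global_attractor V d S A \<longleftrightarrow>
     compactin (Metric_space.mtopology V d) A \<and>
     (\<forall>B. Metric_space.mbounded V d B \<longrightarrow>
        ((\<lambda>t. SUP u0\<in>B. INF a\<in>A. ennreal (d (S t u0) a)) \<longlongrightarrow> 0) at_top)"

definition invariant_under :: "(real \<Rightarrow> 'b \<Rightarrow> 'b) \<Rightarrow> 'b set \<Rightarrow> bool" where
  "invariant_under S A \<longleftrightarrow> (\<forall>t\<ge>0. S t ` A = A)"

end

theory Submission
  imports Defs
begin

text \<open>In coordinates with respect to an \<open>L\<^sup>2\<close>-orthonormal basis of \<open>V\<^sub>h\<close> the problem is a system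
  \<open>c' = h - k(c)\<close> of ordinary differential equations with a strongly monotone, locally Lipschitz
  nonlinearity \<open>k\<close>, and strong monotonicity (with the Poincare constant \<open>\<mu>\<close> of \<open>V\<^sub>h\<close>) does all the
  work. Since \<open>h\<close> is merely measurable in time, one argues with the integral equation: Caratheodory
  solutions satisfy it because an absolutely continuous function whose derivative vanishes almost
  everywhere is constant. Freezing the coefficient \<open>1 + \<parallel>\<nabla>u\<parallel>\<^sup>2\<close> for large arguments makes \<open>k\<close> globally
  Lipschitz, so Banach's fixed point theorem in an exponentially weighted supremum norm gives a
  global solution, and the energy estimate shows that it never leaves the unmodified region. The
  same estimate yields an absorbing ball, which is compact; this suffices for time-dependent data.
  For time-independent data any two solutions approach each other exponentially, so the attractor
  is the singleton of the steady state. The latter is a multiple \<open>s z\<close> of the Riesz representative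
  \<open>z\<close> of \<open>f\<close> in the gradient inner product, with \<open>s\<close> obtained from the intermediate value theorem.\<close>

section \<open>Absolutely continuous functions of a real variable\<close>

text \<open>The nonlinearity is the gradient of a convex function of the coordinates, half the
  stiffness form plus a quarter of its square; this is why it is strongly monotone with the constant
  of its linear part. Classical and Caratheodory solutions meet in the same integral equation
  \<open>solves\<close>, so the flow is studied only once. The price of merely essentially bounded
  data is that the energy is differentiable only almost everywhere. The criterion for monotonicity
  must then use absolute continuity, and it is proved directly from a fine tagged division. All
  constants, the Poincare constant included, come from finite dimension and may depend on the
  mesh.\<close>

abbreviation "abs_cont_real \<equiv> locally_absolutely_continuous (\<lambda>x y::real. \<bar>x - y\<bar>)"

text \<open>The straddle estimate: an increment over an interval around the tag \<open>t\<close> is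
  the sum of the increments on its two sides, and each one-sided difference quotient is below
  \<epsilon> near \<open>t\<close>.\<close>

lemma derivative_nonpos_gauge:
  fixes g :: "real \<Rightarrow> real"
  assumes "(g has_real_derivative D) (at t)" "D \<le> 0" "\<epsilon> > 0"
  obtains r where "r > 0"
    "\<And>u v. u \<le> t \<Longrightarrow> t \<le> v \<Longrightarrow> \<bar>u - t\<bar> < r \<Longrightarrow> \<bar>v - t\<bar> < r \<Longrightarrow> g v - g u \<le> \<epsilon> * (v - u)"
proof -
  have "((\<lambda>s. (g s - g t) / (s - t)) \<longlongrightarrow> D) (at t)"
    using assms(1) by (simp add: has_field_derivative_iff)
  then have "\<forall>\<^sub>F s in at t. (g s - g t) / (s - t) < D + \<epsilon>"
    using \<open>\<epsilon> > 0\<close> by (intro order_tendstoD(2)) auto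
  then obtain r where r: "r > 0" "\<And>s. s \<noteq> t \<Longrightarrow> \<bar>s - t\<bar> < r \<Longrightarrow> (g s - g t) / (s - t) < \<epsilon>"
    using assms(2) unfolding eventually_at dist_real_def
    by (metis UNIV_I add.commute add_le_same_cancel1 less_le_trans)
  show thesis
  proof
    fix u v assume uv: "u \<le> t" "t \<le> v" "\<bar>u - t\<bar> < r" "\<bar>v - t\<bar> < r"
    have "g v - g t \<le> \<epsilon> * (v - t)"
      using r(2)[of v] uv by (cases "v = t") (auto simp: divide_less_eq)
    moreover have "g t - g u \<le> \<epsilon> * (t - u)"
      using r(2)[of u] uv by (cases "u = t") (auto simp: divide_less_eq algebra_simps)
    ultimately show "g v - g u \<le> \<epsilon> * (v - u)"
      by (simp add: algebra_simps)
  qed (fact r(1))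
qed

text \<open>In a fine tagged division the intervals tagged in the exceptional null set have small
  total length, so absolute continuity makes their increments small; the others are controlled by
  the straddle estimate at their tags.\<close>

lemma abs_cont_nonincreasing:
  fixes g :: "real \<Rightarrow> real"
  assumes ac: "abs_cont_real g" and "negligible N" and "b > 0"
    and der: "\<And>t. 0 < t \<Longrightarrow> t < b \<Longrightarrow> t \<notin> N \<Longrightarrow> \<exists>D\<le>0. (g has_real_derivative D) (at t)"
  shows "g b \<le> g 0"
proof (rule field_le_epsilon)
  fix e :: real assume "e > 0"
  \<comment> \<open>The exceptional intervals will contribute \<epsilon> and the others \<epsilon>
    times the length \<open>b\<close>.\<close>
  define \<epsilon> where "\<epsilon> = e / (1 + b)"
  have \<epsilon>: "\<epsilon> > 0" using \<open>e > 0\<close> \<open>b > 0\<close> by (simp add: \<epsilon>_def)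
  obtain \<delta> where \<delta>: "\<delta> > 0" and ac\<delta>: "\<And>D. D division_of \<Union>D \<Longrightarrow> \<Union>D \<subseteq> {0..b} \<Longrightarrow>
      (\<Sum>K\<in>D. Sup K - Inf K) < \<delta> \<Longrightarrow> (\<Sum>K\<in>D. \<bar>g (Inf K) - g (Sup K)\<bar>) < \<epsilon>"
    using ac \<epsilon> \<open>b > 0\<close> unfolding locally_absolutely_continuous_def by meson
  \<comment> \<open>The end points join the exceptional set because the derivative is assumed only
    in the open interval.\<close>
  define M where "M = insert 0 (insert b N)"
  have "negligible M" using \<open>negligible N\<close> by (simp add: M_def)
  \<comment> \<open>The null set gets an open neighbourhood of measure below \<delta>; each of the
    two approximations costs half of it.\<close>
  then obtain G0 where G0: "M \<subseteq> G0" "G0 \<in> lmeasurable" "measure lebesgue G0 < \<delta>/2"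
    using \<delta> negligible_outer by (metis half_gt_zero)
  obtain G where G: "open G" "G0 \<subseteq> G" "G - G0 \<in> lmeasurable" "emeasure lebesgue (G - G0) < ennreal (\<delta>/2)"
    using sets_lebesgue_outer_open[of G0 "\<delta>/2"] G0 \<delta> by (metis fmeasurableD half_gt_zero)
  have Gm: "G \<in> lmeasurable"
    using G G0 by (metis Diff_partition fmeasurable.Un)
  have mG: "measure lebesgue G < \<delta>"
  proof -
    have "measure lebesgue G = measure lebesgue G0 + measure lebesgue (G - G0)"
      using G G0 by (metis Diff_disjoint Diff_partition measure_Un3 measure_empty diff_zero)
    moreover have "measure lebesgue (G - G0) < \<delta>/2"
      using G \<delta> by (simp add: emeasure_eq_measure2 ennreal_less_iff)
    ultimately show ?thesis using G0 by simp
  qed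
  \<comment> \<open>At a tag in \<open>M\<close> the gauge keeps the interval inside
    \<open>G\<close>; at the other tags in the interval it provides the straddle estimate.\<close>
  have "\<exists>r>0. (t \<in> M \<longrightarrow> ball t r \<subseteq> G) \<and> (0 < t \<and> t < b \<and> t \<notin> M \<longrightarrow>
      (\<forall>u v. u \<le> t \<and> t \<le> v \<and> \<bar>u - t\<bar> < r \<and> \<bar>v - t\<bar> < r \<longrightarrow> g v - g u \<le> \<epsilon> * (v - u)))" for t
  proof (cases "t \<in> M")
    case True
    then show ?thesis using G G0 by (metis openE subsetD)
  next
    case F: False
    show ?thesis
    proof (cases "0 < t \<and> t < b")
      case True
      then obtain D where "D \<le> 0" "(g has_real_derivative D) (at t)"
        using der[of t] F by (auto simp: M_def)
      then show ?thesis using derivative_nonpos_gauge \<epsilon> F by (metis (no_types))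
    qed (use F zero_less_one in blast)
  qed
  then obtain r where r: "\<And>t. r t > 0" "\<And>t. t \<in> M \<Longrightarrow> ball t (r t) \<subseteq> G"
    "\<And>t u v. 0 < t \<Longrightarrow> t < b \<Longrightarrow> t \<notin> M \<Longrightarrow> u \<le> t \<Longrightarrow> t \<le> v \<Longrightarrow> \<bar>u - t\<bar> < r t \<Longrightarrow> \<bar>v - t\<bar> < r t \<Longrightarrow>
        g v - g u \<le> \<epsilon> * (v - u)"
    by metis
  have "gauge (\<lambda>t. ball t (r t))"
    using r(1) by (auto simp: gauge_def)
  then obtain p where p: "p tagged_division_of {0..b}" "(\<lambda>t. ball t (r t)) fine p"
    by (rule fine_division_exists_real)
  have "finite p" using p(1) by auto
  have pK: "\<exists>u v. K = {u..v} \<and> u \<le> x \<and> x \<le> v \<and> 0 \<le> u \<and> v \<le> b \<and> Inf K = u \<and> Sup K = v \<and> K \<subseteq> ball x (r x)"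
    if xK: "(x, K) \<in> p" for x K
  proof -
    obtain u v where "K = {u..v}" using tagged_division_ofD(4)[OF p(1) xK] by auto
    moreover have "x \<in> K" "K \<subseteq> {0..b}" using tagged_division_ofD(2,3)[OF p(1) xK] by auto
    moreover have "K \<subseteq> ball x (r x)" using p(2) xK by (auto simp: fine_def)
    ultimately show ?thesis
      by (intro exI[of _ u] exI[of _ v]) (auto simp: subset_iff)
  qed
  define p1 where "p1 = {q \<in> p. fst q \<in> M}"
  define p2 where "p2 = {q \<in> p. fst q \<notin> M}"
  have split: "p = p1 \<union> p2" "p1 \<inter> p2 = {}" "finite p1" "finite p2"
    using \<open>finite p\<close> by (auto simp: p1_def p2_def)
  have tp1: "p1 tagged_partial_division_of {0..b}"
    using p(1) by (auto simp: tagged_division_of_def p1_def intro: tagged_partial_division_subset)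
  then have td1: "p1 tagged_division_of \<Union>(snd ` p1)"
    by (rule tagged_partial_division_of_Union_self)
  define D where "D = snd ` p1"
  have D: "D division_of \<Union>D"
    using td1 division_of_tagged_division unfolding D_def by blast
  have DG: "\<Union>D \<subseteq> G"
    using pK r(2) by (force simp: D_def p1_def subset_iff)
  have "\<Union>D \<subseteq> {0..b}"
    using tagged_division_ofD(3)[OF p(1)] by (fastforce simp: D_def p1_def)
  moreover have "(\<Sum>K\<in>D. Sup K - Inf K) < \<delta>"
  proof -
    have "(\<Sum>K\<in>D. Sup K - Inf K) = sum (measure lebesgue) D"
      proof (intro sum.cong refl)
      fix K assume "K \<in> D"
      then obtain x where "(x, K) \<in> p" by (auto simp: D_def p1_def)
      then obtain u v where "K = {u..v}" "u \<le> v" "Inf K = u" "Sup K = v"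
        using pK[of x K] by (metis order_trans)
      moreover have "measure lebesgue {u..v} = measure lborel {u..v}"
        by (rule measure_completion) simp
      ultimately show "Sup K - Inf K = measure lebesgue K" by simp
    qed
    also have "\<dots> = measure lebesgue (\<Union>D)"
      by (rule content_division[OF D])
    also have "\<dots> \<le> measure lebesgue G"
      using D DG Gm by (intro measure_mono_fmeasurable) (auto simp: lmeasurable_division fmeasurableD)
    finally show ?thesis using mG by simp
  qed
  ultimately have s1: "(\<Sum>K\<in>D. \<bar>g (Inf K) - g (Sup K)\<bar>) < \<epsilon>"
    using ac\<delta> D by blast
  have "g b - g 0 = (\<Sum>(x,K)\<in>p. g (Sup K) - g (Inf K))"
    using additive_tagged_division_1[OF _ p(1), of g] \<open>b > 0\<close> by simp
  also have "\<dots> = (\<Sum>(x,K)\<in>p1. g (Sup K) - g (Inf K)) + (\<Sum>(x,K)\<in>p2. g (Sup K) - g (Inf K))"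
    using split by (simp add: sum.union_disjoint)
  also have "(\<Sum>(x,K)\<in>p1. g (Sup K) - g (Inf K)) \<le> (\<Sum>(x,K)\<in>p1. \<bar>g (Inf K) - g (Sup K)\<bar>)"
    by (intro sum_mono) auto
  \<comment> \<open>The guard prepares the passage from tags to intervals: the term must vanish on
    every \<open>cbox\<close> with empty interior, and this includes the empty one, where
    \<open>Inf\<close> and \<open>Sup\<close> mean nothing.\<close>
  also have "\<dots> = (\<Sum>(x,K)\<in>p1. if K = {} then 0 else \<bar>g (Inf K) - g (Sup K)\<bar>)"
    using tagged_division_ofD(2)[OF td1] by (intro sum.cong) (auto, metis empty_iff)
  also have "\<dots> = (\<Sum>K\<in>D. if K = {} then 0 else \<bar>g (Inf K) - g (Sup K)\<bar>)"
    unfolding D_def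
  proof (rule sum.over_tagged_division_lemma[OF td1])
    show "(if cbox u v = {} then 0 else \<bar>g (Inf (cbox u v)) - g (Sup (cbox u v))\<bar>) = 0"
      if "box u v = {}" for u v
      using that by (cases "u = v"; cases "u < v") (auto simp: not_less)
  qed
  also have "\<dots> \<le> (\<Sum>K\<in>D. \<bar>g (Inf K) - g (Sup K)\<bar>)"
    by (intro sum_mono) auto
  also have "(\<Sum>(x,K)\<in>p2. g (Sup K) - g (Inf K)) \<le> (\<Sum>(x,K)\<in>p2. \<epsilon> * (Sup K - Inf K))"
  proof (intro sum_mono, clarify)
    fix x K assume xK: "(x, K) \<in> p2"
    then have "x \<notin> M" "(x,K) \<in> p" by (auto simp: p2_def)
    from pK[OF this(2)] obtain u v where uv: "K = {u..v}" "u \<le> x" "x \<le> v" "0 \<le> u" "v \<le> b"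
      "Inf K = u" "Sup K = v" "K \<subseteq> ball x (r x)" by blast
    have "x \<noteq> 0" "x \<noteq> b" using \<open>x \<notin> M\<close> by (auto simp: M_def)
    moreover have "u \<in> ball x (r x)" "v \<in> ball x (r x)"
      using uv(1-3,8) by (meson atLeastAtMost_iff order_refl order_trans subsetD)+
    ultimately show "g (Sup K) - g (Inf K) \<le> \<epsilon> * (Sup K - Inf K)"
      using uv r(3)[of x u v] \<open>x \<notin> M\<close> by (auto simp: dist_real_def abs_minus_commute)
  qed
  also have "(\<Sum>(x,K)\<in>p2. \<epsilon> * (Sup K - Inf K)) \<le> (\<Sum>(x,K)\<in>p. \<epsilon> * (Sup K - Inf K))"
  proof (rule sum_mono2)
    show "0 \<le> (case q of (x, K) \<Rightarrow> \<epsilon> * (Sup K - Inf K))" if "q \<in> p - p2" for q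
      using that pK[of "fst q" "snd q"] \<epsilon> by (cases q) auto
  qed (use split in auto)
  also have "\<dots> = \<epsilon> * b"
    using additive_tagged_division_1[OF _ p(1), of "\<lambda>x. \<epsilon> * x"] \<open>b > 0\<close> by (simp add: algebra_simps)
  finally have "g b - g 0 < \<epsilon> + \<epsilon> * b" using s1 by simp
  also have "\<epsilon> + \<epsilon> * b = e"
    using \<open>b > 0\<close> by (simp add: \<epsilon>_def add_divide_distrib[symmetric] distrib_left[of e 1 b, simplified, symmetric])
  finally show "g b \<le> g 0 + e" by simp
qed

text \<open>Lebesgue's differentiation theorem on the half line. Averages to the right of a point
  come from \<open>integrable_ccontinuous_explicit\<close>, averages to the left from the same
  result for the reflected function; the second exceptional set is reflected back.\<close>

lemma indefinite_integral_ae_derivative: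
  fixes f :: "real \<Rightarrow> real"
  assumes int: "\<And>a b. f integrable_on {a..b}"
  obtains N where "negligible N"
    "\<And>t. t > 0 \<Longrightarrow> t \<notin> N \<Longrightarrow> ((\<lambda>s. integral {0..s} f) has_real_derivative f t) (at t)"
proof -
  have int': "(\<lambda>x. f (- x)) integrable_on {a..b}" for a b
    using int[of "-b" "-a"] Henstock_Kurzweil_Integration.integrable_reflect_real[of f "-a" "-b"]
    by (simp only: minus_minus)
  have right: "\<exists>N. negligible N \<and> (\<forall>x e. x \<notin> N \<and> 0 < e \<longrightarrow>
      (\<exists>d>0. \<forall>h. 0 < h \<and> h < d \<longrightarrow> \<bar>integral {x..x + h} g / h - g x\<bar> < e))"
    if "\<And>a b. g integrable_on {a..b}" for g :: "real \<Rightarrow> real"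
  proof -
    have "g integrable_on cbox a b" for a b using that by simp
    then obtain N where "negligible N" and N: "\<And>x e. \<lbrakk>x \<notin> N; 0 < e\<rbrakk> \<Longrightarrow>
        \<exists>d>0. \<forall>h. 0 < h \<and> h < d \<longrightarrow>
          norm (integral (cbox x (x + h *\<^sub>R One)) g /\<^sub>R h ^ DIM(real) - g x) < e"
      using integrable_ccontinuous_explicit[of g] by metis
    then show ?thesis
      by (intro exI[of _ N]) (simp add: divide_inverse mult.commute)
  qed
  obtain N1 where N1: "negligible N1" "\<And>x e. \<lbrakk>x \<notin> N1; 0 < e\<rbrakk> \<Longrightarrow>
      \<exists>d>0. \<forall>h. 0 < h \<and> h < d \<longrightarrow> \<bar>integral {x..x + h} f / h - f x\<bar> < e"
    using right[OF int] by blast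
  obtain N2 where N2: "negligible N2" "\<And>x e. \<lbrakk>x \<notin> N2; 0 < e\<rbrakk> \<Longrightarrow>
      \<exists>d>0. \<forall>h. 0 < h \<and> h < d \<longrightarrow> \<bar>integral {x..x + h} (\<lambda>x. f (- x)) / h - f (- x)\<bar> < e"
    using right[OF int'] by blast
  show thesis
  proof
    show "negligible (N1 \<union> uminus ` N2)"
      using N1(1) negligible_differentiable_image_negligible[OF _ N2(1), of uminus]
      by (simp add: differentiable_on_def)
    fix t :: real assume t: "t > 0" "t \<notin> N1 \<union> uminus ` N2"
    then have t12: "t \<notin> N1" "- t \<notin> N2" by force+
    have "\<exists>d>0. \<forall>s. s \<noteq> t \<and> \<bar>s - t\<bar> < d \<longrightarrow> \<bar>(integral {0..s} f - integral {0..t} f) / (s - t) - f t\<bar> < e"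
      if "e > 0" for e
    proof -
      obtain d1 where d1: "d1 > 0" "\<And>h. 0 < h \<Longrightarrow> h < d1 \<Longrightarrow> \<bar>integral {t..t + h} f / h - f t\<bar> < e"
        using N1(2)[OF t12(1) \<open>e > 0\<close>] by blast
      obtain d2 where d2: "d2 > 0"
        "\<And>h. 0 < h \<Longrightarrow> h < d2 \<Longrightarrow> \<bar>integral {-t..-t + h} (\<lambda>x. f (- x)) / h - f t\<bar> < e"
        using N2(2)[OF t12(2) \<open>e > 0\<close>] by auto
      show ?thesis
      proof (intro exI[of _ "min t (min d1 d2)"] conjI allI impI)
        fix s assume s: "s \<noteq> t \<and> \<bar>s - t\<bar> < min t (min d1 d2)"
        show "\<bar>(integral {0..s} f - integral {0..t} f) / (s - t) - f t\<bar> < e"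
        proof (cases "s > t")
          case True
          then have "integral {0..t} f + integral {t..s} f = integral {0..s} f"
            using t int by (intro Henstock_Kurzweil_Integration.integral_combine) auto
          then have "integral {0..s} f - integral {0..t} f = integral {t..s} f"
            by linarith
          then show ?thesis
            using d1(2)[of "s - t"] True s by auto
        next
          case False
          then have "integral {0..s} f + integral {s..t} f = integral {0..t} f"
            using s int by (intro Henstock_Kurzweil_Integration.integral_combine) auto
          moreover have "integral {-t..-s} (\<lambda>x. f (- x)) = integral {s..t} f"
            by (rule Henstock_Kurzweil_Integration.integral_reflect_real)
          moreover have "- (integral {s..t} f) / (s - t) = integral {s..t} f / (t - s)"
            by (metis minus_diff_eq minus_divide_divide minus_minus)
          moreover from calculation(1) have "integral {0..s} f - integral {0..t} f = - integral {s..t} f"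
            by linarith
          ultimately show ?thesis
            using d2(2)[of "t - s"] False s by auto
        qed
      qed (use t d1 d2 in auto)
    qed
    then show "((\<lambda>s. integral {0..s} f) has_real_derivative f t) (at t)"
      unfolding has_field_derivative_iff LIM_eq by auto
  qed
qed

text \<open>The common source of all closure properties below: increments of \<open>h\<close> are
  dominated by those of functions already known to be absolutely continuous. The constant
  \<open>M\<close> may depend on \<open>b\<close>, which products require.\<close>

lemma locally_absolutely_continuous_dominated:
  assumes "finite I"
    and ac: "\<And>i. i \<in> I \<Longrightarrow> locally_absolutely_continuous (d i) (f i)"
    and dom: "\<And>b. b > 0 \<Longrightarrow> \<exists>M\<ge>0. \<forall>s t. 0 \<le> s \<longrightarrow> s \<le> t \<longrightarrow> t \<le> b \<longrightarrow>
      d' (h s) (h t) \<le> M * (\<Sum>i\<in>I. d i (f i s) (f i t))"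
  shows "locally_absolutely_continuous d' h"
  unfolding locally_absolutely_continuous_def
proof (intro allI impI)
  fix b \<epsilon> :: real assume "b > 0" "\<epsilon> > 0"
  from dom[OF \<open>b > 0\<close>] obtain M where M: "M \<ge> 0" "\<And>s t. 0 \<le> s \<Longrightarrow> s \<le> t \<Longrightarrow> t \<le> b \<Longrightarrow>
      d' (h s) (h t) \<le> M * (\<Sum>i\<in>I. d i (f i s) (f i t))" by blast
  \<comment> \<open>The added 1 covers \<open>M = 0\<close> and empty \<open>I\<close>, and it makes
    the final inequality strict.\<close>
  define \<eta> where "\<eta> = \<epsilon> / (M * card I + 1)"
  have Mc: "M * card I + 1 > 0" using M(1) by (simp add: add_nonneg_pos)
  then have \<eta>: "\<eta> > 0" using \<open>\<epsilon> > 0\<close> by (simp add: \<eta>_def)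
  define small where "small i \<delta> \<longleftrightarrow> \<delta> > 0 \<and> (\<forall>D. D division_of \<Union>D \<and> \<Union>D \<subseteq> {0..b} \<and>
      (\<Sum>K\<in>D. Sup K - Inf K) < \<delta> \<longrightarrow> (\<Sum>K\<in>D. d i (f i (Inf K)) (f i (Sup K))) < \<eta>)" for i \<delta>
  have "\<exists>\<delta>. small i \<delta>" if "i \<in> I" for i
    using ac[OF that, unfolded locally_absolutely_continuous_def, THEN spec, THEN mp, OF \<open>b > 0\<close>,
        THEN spec, THEN mp, OF \<eta>] unfolding small_def .
  then obtain \<delta> where small: "\<And>i. i \<in> I \<Longrightarrow> small i (\<delta> i)"
    by metis
  have \<delta>: "\<And>i. i \<in> I \<Longrightarrow> \<delta> i > 0" "\<And>i D. i \<in> I \<Longrightarrow> D division_of \<Union>D \<Longrightarrow> \<Union>D \<subseteq> {0..b} \<Longrightarrow>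
      (\<Sum>K\<in>D. Sup K - Inf K) < \<delta> i \<Longrightarrow> (\<Sum>K\<in>D. d i (f i (Inf K)) (f i (Sup K))) < \<eta>"
    using small unfolding small_def by auto
  \<comment> \<open>The inserted 1 keeps \<open>Min\<close> away from the empty set when
    \<open>I\<close> is empty.\<close>
  define \<gamma> where "\<gamma> = Min (insert 1 (\<delta> ` I))"
  have "\<gamma> > 0" using \<delta>(1) \<open>finite I\<close> by (auto simp: \<gamma>_def)
  have \<gamma>_le: "\<gamma> \<le> \<delta> i" if "i \<in> I" for i using that \<open>finite I\<close> by (auto simp: \<gamma>_def)
  show "\<exists>\<delta>>0. \<forall>D. D division_of \<Union>D \<and> \<Union>D \<subseteq> {0..b} \<and> (\<Sum>K\<in>D. Sup K - Inf K) < \<delta> \<longrightarrow>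
      (\<Sum>K\<in>D. d' (h (Inf K)) (h (Sup K))) < \<epsilon>"
  proof (intro exI[of _ \<gamma>] conjI allI impI; (elim conjE)?)
    fix D :: "real set set"
    assume D: "D division_of \<Union>D" "\<Union>D \<subseteq> {0..b}" "(\<Sum>K\<in>D. Sup K - Inf K) < \<gamma>"
    have K: "0 \<le> Inf K \<and> Inf K \<le> Sup K \<and> Sup K \<le> b" if KD: "K \<in> D" for K
    proof -
      obtain u v where uv: "K = {u..v}" using division_ofD(4)[OF D(1) KD] by auto
      moreover have "K \<noteq> {}" using division_ofD(3)[OF D(1) KD] .
      moreover have "K \<subseteq> {0..b}" using D(2) KD by auto
      ultimately show ?thesis by auto
    qed
    have "(\<Sum>K\<in>D. d' (h (Inf K)) (h (Sup K))) \<le> (\<Sum>K\<in>D. M * (\<Sum>i\<in>I. d i (f i (Inf K)) (f i (Sup K))))"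
      using K M(2) by (intro sum_mono) auto
    also have "\<dots> = M * (\<Sum>i\<in>I. \<Sum>K\<in>D. d i (f i (Inf K)) (f i (Sup K)))"
      by (subst sum.swap) (simp add: sum_distrib_left)
    also have "\<dots> \<le> M * (\<Sum>i\<in>I. \<eta>)"
    proof (intro mult_left_mono sum_mono)
      show "(\<Sum>K\<in>D. d i (f i (Inf K)) (f i (Sup K))) \<le> \<eta>" if "i \<in> I" for i
        using \<delta>(2)[OF that D(1,2)] \<gamma>_le[OF that] D(3) by simp
    qed (fact M(1))
    also have "\<dots> = (M * card I) * \<eta>" by simp
    also have "\<dots> < (M * card I + 1) * \<eta>" using \<eta> by simp
    also have "\<dots> = \<epsilon>" using Mc by (simp add: \<eta>_def)
    finally show "(\<Sum>K\<in>D. d' (h (Inf K)) (h (Sup K))) < \<epsilon>" .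
  qed (fact \<open>\<gamma> > 0\<close>)
qed

section \<open>Examples and algebra of absolutely continuous functions\<close>

lemma abs_cont_real_id: "abs_cont_real (\<lambda>t. t)"
  unfolding locally_absolutely_continuous_def
proof (intro allI impI)
  fix b \<epsilon> :: real assume "b > 0" "\<epsilon> > 0"
  have "(\<Sum>K\<in>D. \<bar>Inf K - Sup K\<bar>) = (\<Sum>K\<in>D. Sup K - Inf K)" if D: "D division_of \<Union>D" for D :: "real set set"
  proof (intro sum.cong refl)
    fix K assume "K \<in> D"
    then obtain u v where "K = {u..v}" "K \<noteq> {}" using D division_ofD(3,4)[OF D, of K] by auto
    then show "\<bar>Inf K - Sup K\<bar> = Sup K - Inf K" by auto
  qed
  then show "\<exists>\<delta>>0. \<forall>D. D division_of \<Union>D \<and> \<Union>D \<subseteq> {0..b} \<and> (\<Sum>K\<in>D. Sup K - Inf K) < \<delta> \<longrightarrow>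
      (\<Sum>K\<in>D. \<bar>Inf K - Sup K\<bar>) < \<epsilon>"
    using \<open>\<epsilon> > 0\<close> by (intro exI[of _ \<epsilon>]) auto
qed

lemma locally_absolutely_continuous_lipschitz:
  assumes "\<And>b. b > 0 \<Longrightarrow> \<exists>M\<ge>0. \<forall>s t. 0 \<le> s \<longrightarrow> s \<le> t \<longrightarrow> t \<le> b \<longrightarrow> d (h s) (h t) \<le> M * (t - s)"
  shows "locally_absolutely_continuous d h"
proof (rule locally_absolutely_continuous_dominated[where I = "{()}" and d = "\<lambda>_ x y. \<bar>x - y\<bar>" and f = "\<lambda>_ t. t"])
  show "\<exists>M\<ge>0. \<forall>s t. 0 \<le> s \<longrightarrow> s \<le> t \<longrightarrow> t \<le> b \<longrightarrow> d (h s) (h t) \<le> M * (\<Sum>i\<in>{()}. \<bar>s - t\<bar>)" if "b > 0" for b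
  proof -
    have "\<bar>s - t\<bar> = t - s" if "s \<le> t" for s t :: real using that by simp
    then show ?thesis using assms[OF that] by (simp cong: imp_cong)
  qed
qed (auto intro: abs_cont_real_id)

lemma abs_cont_real_add:
  assumes "abs_cont_real f" "abs_cont_real g"
  shows "abs_cont_real (\<lambda>t. f t + g t)"
proof (rule locally_absolutely_continuous_dominated[where I = "{0, 1::nat}" and d = "\<lambda>_ x y. \<bar>x - y\<bar>"
      and f = "\<lambda>i. if i = 0 then f else g"])
  show "\<exists>M\<ge>0. \<forall>s t. 0 \<le> s \<longrightarrow> s \<le> t \<longrightarrow> t \<le> b \<longrightarrow> \<bar>f s + g s - (f t + g t)\<bar> \<le>
      M * (\<Sum>i\<in>{0, 1::nat}. \<bar>(if i = 0 then f else g) s - (if i = 0 then f else g) t\<bar>)" for b :: real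
  proof (intro exI[of _ 1] conjI allI impI)
    fix s t
    have "\<bar>f s + g s - (f t + g t)\<bar> \<le> \<bar>f s - f t\<bar> + \<bar>g s - g t\<bar>" by linarith
    then show "\<bar>f s + g s - (f t + g t)\<bar> \<le> 1 * (\<Sum>i\<in>{0, 1::nat}. \<bar>(if i = 0 then f else g) s - (if i = 0 then f else g) t\<bar>)"
      by simp
  qed simp
qed (use assms in simp_all)

lemma abs_cont_real_mult:
  assumes "abs_cont_real f" "abs_cont_real g" and cont: "continuous_on {0..} f" "continuous_on {0..} g"
  shows "abs_cont_real (\<lambda>t. f t * g t)"
proof (rule locally_absolutely_continuous_dominated[where I = "{0, 1::nat}" and d = "\<lambda>_ x y. \<bar>x - y\<bar>"
      and f = "\<lambda>i. if i = 0 then f else g"])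
  fix b :: real
  have "bounded (f ` {0..b})" "bounded (g ` {0..b})"
    using cont by (auto intro!: compact_imp_bounded compact_continuous_image intro: continuous_on_subset)
  then obtain M1 M2 where M12: "\<And>t. t \<in> {0..b} \<Longrightarrow> \<bar>f t\<bar> \<le> M1" "\<And>t. t \<in> {0..b} \<Longrightarrow> \<bar>g t\<bar> \<le> M2"
    unfolding bounded_iff by (metis imageI real_norm_def)
  define M where "M = max 0 (max M1 M2)"
  have M: "M \<ge> 0" "\<And>t. t \<in> {0..b} \<Longrightarrow> \<bar>f t\<bar> \<le> M" "\<And>t. t \<in> {0..b} \<Longrightarrow> \<bar>g t\<bar> \<le> M"
    using M12 by (fastforce simp: M_def le_max_iff_disj)+
  show "\<exists>M\<ge>0. \<forall>s t. 0 \<le> s \<longrightarrow> s \<le> t \<longrightarrow> t \<le> b \<longrightarrow> \<bar>f s * g s - f t * g t\<bar> \<le>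
      M * (\<Sum>i\<in>{0, 1::nat}. \<bar>(if i = 0 then f else g) s - (if i = 0 then f else g) t\<bar>)"
  proof (intro exI[of _ M] conjI allI impI)
    fix s t assume st: "0 \<le> s" "s \<le> t" "t \<le> b"
    have "f s * g s - f t * g t = g s * (f s - f t) + f t * (g s - g t)" by (simp add: algebra_simps)
    then have "\<bar>f s * g s - f t * g t\<bar> \<le> \<bar>g s\<bar> * \<bar>f s - f t\<bar> + \<bar>f t\<bar> * \<bar>g s - g t\<bar>"
      by (metis abs_mult abs_triangle_ineq)
    also have "\<dots> \<le> M * \<bar>f s - f t\<bar> + M * \<bar>g s - g t\<bar>"
      using M(2)[of t] M(3)[of s] st by (intro add_mono mult_right_mono) auto
    also have "\<dots> = M * (\<bar>g s - g t\<bar> + \<bar>f s - f t\<bar>)" by (simp only: distrib_left add.commute)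
    finally show "\<bar>f s * g s - f t * g t\<bar> \<le>
        M * (\<Sum>i\<in>{0, 1::nat}. \<bar>(if i = 0 then f else g) s - (if i = 0 then f else g) t\<bar>)"
      by (simp add: add.commute)
  qed (fact M(1))
qed (use assms in simp_all)

lemma abs_cont_real_sum:
  assumes "finite I" "\<And>i. i \<in> I \<Longrightarrow> abs_cont_real (f i)"
  shows "abs_cont_real (\<lambda>t. \<Sum>i\<in>I. f i t)"
proof (rule locally_absolutely_continuous_dominated[where I = I and d = "\<lambda>_ x y. \<bar>x - y\<bar>" and f = f])
  show "\<exists>M\<ge>0. \<forall>s t. 0 \<le> s \<longrightarrow> s \<le> t \<longrightarrow> t \<le> b \<longrightarrow>
      \<bar>(\<Sum>i\<in>I. f i s) - (\<Sum>i\<in>I. f i t)\<bar> \<le> M * (\<Sum>i\<in>I. \<bar>f i s - f i t\<bar>)" for b :: real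
    by (intro exI[of _ 1]) (auto simp: sum_subtractf[symmetric] sum_abs)
qed (use assms in auto)

lemma continuous_derivative_abs_cont_real:
  assumes "continuous_on {0..} g'" and "\<And>t. t \<ge> 0 \<Longrightarrow> (g has_real_derivative g' t) (at t within {0..})"
  shows "abs_cont_real g"
proof (rule locally_absolutely_continuous_lipschitz)
  fix b :: real
  have "bounded (g' ` {0..b})"
    using assms(1) by (auto intro!: compact_imp_bounded compact_continuous_image intro: continuous_on_subset)
  then obtain M where M: "\<And>t. t \<in> {0..b} \<Longrightarrow> \<bar>g' t\<bar> \<le> M"
    unfolding bounded_iff by (metis imageI real_norm_def)
  show "\<exists>M\<ge>0. \<forall>s t. 0 \<le> s \<longrightarrow> s \<le> t \<longrightarrow> t \<le> b \<longrightarrow> \<bar>g s - g t\<bar> \<le> M * (t - s)"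
  proof (intro exI[of _ "max 0 M"] conjI allI impI)
    fix s t assume st: "0 \<le> s" "s \<le> t" "t \<le> b"
    have "norm (g s - g t) \<le> max 0 M * norm (s - t)"
    proof (rule field_differentiable_bound[of "{0..b}" g g'])
      show "(g has_field_derivative g' z) (at z within {0..b})" if "z \<in> {0..b}" for z
        using assms(2)[of z] that by (auto intro: DERIV_subset)
      show "norm (g' z) \<le> max 0 M" if "z \<in> {0..b}" for z
        using M[OF that] by simp
    qed (use st in auto)
    then show "\<bar>g s - g t\<bar> \<le> max 0 M * (t - s)" using st by simp
  qed simp
qed

lemma continuous_on_lipschitz_coordinates:
  fixes G :: "(nat \<Rightarrow> real) \<Rightarrow> real"
  assumes lip: "\<And>x y D. D \<ge> 0 \<Longrightarrow> (\<And>j. j < N \<Longrightarrow> \<bar>x j - y j\<bar> \<le> D) \<Longrightarrow> \<bar>G x - G y\<bar> \<le> K * D"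
    and cont: "\<And>j. j < N \<Longrightarrow> continuous_on S (\<lambda>s. w j s)"
  shows "continuous_on S (\<lambda>s. G (\<lambda>j. w j s))"
  unfolding continuous_on_def tendsto_iff
proof (intro ballI allI impI)
  fix s e assume s: "s \<in> S" and e: "(e::real) > 0"
  define D where "D = e / (\<bar>K\<bar> + 1)"
  have D: "D > 0" using e by (simp add: D_def add_nonneg_pos)
  have "\<forall>\<^sub>F t in at s within S. \<forall>j\<in>{..<N}. dist (w j t) (w j s) < D"
    using cont s D by (intro eventually_ball_finite) (auto simp: continuous_on_def tendsto_iff)
  then show "\<forall>\<^sub>F t in at s within S. dist (G (\<lambda>j. w j t)) (G (\<lambda>j. w j s)) < e"
  proof (rule eventually_mono)
    fix t assume t: "\<forall>j\<in>{..<N}. dist (w j t) (w j s) < D"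
    have "dist (G (\<lambda>j. w j t)) (G (\<lambda>j. w j s)) \<le> K * D"
      unfolding dist_real_def using t D by (intro lip) (auto simp: dist_real_def less_imp_le)
    also have "\<dots> \<le> \<bar>K\<bar> * D" using D by (simp add: mult_right_mono)
    also have "\<dots> < (\<bar>K\<bar> + 1) * D" using D by simp
    also have "\<dots> = e" by (simp add: D_def)
    finally show "dist (G (\<lambda>j. w j t)) (G (\<lambda>j. w j s)) < e" .
  qed
qed

text \<open>Since \<open>nat\<close> is discrete, \<open>UNIV \<times> {i}\<close> is a
  neighbourhood of each of its points, and on it only the time varies.\<close>

lemma continuous_on_prod_nat:
  fixes g :: "real \<times> nat \<Rightarrow> real"
  assumes "\<And>i. continuous_on UNIV (\<lambda>t. g (t, i))"
  shows "continuous_on UNIV g"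
proof -
  have "isCont g (t, i)" for t i
  proof -
    have "\<forall>\<^sub>F p in nhds (t, i). snd p = i"
      unfolding eventually_nhds
      by (intro exI[of _ "UNIV \<times> {i}"]) (auto intro!: open_Times open_discrete)
    then have "\<forall>\<^sub>F p in nhds (t, i). g (fst p, i) = g p"
      by (rule eventually_mono) (metis prod.collapse)
    moreover have "continuous_on UNIV (\<lambda>p :: real \<times> nat. g (fst p, i))"
      by (rule continuous_on_compose2[OF assms[of i] continuous_on_fst[OF continuous_on_id]]) auto
    then have "isCont (\<lambda>p. g (fst p, i)) (t, i)"
      by (simp add: continuous_on_eq_continuous_at)
    ultimately show ?thesis
      using isCont_cong[of "\<lambda>p. g (fst p, i)" g "(t, i)"] by blast
  qed
  then show ?thesis by (auto simp: continuous_on_eq_continuous_at)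
qed

section \<open>Integral equations with Lipschitz nonlinearity\<close>

lemma at_within_atLeast_eq:
  fixes t :: real
  assumes "0 \<le> t"
  shows "at t within {0..t+1} = at t within {0..}"
  by (rule at_within_nhd[of t "{..<t+1}"]) (use assms in auto)

lemma continuous_on_atLeastI:
  fixes f :: "real \<Rightarrow> real"
  assumes "\<And>b. continuous_on {0..b} f"
  shows "continuous_on {0..} f"
proof -
  have "continuous (at t within {0..}) f" if "0 \<le> t" for t
  proof -
    have "continuous (at t within {0..t+1}) f"
      using assms[of "t+1"] that by (simp add: continuous_on_eq_continuous_within)
    then show ?thesis using that by (simp only: at_within_atLeast_eq)
  qed
  then show ?thesis by (simp add: continuous_on_eq_continuous_within)
qed

lemma integral_has_derivative_atLeast:
  fixes g :: "real \<Rightarrow> real"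
  assumes "continuous_on {0..} g" "0 \<le> t"
  shows "((\<lambda>s. integral {0..s} g) has_real_derivative g t) (at t within {0..})"
proof -
  have "((\<lambda>s. integral {0..s} g) has_real_derivative g t) (at t within {0..t+1})"
    using assms by (intro integral_has_real_derivative) (auto intro: continuous_on_subset)
  then show ?thesis using assms(2) by (simp only: at_within_atLeast_eq)
qed

lemma indefinite_integral_continuous_atLeast:
  fixes g :: "real \<Rightarrow> real"
  assumes "\<And>b. g integrable_on {0..b}"
  shows "continuous_on {0..} (\<lambda>t. integral {0..t} g)"
  by (intro continuous_on_atLeastI indefinite_integral_continuous_1 assms)

lemma has_integral_exp_real:
  fixes c t :: real
  assumes "c > 0" "t \<ge> 0"
  shows "((\<lambda>s. c * exp (c * s)) has_integral (exp (c * t) - 1)) {0..t}"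
proof -
  have "((\<lambda>s. c * exp (c * s)) has_integral (exp (c * t) - exp (c * 0))) {0..t}"
    by (rule fundamental_theorem_of_calculus)
       (use assms in \<open>auto intro!: derivative_eq_intros simp flip: has_real_derivative_iff_has_vector_derivative\<close>)
  then show ?thesis by simp
qed

text \<open>The library's completeness instance needs a metric domain, but the unknowns for all indices will
  be packed into one function on \<^typ>\<open>real \<times> nat\<close>.\<close>

lemma complete_UNIV_bcontfun:
  "complete (UNIV :: ('a::topological_space \<Rightarrow>\<^sub>C 'b::complete_space) set)"
  unfolding complete_def
proof (intro allI impI, elim conjE)
  fix f :: "nat \<Rightarrow> 'a \<Rightarrow>\<^sub>C 'b"
  assume "Cauchy f"
  have "\<exists>M. \<forall>m n x. M \<le> m \<and> M \<le> n \<longrightarrow> dist (f m x) (f n x) < e" if "e > 0" for e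
    using \<open>Cauchy f\<close> that dist_fun_lt_imp_dist_val_lt unfolding Cauchy_def by meson
  then obtain g where "uniform_limit UNIV (\<lambda>n. apply_bcontfun (f n)) g sequentially"
    using uniformly_convergent_eq_cauchy[of "\<lambda>_. True" "\<lambda>n. apply_bcontfun (f n)"]
    unfolding uniform_limit_sequentially_iff by auto
  from uniform_limit_bcontfunE[OF this sequentially_bot] obtain l where "f \<longlonglongrightarrow> l" by metis
  then show "\<exists>l\<in>UNIV. f \<longlonglongrightarrow> l" by blast
qed

text \<open>Picard's map in the supremum of \<open>exp (- (2 * K * t)) * \<bar>u i t\<bar>\<close>
  over times and indices. Since \<open>K\<close> times the integral of
  \<open>exp (2 * K * s)\<close> up to \<open>t\<close> is below \<open>exp (2 * K * t) / 2\<close>,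
  the contraction factor is 1/2 on the whole half line, and no local solutions have to be glued. The
  growth condition on \<open>F\<close> and the hypothesis \<open>A0\<close> keep the iteration in
  the weighted space. All bounds are uniform in the index because the supremum runs over it,
  too.\<close>

lemma lipschitz_integral_equation_solution:
  fixes A :: "(nat \<Rightarrow> real) \<Rightarrow> nat \<Rightarrow> real" and F :: "nat \<Rightarrow> real \<Rightarrow> real"
  assumes "K > 0"
    and lip: "\<And>x y D i. D \<ge> 0 \<Longrightarrow> (\<And>j. j < N \<Longrightarrow> \<bar>x j - y j\<bar> \<le> D) \<Longrightarrow> \<bar>A x i - A y i\<bar> \<le> K * D"
    and A0: "\<And>i. A (\<lambda>_. 0) i = 0"
    and F: "\<And>i. continuous_on {0..} (F i)" "\<And>i t. t \<ge> 0 \<Longrightarrow> \<bar>F i t\<bar> \<le> M * exp (2 * K * t)"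
  obtains u where "\<And>i. continuous_on {0..} (u i)"
    "\<And>i t. t \<ge> 0 \<Longrightarrow> u i t = F i t - integral {0..t} (\<lambda>s. A (\<lambda>j. u j s) i)"
proof -
  \<comment> \<open>The fixed point \<open>w\<close> will be the weighted unknown; the factor undoes
    the weight before \<open>A\<close> is applied.\<close>
  define h where "h w i s = A (\<lambda>j. exp (2 * K * s) * apply_bcontfun w (s, j)) i"
    for w :: "(real \<times> nat) \<Rightarrow>\<^sub>C real" and i s
  have wc: "continuous_on S (\<lambda>s. apply_bcontfun w (s, j))" for w :: "(real \<times> nat) \<Rightarrow>\<^sub>C real" and j S
    by (intro continuous_on_compose2[OF continuous_on_apply_bcontfun[of UNIV w]] continuous_intros) auto
  have hc: "continuous_on S (h w i)" for w i S
    unfolding h_def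
    by (rule continuous_on_lipschitz_coordinates[where N = N and K = K and G = "\<lambda>x. A x i"])
       (use lip in \<open>auto intro!: continuous_intros wc\<close>)
  have hd: "\<bar>h w i s - h v i s\<bar> \<le> dist w v / 2 * (2 * K * exp (2 * K * s))" for w v i s
  proof -
    have "\<bar>h w i s - h v i s\<bar> \<le> K * (exp (2 * K * s) * dist w v)"
      unfolding h_def
    proof (rule lip)
      fix j
      have "\<bar>apply_bcontfun w (s, j) - apply_bcontfun v (s, j)\<bar> \<le> dist w v"
        using dist_bounded[of w "(s, j)" v] by (simp add: dist_real_def)
      then show "\<bar>exp (2 * K * s) * apply_bcontfun w (s, j) - exp (2 * K * s) * apply_bcontfun v (s, j)\<bar>
          \<le> exp (2 * K * s) * dist w v"
        by (simp add: abs_mult flip: right_diff_distrib)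
    qed simp
    then show ?thesis by (simp add: mult_ac)
  qed
  have Id: "\<bar>integral {0..t} (h w i) - integral {0..t} (h v i)\<bar> \<le> dist w v / 2 * exp (2 * K * t)"
    if "t \<ge> 0" for w v i t
  proof -
    have E: "((\<lambda>s. dist w v / 2 * (2 * K * exp (2 * K * s))) has_integral
        (dist w v / 2 * (exp (2 * K * t) - 1))) {0..t}"
      by (intro has_integral_mult_right has_integral_exp_real) (use that \<open>K > 0\<close> in auto)
    have int: "h w i integrable_on {0..t}" "h v i integrable_on {0..t}"
      by (auto intro!: integrable_continuous_real hc)
    have "norm (integral {0..t} (\<lambda>s. h w i s - h v i s)) \<le> integral {0..t} (\<lambda>s. dist w v / 2 * (2 * K * exp (2 * K * s)))"
      using hd E int by (intro integral_norm_bound_integral) (auto intro: integrable_diff)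
    also have "\<dots> = dist w v / 2 * (exp (2 * K * t) - 1)" using E by (rule integral_unique)
    also have "\<dots> \<le> dist w v / 2 * exp (2 * K * t)" by (intro mult_left_mono) auto
    finally show ?thesis using int by (simp add: integral_diff)
  qed
  have h0: "h 0 i = (\<lambda>_. 0)" for i by (simp add: fun_eq_iff h_def A0 zero_bcontfun.rep_eq)
  \<comment> \<open>Cutting the time at 0 extends the iterate constantly to negative times, since
    elements of the function space live on all of \<open>real \<times> nat\<close>.\<close>
  define \<Phi> where "\<Phi> w p = exp (- (2 * K * max 0 (fst p))) *
      (F (snd p) (max 0 (fst p)) - integral {0..max 0 (fst p)} (h w (snd p)))" for w and p :: "real \<times> nat"
  have exp_cancel: "exp (- (2 * K * t)) * (c * exp (2 * K * t)) = c" for c t :: real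
    by (simp add: exp_minus)
  have \<Phi>_bcf: "\<Phi> w \<in> bcontfun" for w
    unfolding bcontfun_def
  proof (intro CollectI conjI)
    show "continuous_on UNIV (\<Phi> w)"
    proof (rule continuous_on_prod_nat)
      fix i
      have m: "continuous_on UNIV (\<lambda>t::real. max 0 t)" by (intro continuous_intros)
      have "continuous_on {0..} (\<lambda>t. integral {0..t} (h w i))"
        by (intro indefinite_integral_continuous_atLeast integrable_continuous_real hc)
      then have c: "continuous_on {0..} (\<lambda>t. F i t - integral {0..t} (h w i))"
        using F(1)[of i] by (intro continuous_intros)
      have "continuous_on UNIV (\<lambda>t. F i (max 0 t) - integral {0..max 0 t} (h w i))"
        by (rule continuous_on_compose2[OF c m]) auto
      then show "continuous_on UNIV (\<lambda>t. \<Phi> w (t, i))"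
        by (auto simp: \<Phi>_def intro!: continuous_intros)
    qed
    show "bounded (range (\<Phi> w))"
      unfolding bounded_iff
    proof (intro exI[of _ "M + dist w 0 / 2"] ballI, clarify)
      fix t i
      let ?t = "max 0 t :: real"
      have "\<bar>integral {0..?t} (h w i)\<bar> \<le> dist w 0 / 2 * exp (2 * K * ?t)"
        using Id[of ?t w i 0] by (simp add: h0)
      moreover have "\<bar>F i ?t\<bar> \<le> M * exp (2 * K * ?t)" by (rule F) simp
      ultimately have "\<bar>F i ?t - integral {0..?t} (h w i)\<bar> \<le> (M + dist w 0 / 2) * exp (2 * K * ?t)"
        by (simp only: distrib_right) linarith
      then have "exp (- (2 * K * ?t)) * \<bar>F i ?t - integral {0..?t} (h w i)\<bar> \<le>
          exp (- (2 * K * ?t)) * ((M + dist w 0 / 2) * exp (2 * K * ?t))"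
        by (intro mult_left_mono) auto
      then show "norm (\<Phi> w (t, i)) \<le> M + dist w 0 / 2"
        unfolding exp_cancel \<Phi>_def by (simp add: abs_mult)
    qed
  qed
  define T where "T w = Bcontfun (\<Phi> w)" for w
  have T: "apply_bcontfun (T w) = \<Phi> w" for w
    using \<Phi>_bcf by (simp add: T_def Bcontfun_inverse)
  have "dist (T w) (T v) \<le> 1/2 * dist w v" for w v
  proof (rule dist_bound)
    fix p
    obtain t :: real and i :: nat where p: "p = (t, i)" by force
    let ?t = "max 0 t :: real"
    have "dist (T w p) (T v p) = exp (- (2 * K * ?t)) * \<bar>integral {0..?t} (h w i) - integral {0..?t} (h v i)\<bar>"
      by (simp add: T \<Phi>_def p dist_real_def abs_mult abs_minus_commute flip: right_diff_distrib)
    also have "\<dots> \<le> exp (- (2 * K * ?t)) * (dist w v / 2 * exp (2 * K * ?t))"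
      by (intro mult_left_mono Id) auto
    finally show "dist (T w p) (T v p) \<le> 1/2 * dist w v"
      unfolding exp_cancel by simp
  qed
  then obtain w where w: "T w = w"
    using Banach_fix[OF complete_UNIV_bcontfun, of "1/2" T] by auto
  have w_eq: "apply_bcontfun w (t, i) = exp (- (2 * K * t)) * (F i t - integral {0..t} (h w i))"
    if "t \<ge> 0" for t i
    using that T[of w] by (simp add: w \<Phi>_def max_def)
  show thesis
  proof (rule that[of "\<lambda>i t. exp (2 * K * t) * apply_bcontfun w (t, i)"])
    show "continuous_on {0..} (\<lambda>t. exp (2 * K * t) * apply_bcontfun w (t, i))" for i
      by (intro continuous_intros wc)
    show "exp (2 * K * t) * apply_bcontfun w (t, i) =
        F i t - integral {0..t} (\<lambda>s. A (\<lambda>j. exp (2 * K * s) * apply_bcontfun w (s, j)) i)"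
      if "t \<ge> 0" for i t
      using that by (simp add: w_eq h_def[abs_def] exp_minus)
  qed
qed

lemma indefinite_integral_abs_cont_real:
  fixes h :: "real \<Rightarrow> real"
  assumes h: "\<And>a b. h integrable_on {a..b}" "\<And>t. \<bar>h t\<bar> \<le> C"
  shows "abs_cont_real (\<lambda>s. integral {0..s} h)"
proof (rule locally_absolutely_continuous_lipschitz)
  show "\<exists>M\<ge>0. \<forall>s t. 0 \<le> s \<longrightarrow> s \<le> t \<longrightarrow> t \<le> b \<longrightarrow> \<bar>integral {0..s} h - integral {0..t} h\<bar> \<le> M * (t - s)" for b
  proof (intro exI[of _ C] conjI allI impI)
    fix s t :: real assume st: "0 \<le> s" "s \<le> t"
    have "integral {0..s} h + integral {s..t} h = integral {0..t} h"
      using st h by (intro Henstock_Kurzweil_Integration.integral_combine) auto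
    moreover have "norm (integral {s..t} h) \<le> integral {s..t} (\<lambda>_. C)"
      using h by (intro integral_norm_bound_integral) auto
    then have "norm (integral {s..t} h) \<le> C * (t - s)"
      using st by (simp add: mult.commute)
    ultimately show "\<bar>integral {0..s} h - integral {0..t} h\<bar> \<le> C * (t - s)"
      by simp
  qed (use h(2)[of 0] in linarith)
qed

lemma abs_cont_real_const: "abs_cont_real (\<lambda>_. k)"
  by (rule locally_absolutely_continuous_lipschitz) auto

lemma energy_bound:
  fixes c h p :: "nat \<Rightarrow> real \<Rightarrow> real" and C \<mu> :: real
  assumes "\<mu> > 0"
    and h: "\<And>i a b. i < N \<Longrightarrow> h i integrable_on {a..b}" "\<And>i t. i < N \<Longrightarrow> \<bar>h i t\<bar> \<le> C"
    and p: "\<And>i. i < N \<Longrightarrow> continuous_on {0..} (p i)"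
    and coercive: "\<And>t. t \<ge> 0 \<Longrightarrow> \<mu> * (\<Sum>i<N. (c i t)\<^sup>2) \<le> (\<Sum>i<N. p i t * c i t)"
    and c: "\<And>i t. i < N \<Longrightarrow> t \<ge> 0 \<Longrightarrow> c i t = c i 0 + integral {0..t} (h i) - integral {0..t} (p i)"
    and "t \<ge> 0"
  shows "(\<Sum>i<N. (c i t)\<^sup>2) \<le> exp (- \<mu> * t) * (\<Sum>i<N. (c i 0)\<^sup>2) + real N * C\<^sup>2 / \<mu>\<^sup>2"
proof (cases "t = 0")
  case True
  then show ?thesis by simp
next
  case False
  with \<open>t \<ge> 0\<close> have "t > 0" by simp
  \<comment> \<open>The right-hand side of the integral equation, which is absolutely continuous
    term by term; it agrees with \<open>c\<close> at nonnegative times.\<close>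
  define g where "g i s = c i 0 + integral {0..s} (h i) - integral {0..s} (p i)" for i s
  have gc: "g i s = c i s" if "i < N" "s \<ge> 0" for i s using c[OF that] by (simp add: g_def)
  \<comment> \<open>The stationary level of the limiting equation
    \<open>Y' = - \<mu> * Y + \<mu> * R\<close>.\<close>
  define R where "R = real N * C\<^sup>2 / \<mu>\<^sup>2"
  define Y where "Y s = (\<Sum>i<N. g i s * g i s)" for s
  define z where "z s = exp (\<mu> * s) * (Y s + - R)" for s
  have hac: "abs_cont_real (\<lambda>s. integral {0..s} (h i))" if "i < N" for i
    by (rule indefinite_integral_abs_cont_real[of _ C]) (use h that in auto)
  have pac: "abs_cont_real (\<lambda>s. integral {0..s} (p i))" if "i < N" for i
    by (rule continuous_derivative_abs_cont_real[OF p[OF that]])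
       (rule integral_has_derivative_atLeast[OF p[OF that]])
  have gac: "abs_cont_real (g i)" if "i < N" for i
  proof -
    have "abs_cont_real (\<lambda>s. (c i 0 + integral {0..s} (h i)) + (-1) * integral {0..s} (p i))"
      by (intro abs_cont_real_add abs_cont_real_mult abs_cont_real_const hac pac continuous_intros that
          indefinite_integral_continuous_atLeast integrable_continuous_real continuous_on_subset[OF p]) auto
    then show ?thesis by (simp add: g_def[abs_def])
  qed
  have gcont: "continuous_on {0..} (g i)" if "i < N" for i
    unfolding g_def
    by (intro continuous_intros indefinite_integral_continuous_atLeast integrable_continuous_real
        continuous_on_subset[OF p] h that) auto
  have eac: "abs_cont_real (\<lambda>s. exp (\<mu> * s))"
    by (rule continuous_derivative_abs_cont_real[where g' = "\<lambda>s. \<mu> * exp (\<mu> * s)"])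
       (auto intro!: continuous_intros derivative_eq_intros)
  have "abs_cont_real Y"
    unfolding Y_def by (intro abs_cont_real_sum abs_cont_real_mult gac gcont) auto
  moreover have "continuous_on {0..} Y"
    unfolding Y_def by (intro continuous_intros gcont) auto
  ultimately have zac: "abs_cont_real z"
    unfolding z_def by (intro abs_cont_real_mult eac abs_cont_real_add abs_cont_real_const continuous_intros)
  have "\<exists>S. negligible S \<and> (\<forall>s>0. s \<notin> S \<longrightarrow> ((\<lambda>s. integral {0..s} (h i)) has_real_derivative h i s) (at s))"
    if "i < N" for i
    using indefinite_integral_ae_derivative[OF h(1)[OF that]] by metis
  then obtain S where S: "\<And>i. i < N \<Longrightarrow> negligible (S i)"
    "\<And>i s. i < N \<Longrightarrow> s > 0 \<Longrightarrow> s \<notin> S i \<Longrightarrow> ((\<lambda>s. integral {0..s} (h i)) has_real_derivative h i s) (at s)"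
    by metis
  have "z t \<le> z 0"
  proof (rule abs_cont_nonincreasing[OF zac _ \<open>t > 0\<close>])
    show "negligible (\<Union>i<N. S i)" using S(1) by (intro negligible_Union) auto
    fix s assume s: "0 < s" "s \<notin> (\<Union>i<N. S i)"
    have der: "(g i has_real_derivative (h i s - p i s)) (at s)" if "i < N" for i
    proof -
      have "((\<lambda>s. integral {0..s} (p i)) has_real_derivative p i s) (at s within {0..})"
        using p that s by (intro integral_has_derivative_atLeast) auto
      moreover have "at s within {0..} = at s"
        by (rule at_within_interior) (use s in auto)
      ultimately show ?thesis
        unfolding g_def using S(2)[OF that s(1)] s that
        by (auto intro!: derivative_eq_intros)
    qed
    have Yder: "(Y has_real_derivative (\<Sum>i<N. 2 * g i s * (h i s - p i s))) (at s)"
      unfolding Y_def by (auto intro!: derivative_eq_intros der sum.cong)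
    let ?Y' = "\<Sum>i<N. 2 * g i s * (h i s - p i s)"
    have zder: "(z has_real_derivative (exp (\<mu> * s) * (\<mu> * (Y s - R) + ?Y'))) (at s)"
      unfolding z_def by (rule derivative_eq_intros Yder refl | simp add: algebra_simps)+
    have "?Y' \<le> (\<Sum>i<N. \<mu> * (g i s)\<^sup>2 + C\<^sup>2 / \<mu> - 2 * (p i s * g i s))"
    proof (rule sum_mono)
      fix i assume "i \<in> {..<N}"
      then have "(h i s)\<^sup>2 \<le> C\<^sup>2" using h(2)[of i s] by (simp add: abs_le_square_iff[symmetric])
      then have "(h i s)\<^sup>2 / \<mu> \<le> C\<^sup>2 / \<mu>" using \<open>\<mu> > 0\<close> by (simp add: divide_right_mono)
      \<comment> \<open>Young's inequality with weight \<mu>: half of the dissipation is spent on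
        absorbing the data, the other half yields the decay rate.\<close>
      moreover have "0 \<le> (\<mu> * g i s - h i s)\<^sup>2 / \<mu>" using \<open>\<mu> > 0\<close> by simp
      then have "2 * g i s * h i s \<le> \<mu> * (g i s)\<^sup>2 + (h i s)\<^sup>2 / \<mu>"
        using \<open>\<mu> > 0\<close> by (simp add: power2_eq_square field_simps)
      ultimately show "2 * g i s * (h i s - p i s) \<le> \<mu> * (g i s)\<^sup>2 + C\<^sup>2 / \<mu> - 2 * (p i s * g i s)"
        by (simp add: algebra_simps)
    qed
    also have "\<dots> = \<mu> * Y s + \<mu> * R - 2 * (\<Sum>i<N. p i s * g i s)"
      using \<open>\<mu> > 0\<close>
      by (simp add: sum.distrib sum_subtractf sum_distrib_left Y_def R_def power2_eq_square)
    also have "(\<Sum>i<N. p i s * g i s) = (\<Sum>i<N. p i s * c i s)"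
      using s by (intro sum.cong) (auto simp: gc)
    also have "\<mu> * Y s + \<mu> * R - 2 * (\<Sum>i<N. p i s * c i s) \<le> \<mu> * Y s + \<mu> * R - 2 * (\<mu> * Y s)"
    proof -
      have "Y s = (\<Sum>i<N. (c i s)\<^sup>2)" unfolding Y_def power2_eq_square using s by (intro sum.cong) (auto simp: gc)
      then show ?thesis using coercive[of s] s by simp
    qed
    finally have "\<mu> * (Y s - R) + ?Y' \<le> 0" by (simp add: algebra_simps)
    then show "\<exists>D\<le>0. (z has_real_derivative D) (at s)"
      using zder by (intro exI[of _ "exp (\<mu> * s) * (\<mu> * (Y s - R) + ?Y')"]) (simp add: mult_nonneg_nonpos)
  qed
  then have "exp (\<mu> * t) * (Y t - R) \<le> Y 0 - R" by (simp add: z_def)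
  then have "exp (- \<mu> * t) * (exp (\<mu> * t) * (Y t - R)) \<le> exp (- \<mu> * t) * (Y 0 - R)"
    by (intro mult_left_mono) auto
  moreover have "exp (- \<mu> * t) * (exp (\<mu> * t) * q) = q" for q
    by (simp add: exp_minus)
  ultimately have "Y t - R \<le> exp (- \<mu> * t) * Y 0 - exp (- \<mu> * t) * R"
    by (simp only: right_diff_distrib)
  moreover have "0 \<le> exp (- \<mu> * t) * R" by (simp add: R_def)
  ultimately have "Y t \<le> exp (- \<mu> * t) * Y 0 + R" by linarith
  moreover have "Y s = (\<Sum>i<N. (c i s)\<^sup>2)" if "s \<ge> 0" for s
    unfolding Y_def power2_eq_square using that by (intro sum.cong) (auto simp: gc)
  ultimately show ?thesis using \<open>t \<ge> 0\<close> by (simp add: R_def)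
qed

section \<open>The coercive system in coordinates\<close>

text \<open>The model is the stiffness matrix of an \<open>L\<^sup>2\<close>-orthonormal basis: the
  sum of squares is then the squared \<open>L\<^sup>2\<close> norm, and \<open>coercive\<close> is
  the Poincare inequality.\<close>

locale coercive_matrix =
  fixes N :: nat and a :: "nat \<Rightarrow> nat \<Rightarrow> real" and \<mu> :: real
  assumes sym: "a i j = a j i"
    and mu_pos: "\<mu> > 0"
    and coercive: "\<mu> * (\<Sum>i<N. (x i)\<^sup>2) \<le> (\<Sum>i<N. \<Sum>j<N. a i j * x i * x j)"
begin

definition form :: "(nat \<Rightarrow> real) \<Rightarrow> (nat \<Rightarrow> real) \<Rightarrow> real" where
  "form x y = (\<Sum>i<N. \<Sum>j<N. a i j * x i * y j)"

definition lin :: "(nat \<Rightarrow> real) \<Rightarrow> nat \<Rightarrow> real" where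
  "lin x i = (\<Sum>j<N. a i j * x j)"

definition kop :: "(nat \<Rightarrow> real) \<Rightarrow> nat \<Rightarrow> real" where
  "kop x i = (1 + form x x) * lin x i"

text \<open>A crude substitute for the operator norm of the matrix; it bounds both
  \<open>form\<close> and \<open>lin\<close>.\<close>

definition abs_sum :: real where "abs_sum = (\<Sum>i<N. \<Sum>j<N. \<bar>a i j\<bar>)"

lemma abs_sum_nonneg: "abs_sum \<ge> 0"
  unfolding abs_sum_def by (intro sum_nonneg) auto

lemma form_sym: "form x y = form y x"
  unfolding form_def by (subst sum.swap) (simp add: sym mult_ac)

lemma form_lin: "form x y = (\<Sum>i<N. lin x i * y i)"
proof -
  have "form x y = (\<Sum>i<N. \<Sum>j<N. a i j * x j * y i)"
    unfolding form_def by (subst sum.swap) (simp add: sym mult_ac)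
  then show ?thesis by (simp add: lin_def sum_distrib_right)
qed

lemma form_diff: "form (\<lambda>i. x i - y i) z = form x z - form y z"
  unfolding form_def by (simp add: algebra_simps sum_subtractf)

lemma form_diff': "form z (\<lambda>i. x i - y i) = form z x - form z y"
  using form_diff form_sym by metis

lemma lin_diff: "lin (\<lambda>i. x i - y i) i = lin x i - lin y i"
  unfolding lin_def by (simp add: algebra_simps sum_subtractf)

lemma form_coercive: "\<mu> * (\<Sum>i<N. (x i)\<^sup>2) \<le> form x x"
  unfolding form_def by (rule coercive)

lemma form_nonneg: "form x x \<ge> 0"
  using form_coercive[of x] mu_pos by (meson less_imp_le mult_nonneg_nonneg order_trans sum_nonneg zero_le_power2)

lemma abs_form_le:
  assumes "\<And>i. i < N \<Longrightarrow> \<bar>x i\<bar> \<le> X" "\<And>i. i < N \<Longrightarrow> \<bar>y i\<bar> \<le> Y"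
  shows "\<bar>form x y\<bar> \<le> abs_sum * X * Y"
proof -
  have "\<bar>form x y\<bar> \<le> (\<Sum>i<N. \<Sum>j<N. \<bar>a i j * x i * y j\<bar>)"
    unfolding form_def by (rule order_trans[OF sum_abs sum_mono[OF sum_abs]])
  also have "\<dots> \<le> (\<Sum>i<N. \<Sum>j<N. \<bar>a i j\<bar> * X * Y)"
  proof (intro sum_mono)
    fix i j assume "i \<in> {..<N}" "j \<in> {..<N}"
    then have "\<bar>x i\<bar> \<le> X" "\<bar>y j\<bar> \<le> Y" using assms by auto
    then show "\<bar>a i j * x i * y j\<bar> \<le> \<bar>a i j\<bar> * X * Y"
      unfolding abs_mult by (intro mult_mono) auto
  qed
  also have "\<dots> = abs_sum * X * Y" by (simp add: abs_sum_def sum_distrib_right)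
  finally show ?thesis .
qed

lemma abs_lin_le:
  assumes "i < N" "\<And>i. i < N \<Longrightarrow> \<bar>x i\<bar> \<le> X"
  shows "\<bar>lin x i\<bar> \<le> abs_sum * X"
proof -
  have "X \<ge> 0" using assms(2)[OF assms(1)] by linarith
  have "\<bar>lin x i\<bar> \<le> (\<Sum>j<N. \<bar>a i j * x j\<bar>)"
    unfolding lin_def by (rule sum_abs)
  also have "\<dots> \<le> (\<Sum>j<N. \<bar>a i j\<bar> * X)"
    unfolding abs_mult using assms by (intro sum_mono mult_left_mono) auto
  also have "\<dots> = (\<Sum>j<N. \<bar>a i j\<bar>) * X" by (simp add: sum_distrib_right)
  also have "\<dots> \<le> abs_sum * X"
    unfolding abs_sum_def using \<open>X \<ge> 0\<close> \<open>i < N\<close>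
    by (intro mult_right_mono member_le_sum[where f = "\<lambda>i. \<Sum>j<N. \<bar>a i j\<bar>"] sum_nonneg) auto
  finally show ?thesis .
qed

text \<open>The counterpart of an inverse inequality: it turns the energy bound on the sum of
  squares into a bound on the squared gradient norm, on which the freezing depends.\<close>

lemma form_le: "form x x \<le> abs_sum * (\<Sum>i<N. (x i)\<^sup>2)"
proof -
  let ?X = "sqrt (\<Sum>i<N. (x i)\<^sup>2)"
  have "\<bar>x i\<bar> \<le> ?X" if "i < N" for i
    using member_le_sum[of i "{..<N}" "\<lambda>i. (x i)\<^sup>2"] that by (intro real_le_rsqrt) auto
  then have "\<bar>form x x\<bar> \<le> abs_sum * ?X * ?X" by (intro abs_form_le) auto
  also have "\<dots> = abs_sum * (\<Sum>i<N. (x i)\<^sup>2)"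
    by (simp add: mult.assoc sum_nonneg)
  finally show ?thesis by simp
qed

text \<open>\<open>kop\<close> is the gradient of the convex function
  \<open>form x x / 2 + (form x x)\<^sup>2 / 4\<close>. Explicitly, with \<open>d = x - y\<close>,
  its cubic part tested with \<open>d\<close> equals half of
  \<open>(form x x + form y y) * form d d\<close> plus half of
  \<open>(form x x - form y y)\<^sup>2\<close>, both nonnegative, and the linear part contributes
  \<open>form d d\<close>.\<close>

lemma kop_strongly_monotone:
  "\<mu> * (\<Sum>i<N. (x i - y i)\<^sup>2) \<le> (\<Sum>i<N. (kop x i - kop y i) * (x i - y i))"
proof -
  let ?d = "\<lambda>i. x i - y i"
  have "(\<Sum>i<N. (kop x i - kop y i) * ?d i) =
      (1 + form x x) * form x ?d - (1 + form y y) * form y ?d"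
    by (simp add: kop_def form_lin[of _ ?d] sum_distrib_left sum_subtractf[symmetric] algebra_simps)
  also have "\<dots> = form ?d ?d + (form x x + form y y) * form ?d ?d / 2 + (form x x - form y y)\<^sup>2 / 2"
    by (simp add: form_diff form_diff' form_sym[of y x] power2_eq_square field_simps)
  also have "\<dots> \<ge> form ?d ?d"
    using form_nonneg[of x] form_nonneg[of y] form_nonneg[of ?d] by simp
  finally show ?thesis using form_coercive[of ?d] by linarith
qed

lemma kop_cong:
  assumes "\<And>j. j < N \<Longrightarrow> x j = y j"
  shows "kop x i = kop y i"
proof -
  have "form x x = form y y" unfolding form_def by (intro sum.cong refl) (simp add: assms)
  moreover have "lin x i = lin y i" unfolding lin_def by (intro sum.cong refl) (simp add: assms)
  ultimately show ?thesis by (simp add: kop_def)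
qed

lemma kop_continuous:
  assumes "\<And>i. i < N \<Longrightarrow> continuous_on S (c i)" "i < N"
  shows "continuous_on S (\<lambda>s. kop (\<lambda>j. c j s) i)"
  unfolding kop_def form_def lin_def using assms by (intro continuous_intros) auto

text \<open>Beyond \<open>form x x = M\<close> the nonlinear coefficient is frozen. This makes the operator globally
  Lipschitz and keeps the energy estimate, so that solutions never reach the modified region.\<close>

definition trunc :: "real \<Rightarrow> (nat \<Rightarrow> real) \<Rightarrow> nat \<Rightarrow> real" where
  "trunc M x i = (if i < N then (1 + min (form x x) M) * lin x i else 0)"

lemma trunc_lipschitz:
  assumes "M \<ge> 0"
  obtains K where "K \<ge> 1" "\<And>x y D i. D \<ge> 0 \<Longrightarrow> (\<And>j. j < N \<Longrightarrow> \<bar>x j - y j\<bar> \<le> D) \<Longrightarrow>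
    \<bar>trunc M x i - trunc M y i\<bar> \<le> K * D"
proof -
  \<comment> \<open>Coercivity confines the unfrozen region \<open>form y y \<le> M\<close> to
    coordinates of size at most \<open>r\<close>.\<close>
  define r where "r = sqrt (M / \<mu>)"
  have "r \<ge> 0" using assms mu_pos by (simp add: r_def)
  define L where "L = 2 * abs_sum * r + abs_sum + M"
  \<comment> \<open>The leading 1 yields \<open>K \<ge> 1\<close>, with which the exponential weight
    dominates the linear growth of the integrated data in \<open>solves_exists\<close>.\<close>
  define K where "K = 1 + abs_sum + M * abs_sum + L * abs_sum * r"
  note S = abs_sum_nonneg
  have "L \<ge> 0" using S \<open>r \<ge> 0\<close> assms by (simp add: L_def)
  then have "K \<ge> 1" using S \<open>r \<ge> 0\<close> assms by (simp add: K_def)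
  \<comment> \<open>Only \<open>y\<close> is supposed to lie in the unfrozen region. The difference
    of the coefficients is therefore paired with \<open>lin y\<close>, which is bounded there, and
    the coefficient at \<open>x\<close> is at most \<open>M\<close> anyway.\<close>
  have main: "\<bar>min (form x x) M * lin x i - min (form y y) M * lin y i\<bar> \<le> (M * abs_sum + L * abs_sum * r) * D"
    if D: "D \<ge> 0" "\<And>j. j < N \<Longrightarrow> \<bar>x j - y j\<bar> \<le> D" and "i < N" and y: "form y y \<le> M" for x y D i
  proof -
    let ?d = "\<lambda>i. x i - y i"
    have y_le: "\<bar>y j\<bar> \<le> r" if "j < N" for j
    proof -
      have "\<mu> * (y j)\<^sup>2 \<le> \<mu> * (\<Sum>i<N. (y i)\<^sup>2)"
        using member_le_sum[of j "{..<N}" "\<lambda>i. (y i)\<^sup>2"] that mu_pos by (intro mult_left_mono) auto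
      also have "\<dots> \<le> M" using form_coercive[of y] y by linarith
      finally have "(y j)\<^sup>2 \<le> M / \<mu>" using mu_pos by (simp add: pos_le_divide_eq mult.commute)
      then show ?thesis unfolding r_def by (intro real_le_rsqrt) simp
    qed
    have "\<bar>min (form x x) M - min (form y y) M\<bar> \<le> L * D"
    \<comment> \<open>For small \<open>D\<close> the quadratic part of the difference is at most
      linear in \<open>D\<close>; for large \<open>D\<close> the cut-off already bounds the
      difference by \<open>M\<close>.\<close>
    proof (cases "D \<le> 1")
      case True
      have "form x x - form y y = 2 * form y ?d + form ?d ?d"
        by (simp add: form_diff form_diff' form_sym[of y x])
      then have "\<bar>form x x - form y y\<bar> \<le> 2 * (abs_sum * r * D) + abs_sum * D * D"
        using abs_form_le[of y r ?d D] abs_form_le[of ?d D ?d D] y_le D by auto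
      also have "abs_sum * D * D \<le> abs_sum * D * 1" using S D(1) True by (intro mult_left_mono) auto
      also have "2 * (abs_sum * r * D) + abs_sum * D * 1 \<le> L * D"
        using assms D(1) by (simp add: L_def algebra_simps)
      finally show ?thesis by (auto simp: min_def abs_if split: if_splits)
    next
      case False
      have "\<bar>min (form x x) M - min (form y y) M\<bar> \<le> M"
        using form_nonneg[of x] form_nonneg[of y] assms by (auto simp: min_def abs_if)
      also have "M \<le> M * D" using False assms by (simp add: mult_le_cancel_left1)
      also have "\<dots> \<le> L * D" using S \<open>r \<ge> 0\<close> D(1) by (intro mult_right_mono) (auto simp: L_def)
      finally show ?thesis .
    qed
    then have 1: "\<bar>(min (form x x) M - min (form y y) M) * lin y i\<bar> \<le> (L * D) * (abs_sum * r)"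
      unfolding abs_mult using abs_lin_le[OF \<open>i < N\<close>, of y r] y_le \<open>L \<ge> 0\<close> D(1) by (intro mult_mono) auto
    have 2: "\<bar>min (form x x) M * lin ?d i\<bar> \<le> M * (abs_sum * D)"
      unfolding abs_mult using abs_lin_le[OF \<open>i < N\<close>, of ?d D] D form_nonneg[of x] assms
      by (intro mult_mono) auto
    have "min (form x x) M * lin x i - min (form y y) M * lin y i =
        min (form x x) M * lin ?d i + (min (form x x) M - min (form y y) M) * lin y i"
      by (simp add: lin_diff algebra_simps)
    also have "\<bar>\<dots>\<bar> \<le> M * (abs_sum * D) + (L * D) * (abs_sum * r)"
      using 1 2 by linarith
    finally show ?thesis by (simp add: algebra_simps)
  qed
  show thesis
  proof (rule that[OF \<open>K \<ge> 1\<close>])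
    fix x y :: "nat \<Rightarrow> real" and D i assume D: "D \<ge> 0" "\<And>j. j < N \<Longrightarrow> \<bar>x j - y j\<bar> \<le> D"
    show "\<bar>trunc M x i - trunc M y i\<bar> \<le> K * D"
    proof (cases "i < N")
      case True
      let ?d = "\<lambda>i. x i - y i"
      have lin: "\<bar>lin ?d i\<bar> \<le> abs_sum * D" using abs_lin_le[OF True, of ?d D] D by auto
      have "\<bar>min (form x x) M * lin x i - min (form y y) M * lin y i\<bar> \<le> (M * abs_sum + L * abs_sum * r) * D"
      proof -
        \<comment> \<open>By symmetry \<open>main\<close> applies as soon as one of the points is
          unfrozen; between two frozen points the difference is linear.\<close>
        consider "form y y \<le> M" | "form x x \<le> M" | "form y y > M" "form x x > M" by linarith
        then show ?thesis
        proof cases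
          case 1 show ?thesis by (rule main[of D x y i, OF D True 1])
        next
          case 2
          have "\<And>j. j < N \<Longrightarrow> \<bar>y j - x j\<bar> \<le> D" using D(2) by (simp add: abs_minus_commute)
          from main[of D y x i, OF D(1) this True 2] show ?thesis by (simp add: abs_minus_commute)
        next
          case 3
          then have "min (form x x) M * lin x i - min (form y y) M * lin y i = M * lin ?d i"
            by (simp add: lin_diff algebra_simps)
          also have "\<bar>\<dots>\<bar> \<le> M * (abs_sum * D)"
            unfolding abs_mult using lin assms by (intro mult_mono) auto
          also have "\<dots> \<le> (M * abs_sum + L * abs_sum * r) * D"
            using \<open>L \<ge> 0\<close> S \<open>r \<ge> 0\<close> D(1) by (simp add: algebra_simps)
          finally show ?thesis .
        qed
      qed
      moreover have "trunc M x i - trunc M y i =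
          lin ?d i + (min (form x x) M * lin x i - min (form y y) M * lin y i)"
        using True by (simp add: trunc_def lin_diff algebra_simps)
      ultimately have "\<bar>trunc M x i - trunc M y i\<bar> \<le> abs_sum * D + (M * abs_sum + L * abs_sum * r) * D"
        using lin by linarith
      also have "\<dots> \<le> K * D" using D(1) by (simp add: K_def algebra_simps)
      finally show ?thesis .
    qed (use \<open>K \<ge> 1\<close> D in \<open>simp add: trunc_def\<close>)
  qed
qed

text \<open>The integral form of \<open>c' = h - kop c\<close>, meaningful for data that are merely
  integrable in time. Continuity is demanded so that the second integrand is continuous;
  \<open>integral\<close> alone would also assign a value to nonintegrable functions.\<close>

definition solves :: "(nat \<Rightarrow> real \<Rightarrow> real) \<Rightarrow> (nat \<Rightarrow> real \<Rightarrow> real) \<Rightarrow> bool" where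
  "solves h c \<longleftrightarrow> (\<forall>i<N. continuous_on {0..} (c i) \<and> (\<forall>t\<ge>0.
      c i t = c i 0 + integral {0..t} (h i) - integral {0..t} (\<lambda>s. kop (\<lambda>j. c j s) i)))"

lemma solves_exists:
  fixes C :: real
  assumes h: "\<And>i a b. i < N \<Longrightarrow> h i integrable_on {a..b}" "\<And>i t. i < N \<Longrightarrow> \<bar>h i t\<bar> \<le> C"
  obtains c where "solves h c" "\<And>i. i < N \<Longrightarrow> c i 0 = x0 i"
proof -
  define X where "X = (\<Sum>i<N. (x0 i)\<^sup>2)"
  \<comment> \<open>The bound of \<open>energy_bound\<close> for initial energy \<open>X\<close>,
    converted by \<open>form_le\<close> into a bound for the form.\<close>
  define M where "M = abs_sum * (X + real N * C\<^sup>2 / \<mu>\<^sup>2)"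
  have "X \<ge> 0" by (simp add: X_def sum_nonneg)
  have "M \<ge> 0" using \<open>X \<ge> 0\<close> abs_sum_nonneg by (simp add: M_def)
  from trunc_lipschitz[OF this] obtain K where K: "K \<ge> 1" "\<And>x y D i. D \<ge> 0 \<Longrightarrow>
      (\<And>j. j < N \<Longrightarrow> \<bar>x j - y j\<bar> \<le> D) \<Longrightarrow> \<bar>trunc M x i - trunc M y i\<bar> \<le> K * D" by blast
  \<comment> \<open>Components beyond \<open>N\<close> are zero, as they are for
    \<open>trunc\<close>, because the fixed point lemma asks for bounds valid for every
    index.\<close>
  define F where "F i t = (if i < N then x0 i + integral {0..t} (h i) else 0)" for i t
  have F1: "continuous_on {0..} (F i)" for i
    unfolding F_def using h(1) by (cases "i < N") (auto intro!: continuous_intros indefinite_integral_continuous_atLeast)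
  have F2: "\<bar>F i t\<bar> \<le> (sqrt X + \<bar>C\<bar>) * exp (2 * K * t)" if "t \<ge> 0" for i t
  proof (cases "i < N")
    case True
    have "\<bar>x0 i\<bar> \<le> sqrt X"
      unfolding X_def using member_le_sum[of i "{..<N}" "\<lambda>i. (x0 i)\<^sup>2"] True by (intro real_le_rsqrt) auto
    moreover have "norm (integral {0..t} (h i)) \<le> integral {0..t} (\<lambda>_. \<bar>C\<bar>)"
      using h True by (intro integral_norm_bound_integral) (auto intro: order_trans[OF _ abs_ge_self])
    then have "\<bar>integral {0..t} (h i)\<bar> \<le> \<bar>C\<bar> * t" using that by (simp add: mult.commute)
    ultimately have "\<bar>F i t\<bar> \<le> sqrt X + \<bar>C\<bar> * t" using True by (simp add: F_def)
    also have "\<dots> \<le> sqrt X * exp (2 * K * t) + \<bar>C\<bar> * exp (2 * K * t)"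
    proof -
      have "1 + 2 * K * t \<le> exp (2 * K * t)" by (rule exp_ge_add_one_self)
      moreover have "1 * t \<le> 2 * K * t" using K that by (intro mult_right_mono) auto
      ultimately have "1 \<le> exp (2 * K * t)" "t \<le> exp (2 * K * t)" using that by linarith+
      then have "sqrt X * 1 \<le> sqrt X * exp (2 * K * t)" "\<bar>C\<bar> * t \<le> \<bar>C\<bar> * exp (2 * K * t)"
        using \<open>X \<ge> 0\<close> by (intro mult_left_mono; simp)+
      then show ?thesis by simp
    qed
    finally show ?thesis by (simp add: algebra_simps)
  qed (use \<open>X \<ge> 0\<close> in \<open>simp add: F_def\<close>)
  have "0 < K" using K(1) by simp
  moreover have "trunc M (\<lambda>_. 0) i = 0" for i by (simp add: trunc_def lin_def)
  ultimately obtain u where uc: "\<And>i. continuous_on {0..} (u i)"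
    and u: "\<And>i t. t \<ge> 0 \<Longrightarrow> u i t = F i t - integral {0..t} (\<lambda>s. trunc M (\<lambda>j. u j s) i)"
    using lipschitz_integral_equation_solution[of K N "trunc M" F "sqrt X + \<bar>C\<bar>"] K(2) F1 F2 by blast
  have u0: "u i 0 = x0 i" if "i < N" for i using u[of 0 i] that by (simp add: F_def)
  have bound: "form (\<lambda>j. u j t) (\<lambda>j. u j t) \<le> M" if "t \<ge> 0" for t
  proof -
    have "(\<Sum>i<N. (u i t)\<^sup>2) \<le> exp (- \<mu> * t) * (\<Sum>i<N. (u i 0)\<^sup>2) + real N * C\<^sup>2 / \<mu>\<^sup>2"
    proof (rule energy_bound[OF mu_pos h])
      show "continuous_on {0..} (\<lambda>s. trunc M (\<lambda>j. u j s) i)" for i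
        by (rule continuous_on_lipschitz_coordinates[where G = "\<lambda>x. trunc M x i" and K = K and N = N])
           (auto intro: K uc)
      show "\<mu> * (\<Sum>i<N. (u i t)\<^sup>2) \<le> (\<Sum>i<N. trunc M (\<lambda>j. u j t) i * u i t)" for t
      proof -
        let ?x = "\<lambda>j. u j t"
        define m where "m = 1 + min (form ?x ?x) M"
        have "(\<Sum>i<N. trunc M ?x i * u i t) = (\<Sum>i<N. m * (lin ?x i * u i t))"
          by (simp add: trunc_def m_def mult.assoc)
        also have "\<dots> = m * form ?x ?x" by (simp add: form_lin sum_distrib_left)
        finally have "(\<Sum>i<N. trunc M ?x i * u i t) = (1 + min (form ?x ?x) M) * form ?x ?x"
          by (simp only: m_def)
        also have "\<dots> \<ge> 1 * form ?x ?x"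
          using form_nonneg[of ?x] \<open>M \<ge> 0\<close> by (intro mult_right_mono) auto
        finally show ?thesis using form_coercive[of ?x] by linarith
      qed
      show "u i t = u i 0 + integral {0..t} (h i) - integral {0..t} (\<lambda>s. trunc M (\<lambda>j. u j s) i)"
        if "i < N" "t \<ge> 0" for i t
        using u[OF that(2), of i] that u0 by (simp add: F_def)
    qed (use that in auto)
    also have "(\<Sum>i<N. (u i 0)\<^sup>2) = X" unfolding X_def by (intro sum.cong) (auto simp: u0)
    also have "exp (- \<mu> * t) * X \<le> 1 * X" using \<open>X \<ge> 0\<close> mu_pos that by (intro mult_right_mono) auto
    finally have "(\<Sum>i<N. (u i t)\<^sup>2) \<le> X + real N * C\<^sup>2 / \<mu>\<^sup>2" by simp
    then have "abs_sum * (\<Sum>i<N. (u i t)\<^sup>2) \<le> M"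
      unfolding M_def using abs_sum_nonneg by (rule mult_left_mono)
    then show ?thesis using form_le[of "\<lambda>j. u j t"] by linarith
  qed
  show thesis
  proof (rule that[of u])
    show "solves h u"
      unfolding solves_def
    proof (intro allI impI conjI)
      fix i t assume "i < N" "(t::real) \<ge> 0"
      have "integral {0..t} (\<lambda>s. trunc M (\<lambda>j. u j s) i) = integral {0..t} (\<lambda>s. kop (\<lambda>j. u j s) i)"
        using bound \<open>i < N\<close> by (intro integral_cong) (simp add: trunc_def kop_def min_def)
      then show "u i t = u i 0 + integral {0..t} (h i) - integral {0..t} (\<lambda>s. kop (\<lambda>j. u j s) i)"
        using u[OF \<open>t \<ge> 0\<close>, of i] \<open>i < N\<close> u0 by (simp add: F_def)
    qed (rule uc)
  qed (fact u0)
qed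

text \<open>The data cancel in the difference, so \<open>energy_bound\<close> applies with
  \<open>h = 0\<close> and bound 0; the coercivity it requires is strong monotonicity.\<close>

lemma solves_contraction:
  assumes h: "\<And>i a b. i < N \<Longrightarrow> h i integrable_on {a..b}"
    and c: "solves h c" and e: "solves h e" and "t \<ge> 0"
  shows "(\<Sum>i<N. (c i t - e i t)\<^sup>2) \<le> exp (- \<mu> * t) * (\<Sum>i<N. (c i 0 - e i 0)\<^sup>2)"
proof -
  let ?p = "\<lambda>i s. kop (\<lambda>j. c j s) i - kop (\<lambda>j. e j s) i"
  have kc: "continuous_on {0..} (\<lambda>s. kop (\<lambda>j. c j s) i)" "continuous_on {0..} (\<lambda>s. kop (\<lambda>j. e j s) i)" if "i < N" for i
    using c e that by (auto simp: solves_def intro!: kop_continuous)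
  have "(\<Sum>i<N. (c i t - e i t)\<^sup>2) \<le> exp (- \<mu> * t) * (\<Sum>i<N. (c i 0 - e i 0)\<^sup>2) + real N * 0\<^sup>2 / \<mu>\<^sup>2"
  proof (rule energy_bound[OF mu_pos, where h = "\<lambda>_ _. 0" and p = ?p and c = "\<lambda>i t. c i t - e i t"])
    show "continuous_on {0..} (?p i)" if "i < N" for i using kc[OF that] by (intro continuous_intros)
    show "c i t - e i t = c i 0 - e i 0 + integral {0..t} (\<lambda>_. 0) - integral {0..t} (?p i)"
      if "i < N" "t \<ge> 0" for i t
    proof -
      have "integral {0..t} (?p i) = integral {0..t} (\<lambda>s. kop (\<lambda>j. c j s) i) - integral {0..t} (\<lambda>s. kop (\<lambda>j. e j s) i)"
        using kc[OF that(1)]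
        by (intro integral_diff integrable_continuous_real) (auto intro: continuous_on_subset)
      moreover have "c i t = c i 0 + integral {0..t} (h i) - integral {0..t} (\<lambda>s. kop (\<lambda>j. c j s) i)"
        "e i t = e i 0 + integral {0..t} (h i) - integral {0..t} (\<lambda>s. kop (\<lambda>j. e j s) i)"
        using c e that unfolding solves_def by blast+
      ultimately show ?thesis by simp
    qed
  qed (use \<open>t \<ge> 0\<close> kop_strongly_monotone in auto)
  then show ?thesis by simp
qed

lemma solves_unique:
  assumes "\<And>i a b. i < N \<Longrightarrow> h i integrable_on {a..b}" "solves h c" "solves h e"
    "\<And>i. i < N \<Longrightarrow> c i 0 = e i 0" "t \<ge> 0" "i < N"
  shows "c i t = e i t"
proof -
  have "(\<Sum>i<N. (c i 0 - e i 0)\<^sup>2) = 0" using assms(4) by simp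
  then have "(\<Sum>i<N. (c i t - e i t)\<^sup>2) \<le> 0"
    using solves_contraction[OF assms(1-3,5)] by simp
  then have "(\<Sum>i<N. (c i t - e i t)\<^sup>2) = 0" by (simp add: antisym sum_nonneg)
  then show ?thesis using \<open>i < N\<close> by (simp add: sum_nonneg_eq_0_iff)
qed

lemma solves_bound:
  fixes C :: real
  assumes h: "\<And>i a b. i < N \<Longrightarrow> h i integrable_on {a..b}" "\<And>i t. i < N \<Longrightarrow> \<bar>h i t\<bar> \<le> C"
    and c: "solves h c" and "t \<ge> 0"
  shows "(\<Sum>i<N. (c i t)\<^sup>2) \<le> exp (- \<mu> * t) * (\<Sum>i<N. (c i 0)\<^sup>2) + real N * C\<^sup>2 / \<mu>\<^sup>2"
proof (rule energy_bound[OF mu_pos h, where p = "\<lambda>i s. kop (\<lambda>j. c j s) i"])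
  show "continuous_on {0..} (\<lambda>s. kop (\<lambda>j. c j s) i)" if "i < N" for i
    using c that by (auto simp: solves_def intro!: kop_continuous)
  show "\<mu> * (\<Sum>i<N. (c i t)\<^sup>2) \<le> (\<Sum>i<N. kop (\<lambda>j. c j t) i * c i t)" for t
    using kop_strongly_monotone[of "\<lambda>j. c j t" "\<lambda>_. 0"] by (simp add: kop_def lin_def)
  show "c i t = c i 0 + integral {0..t} (h i) - integral {0..t} (\<lambda>s. kop (\<lambda>j. c j s) i)"
    if "i < N" "t \<ge> 0" for i t
    using c that unfolding solves_def by blast
qed (use \<open>t \<ge> 0\<close> in auto)

end

section \<open>Orthonormal bases\<close>

text \<open>\<open>N = 0\<close> is allowed; this is the case of a mesh without interior nodes,
  where the space is trivial.\<close>

definition orthonormal_basis ::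
  "('x \<Rightarrow> real) set \<Rightarrow> (('x \<Rightarrow> real) \<Rightarrow> ('x \<Rightarrow> real) \<Rightarrow> real) \<Rightarrow> nat \<Rightarrow> (nat \<Rightarrow> 'x \<Rightarrow> real) \<Rightarrow> bool" where
  "orthonormal_basis V m N e \<longleftrightarrow> (\<forall>i<N. e i \<in> V) \<and>
     (\<forall>i<N. \<forall>j<N. m (e i) (e j) = (if i = j then 1 else 0)) \<and>
     (\<forall>v\<in>V. v = (\<lambda>x. \<Sum>i<N. m v (e i) * e i x))"

text \<open>Stated relative to a set of functions so that it fits the \<open>L\<^sup>2\<close> and
  the gradient inner product alike, as well as the kernels of evaluations in the induction
  below.\<close>

locale inner_product_on =
  fixes V :: "('x \<Rightarrow> real) set" and m :: "('x \<Rightarrow> real) \<Rightarrow> ('x \<Rightarrow> real) \<Rightarrow> real"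
  assumes zero: "(\<lambda>_. 0) \<in> V"
    and lincomb: "v \<in> V \<Longrightarrow> w \<in> V \<Longrightarrow> (\<lambda>x. s * v x + t * w x) \<in> V"
    and sym: "v \<in> V \<Longrightarrow> w \<in> V \<Longrightarrow> m v w = m w v"
    and lin: "v \<in> V \<Longrightarrow> w \<in> V \<Longrightarrow> z \<in> V \<Longrightarrow> m (\<lambda>x. s * v x + t * w x) z = s * m v z + t * m w z"
    and pos: "v \<in> V \<Longrightarrow> v \<noteq> (\<lambda>_. 0) \<Longrightarrow> m v v > 0"
begin

lemma scale: "v \<in> V \<Longrightarrow> (\<lambda>x. s * v x) \<in> V"
  using lincomb[of v v s 0] by simp

lemma diff: "v \<in> V \<Longrightarrow> w \<in> V \<Longrightarrow> (\<lambda>x. v x - w x) \<in> V"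
  using lincomb[of v w 1 "-1"] by simp

lemma form_zero: "v \<in> V \<Longrightarrow> m (\<lambda>_. 0) v = 0"
  using lin[of v v v 0 0] by simp

lemma nonneg: "v \<in> V \<Longrightarrow> m v v \<ge> 0"
  using pos[of v] form_zero[OF zero] by (cases "v = (\<lambda>_. 0)") auto

lemma form_scale: "v \<in> V \<Longrightarrow> w \<in> V \<Longrightarrow> m (\<lambda>x. s * v x) w = s * m v w"
  using lin[of v v w s 0] by simp

lemma form_diff: "v \<in> V \<Longrightarrow> w \<in> V \<Longrightarrow> z \<in> V \<Longrightarrow> m (\<lambda>x. v x - w x) z = m v z - m w z"
  using lin[of v w z 1 "-1"] by simp

lemma sum_mem:
  fixes N :: nat
  shows "(\<And>i. i < N \<Longrightarrow> e i \<in> V) \<Longrightarrow> (\<lambda>x. \<Sum>i<N. c i * e i x) \<in> V"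
proof (induction N)
  case 0 then show ?case by (simp add: zero)
next
  case (Suc N)
  then have "(\<lambda>x. 1 * (\<Sum>i<N. c i * e i x) + c N * e N x) \<in> V" by (intro lincomb) auto
  then show ?case by simp
qed

lemma form_sum:
  fixes N :: nat
  shows "(\<And>i. i < N \<Longrightarrow> e i \<in> V) \<Longrightarrow> z \<in> V \<Longrightarrow> m (\<lambda>x. \<Sum>i<N. c i * e i x) z = (\<Sum>i<N. c i * m (e i) z)"
proof (induction N)
  case 0 then show ?case by (simp add: form_zero)
next
  case (Suc N)
  then have "m (\<lambda>x. 1 * (\<Sum>i<N. c i * e i x) + c N * e N x) z =
      1 * m (\<lambda>x. \<Sum>i<N. c i * e i x) z + c N * m (e N) z"
    by (intro lin sum_mem) auto
  with Suc show ?case by simp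
qed

lemma form_sum':
  fixes N :: nat
  shows "(\<And>i. i < N \<Longrightarrow> e i \<in> V) \<Longrightarrow> z \<in> V \<Longrightarrow> m z (\<lambda>x. \<Sum>i<N. c i * e i x) = (\<Sum>i<N. c i * m z (e i))"
  using form_sum[of N e z c] sym[OF _ sum_mem[of N e c], of z] sym[of z] by simp

lemma coordinate_sum:
  assumes "orthonormal_basis V m N e" "i < N"
  shows "m (\<lambda>x. \<Sum>i<N. c i * e i x) (e i) = c i"
proof -
  have "m (\<lambda>x. \<Sum>i<N. c i * e i x) (e i) = (\<Sum>j<N. c j * m (e j) (e i))"
    using assms by (intro form_sum) (auto simp: orthonormal_basis_def)
  also have "\<dots> = (\<Sum>j<N. if j = i then c j else 0)"
    using assms by (intro sum.cong) (auto simp: orthonormal_basis_def)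
  finally show ?thesis using \<open>i < N\<close> by simp
qed

lemma parseval:
  assumes "orthonormal_basis V m N e" "v \<in> V"
  shows "m v v = (\<Sum>i<N. (m v (e i))\<^sup>2)"
proof -
  have v: "v = (\<lambda>x. \<Sum>i<N. m v (e i) * e i x)" and e: "\<And>i. i < N \<Longrightarrow> e i \<in> V"
    using assms by (auto simp: orthonormal_basis_def)
  have "m v (\<lambda>x. \<Sum>i<N. m v (e i) * e i x) = (\<Sum>i<N. m v (e i) * m v (e i))"
    by (rule form_sum'[OF e assms(2)])
  then show ?thesis using v by (simp add: power2_eq_square)
qed

end

text \<open>Gram-Schmidt, by induction over a finite set of evaluation points that determines the elements
  of \<open>V\<close>: the kernel of one evaluation has codimension at most one.\<close>

lemma orthonormal_basis_exists:
  assumes "finite P" "inner_product_on V m" "\<And>v. v \<in> V \<Longrightarrow> (\<And>p. p \<in> P \<Longrightarrow> v p = 0) \<Longrightarrow> v = (\<lambda>_. 0)"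
  shows "\<exists>N e. orthonormal_basis V m N e"
  using assms
proof (induction P arbitrary: V rule: finite_induct)
  case empty
  then have "orthonormal_basis V m 0 (\<lambda>_ _. 0)"
    by (auto simp: orthonormal_basis_def)
  then show ?case by blast
next
  case (insert p P)
  interpret inner_product_on V m by fact
  let ?V' = "{v \<in> V. v p = 0}"
  have V': "inner_product_on ?V' m"
    by unfold_locales (simp_all add: zero lincomb lin pos, metis sym)
  have "v = (\<lambda>_. 0)" if "v \<in> ?V'" "\<And>q. q \<in> P \<Longrightarrow> v q = 0" for v
    using that insert.prems(2)[of v] by auto
  from insert.IH[OF V' this] obtain N e where e: "orthonormal_basis ?V' m N e" by blast
  then have eV: "e i \<in> V" "e i p = 0" if "i < N" for i
    using that by (auto simp: orthonormal_basis_def)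
  have ee: "m (e i) (e j) = (if i = j then 1 else 0)" if "i < N" "j < N" for i j
    using e that by (auto simp: orthonormal_basis_def)
  show ?case
  proof (cases "?V' = V")
    case True
    then show ?thesis using e by metis
  next
    case False
    then obtain v0 where v0: "v0 \<in> V" "v0 p \<noteq> 0" by blast
    \<comment> \<open>Removing the projection onto the kernel makes \<open>w\<close> orthogonal to
      it; the value at \<open>p\<close> survives because the kernel vanishes there.\<close>
    define w where "w = (\<lambda>x. v0 x - (\<Sum>i<N. m v0 (e i) * e i x))"
    have sumV: "(\<lambda>x. \<Sum>i<N. m v0 (e i) * e i x) \<in> V" by (intro sum_mem eV)
    then have w: "w \<in> V" unfolding w_def by (intro diff v0)
    have wp: "w p = v0 p" by (simp add: w_def eV)
    have we: "m w (e i) = 0" if "i < N" for i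
    proof -
      have "m w (e i) = m v0 (e i) - m (\<lambda>x. \<Sum>i<N. m v0 (e i) * e i x) (e i)"
        unfolding w_def by (intro form_diff v0 sumV eV that)
      also have "m (\<lambda>x. \<Sum>i<N. m v0 (e i) * e i x) (e i) = (\<Sum>j<N. m v0 (e j) * m (e j) (e i))"
        by (intro form_sum eV that)
      also have "\<dots> = (\<Sum>j<N. if j = i then m v0 (e j) else 0)"
        using that by (intro sum.cong) (auto simp: ee)
      finally show ?thesis using that by simp
    qed
    define n where "n = m w w"
    have "w \<noteq> (\<lambda>_. 0)" using wp v0 by auto
    then have n: "n > 0" unfolding n_def by (rule pos[OF w])
    define e' where "e' i = (if i < N then e i else (\<lambda>x. 1 / sqrt n * w x))" for i
    have e'V: "e' i \<in> V" for i using eV scale[OF w, of "1 / sqrt n"] by (auto simp: e'_def)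
    have me': "m u (e' N) = m u w / sqrt n" if "u \<in> V" for u
      using form_scale[OF w that, of "1 / sqrt n"] scale[OF w, of "1 / sqrt n"] that w
      by (simp add: e'_def sym)
    have "m (e' i) (e' j) = (if i = j then 1 else 0)" if "i < Suc N" "j < Suc N" for i j
    proof -
      have NN: "m (e' N) (e' N) = 1"
        using me'[OF e'V, of N] me'[OF w] sym[OF e'V[of N] w] n by (simp add: n_def[symmetric])
      have "m (e i) (e' N) = 0" if "i < N" for i
        using me'[OF eV(1)[OF that]] we[OF that] sym[OF eV(1)[OF that] w] by simp
      then have iN: "m (e' i) (e' N) = 0" "m (e' N) (e' i) = 0" if "i < N" for i
        using that sym[OF e'V e'V, of N i] by (auto simp: e'_def)
      show ?thesis
        using that NN iN ee by (cases "i = N"; cases "j = N") (auto simp: less_Suc_eq e'_def)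
    qed
    moreover have "u = (\<lambda>x. \<Sum>i<Suc N. m u (e' i) * e' i x)" if u: "u \<in> V" for u
    proof -
      \<comment> \<open>With this \<open>q\<close> the remainder \<open>u - q w\<close> vanishes at
        \<open>p\<close> and thus is expanded by the basis of the kernel.\<close>
      define q where "q = u p / w p"
      define u' where "u' = (\<lambda>x. u x - q * w x)"
      have qw: "(\<lambda>x. q * w x) \<in> V" by (rule scale[OF w])
      have "u' \<in> V" unfolding u'_def by (intro diff u qw)
      then have u'V: "u' \<in> ?V'" using wp v0 by (simp add: u'_def q_def)
      then have u': "u' = (\<lambda>x. \<Sum>i<N. m u' (e i) * e i x)" using e by (auto simp: orthonormal_basis_def)
      have mu: "m u' z = m u z - q * m w z" if "z \<in> V" for z
        unfolding u'_def by (simp add: form_diff[OF u qw that] form_scale[OF w that])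
      have "m u' w = (\<Sum>i<N. m u' (e i) * m (e i) w)"
        by (subst u') (intro form_sum eV w)
      also have "\<dots> = 0" using we sym[OF w eV(1)] by (intro sum.neutral) auto
      finally have "m u w = q * n" using mu[OF w] by (simp add: n_def)
      then have last: "m u (e' N) * e' N x = q * w x" for x
        using me'[OF u] n by (simp add: e'_def)
      have "m u (e' i) * e' i x = m u' (e i) * e i x" if "i < N" for i x
        using that mu[OF eV(1)[OF that]] we[OF that] by (simp add: e'_def)
      then have "(\<Sum>i<Suc N. m u (e' i) * e' i x) = u' x + q * w x" for x
        by (subst u') (simp add: last)
      then show ?thesis by (simp add: u'_def)
    qed
    ultimately have "orthonormal_basis V m (Suc N) e'"
      unfolding orthonormal_basis_def using e'V by blast
    then show ?thesis by blast
  qed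
qed

section \<open>The finite element space\<close>

lemma L2_D: "f \<in> L2 \<Omega> \<Longrightarrow> f \<in> borel_measurable (lebesgue_on \<Omega>)"
  "f \<in> L2 \<Omega> \<Longrightarrow> integrable (lebesgue_on \<Omega>) (\<lambda>x. (f x)\<^sup>2)"
  by (auto simp: L2_def)

lemma L2_integrable_mult:
  assumes "f \<in> L2 \<Omega>" "g \<in> L2 \<Omega>"
  shows "integrable (lebesgue_on \<Omega>) (\<lambda>x. f x * g x)"
proof (rule Bochner_Integration.integrable_bound)
  show "integrable (lebesgue_on \<Omega>) (\<lambda>x. (f x)\<^sup>2 + (g x)\<^sup>2)"
    using assms by (intro Bochner_Integration.integrable_add L2_D)
  show "(\<lambda>x. f x * g x) \<in> borel_measurable (lebesgue_on \<Omega>)"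
    using assms by (intro borel_measurable_times L2_D)
  have "\<bar>u * v\<bar> \<le> u\<^sup>2 + v\<^sup>2" for u v :: real
  proof -
    have "0 \<le> (\<bar>u\<bar> - \<bar>v\<bar>)\<^sup>2" by simp
    then have "2 * (\<bar>u\<bar> * \<bar>v\<bar>) \<le> u\<^sup>2 + v\<^sup>2" by (simp add: power2_diff)
    moreover have "0 \<le> \<bar>u\<bar> * \<bar>v\<bar>" by simp
    ultimately show ?thesis unfolding abs_mult by linarith
  qed
  then show "AE x in lebesgue_on \<Omega>. norm (f x * g x) \<le> norm ((f x)\<^sup>2 + (g x)\<^sup>2)"
    by (intro AE_I2) (simp add: abs_mult order_trans[OF _ abs_ge_self])
qed

lemma L2_lincomb:
  assumes "f \<in> L2 \<Omega>" "g \<in> L2 \<Omega>"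
  shows "(\<lambda>x. s * f x + t * g x) \<in> L2 \<Omega>"
proof -
  have "integrable (lebesgue_on \<Omega>) (\<lambda>x. s\<^sup>2 * (f x)\<^sup>2 + 2 * s * t * (f x * g x) + t\<^sup>2 * (g x)\<^sup>2)"
    using assms by (intro Bochner_Integration.integrable_add integrable_mult_right L2_D L2_integrable_mult)
  then have "integrable (lebesgue_on \<Omega>) (\<lambda>x. (s * f x + t * g x)\<^sup>2)"
    by (simp add: power2_eq_square algebra_simps)
  moreover have "(\<lambda>x. s * f x + t * g x) \<in> borel_measurable (lebesgue_on \<Omega>)"
    using assms by (intro borel_measurable_add borel_measurable_times borel_measurable_const L2_D)
  ultimately show ?thesis by (simp add: L2_def)
qed

lemma L2_inner_sym: "L2_inner \<Omega> f g = L2_inner \<Omega> g f"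
  by (simp add: L2_inner_def mult.commute)

lemma L2_inner_lin:
  assumes "f \<in> L2 \<Omega>" "g \<in> L2 \<Omega>" "k \<in> L2 \<Omega>"
  shows "L2_inner \<Omega> (\<lambda>x. s * f x + t * g x) k = s * L2_inner \<Omega> f k + t * L2_inner \<Omega> g k"
proof -
  have "L2_inner \<Omega> (\<lambda>x. s * f x + t * g x) k = (LINT x|lebesgue_on \<Omega>. s * (f x * k x) + t * (g x * k x))"
    unfolding L2_inner_def by (intro Bochner_Integration.integral_cong refl) (simp add: algebra_simps)
  also have "\<dots> = s * L2_inner \<Omega> f k + t * L2_inner \<Omega> g k"
    using assms L2_integrable_mult unfolding L2_inner_def
    by (subst Bochner_Integration.integral_add) auto
  finally show ?thesis .
qed

lemma L2_inner_diff:
  assumes "f \<in> L2 \<Omega>" "g \<in> L2 \<Omega>" "k \<in> L2 \<Omega>"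
  shows "L2_inner \<Omega> (\<lambda>x. f x - g x) k = L2_inner \<Omega> f k - L2_inner \<Omega> g k"
  using L2_inner_lin[OF assms, of 1 "-1"] by simp

lemma L2_inner_nonneg: "L2_inner \<Omega> f f \<ge> 0"
  by (simp add: L2_inner_def)

lemma L2_norm_nonneg: "L2_norm \<Omega> f \<ge> 0"
  by (simp add: L2_norm_def L2_inner_nonneg)

text \<open>Expand the nonnegative square of \<open>f - s e\<close> with \<open>s\<close> the
  coefficient of \<open>f\<close>. Positive semidefiniteness suffices, as it must for functions that
  are not identified modulo null sets.\<close>

lemma abs_L2_inner_unit_le:
  assumes "f \<in> L2 \<Omega>" "e \<in> L2 \<Omega>" "L2_inner \<Omega> e e = 1"
  shows "\<bar>L2_inner \<Omega> f e\<bar> \<le> L2_norm \<Omega> f"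
proof -
  define s where "s = L2_inner \<Omega> f e"
  let ?g = "\<lambda>x. 1 * f x + (- s) * e x"
  have g: "?g \<in> L2 \<Omega>" using assms by (intro L2_lincomb)
  have "0 \<le> L2_inner \<Omega> ?g ?g" by (rule L2_inner_nonneg)
  also have "\<dots> = 1 * L2_inner \<Omega> f ?g + (- s) * L2_inner \<Omega> e ?g"
    using assms g by (intro L2_inner_lin)
  also have "L2_inner \<Omega> f ?g = 1 * L2_inner \<Omega> f f + (- s) * s"
    using assms by (subst L2_inner_sym, subst L2_inner_lin) (auto simp: s_def L2_inner_sym[of _ e f])
  also have "L2_inner \<Omega> e ?g = 1 * s + (- s) * 1"
    using assms by (subst L2_inner_sym, subst L2_inner_lin) (auto simp: s_def)
  finally have "s\<^sup>2 \<le> L2_inner \<Omega> f f" by (simp add: power2_eq_square)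
  then show ?thesis unfolding L2_norm_def s_def by (simp add: real_le_rsqrt)
qed

lemma L2_inner_sum:
  assumes "\<And>i. i < (N::nat) \<Longrightarrow> e i \<in> L2 \<Omega>" "f \<in> L2 \<Omega>"
  shows "L2_inner \<Omega> f (\<lambda>x. \<Sum>i<N. c i * e i x) = (\<Sum>i<N. c i * L2_inner \<Omega> f (e i))"
proof -
  have "L2_inner \<Omega> f (\<lambda>x. \<Sum>i<N. c i * e i x) = (LINT x|lebesgue_on \<Omega>. (\<Sum>i<N. c i * (f x * e i x)))"
    unfolding L2_inner_def by (simp add: sum_distrib_left mult_ac)
  also have "\<dots> = (\<Sum>i<N. (LINT x|lebesgue_on \<Omega>. c i * (f x * e i x)))"
    using assms by (intro Bochner_Integration.integral_sum integrable_mult_right L2_integrable_mult) auto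
  finally show ?thesis by (simp add: L2_inner_def)
qed

locale mesh =
  fixes \<Omega> :: "'a::euclidean_space set" and \<T> :: "'a set set"
  assumes domain: "convex_polytopal_domain \<Omega>" and triang: "regular_triangulation \<Omega> \<T>"
begin

abbreviation "V \<equiv> Vh \<Omega> \<T>"

lemma open_domain: "open \<Omega>" and domain_nonempty: "\<Omega> \<noteq> {}" and convex_domain: "convex \<Omega>"
  using domain by (auto simp: convex_polytopal_domain_def)

lemma compact_closure_domain: "compact (closure \<Omega>)"
  using domain polytope_imp_compact unfolding convex_polytopal_domain_def by blast

lemma bounded_domain: "bounded \<Omega>"
  by (rule bounded_subset[OF compact_imp_bounded[OF compact_closure_domain] closure_subset])

lemma domain_lmeasurable: "\<Omega> \<in> lmeasurable"
  by (simp add: lmeasurable_open open_domain bounded_domain)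

lemma domain_sets: "\<Omega> \<in> sets lebesgue"
  using domain_lmeasurable by (rule fmeasurableD)

lemma finite_mesh: "finite \<T>" and Union_mesh: "\<Union>\<T> = closure \<Omega>"
  using triang by (auto simp: regular_triangulation_def triangulation_def)

text \<open>Affine independence of \<open>DIM('a) + 1\<close> vertices gives full dimension and
  thereby interior points, where an affine function determines its gradient.\<close>

lemma mesh_elem:
  assumes "K \<in> \<T>"
  obtains C where "finite C" "K = convex hull C" "interior K \<noteq> {}"
proof -
  from triang assms have "int DIM('a) simplex K" by (simp add: regular_triangulation_def)
  then obtain C where C: "finite C" "\<not> affine_dependent C" "int (card C) = int DIM('a) + 1" "K = convex hull C"
    by (auto simp: simplex)
  have "aff_dim C = int DIM('a)" using aff_dim_affine_independent[OF C(2)] C(3) by simp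
  then have "aff_dim K = int DIM('a)" by (simp add: C(4) aff_dim_convex_hull)
  then have "interior K \<noteq> {}"
    using C(4) convex_convex_hull interior_rel_interior_gen[of K] rel_interior_eq_empty[of K] C(3)
    by (auto simp: aff_dim_empty)
  then show thesis using that C by blast
qed

lemma mesh_convex: "K \<in> \<T> \<Longrightarrow> convex K" and mesh_compact: "K \<in> \<T> \<Longrightarrow> compact K"
  by (metis mesh_elem convex_convex_hull, metis mesh_elem finite_imp_compact_convex_hull)

text \<open>The union of the open simplices: here the gradient of an element of \<open>V\<close> is
  constant on each simplex, and only a null set of \<Omega> is left out.\<close>

definition regular_part :: "'a set" where "regular_part = (\<Union>K\<in>\<T>. interior K)"

text \<open>An open convex set is the interior of its closure.\<close>

lemma regular_part_subset: "regular_part \<subseteq> \<Omega>"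
proof -
  have "interior K \<subseteq> \<Omega>" if "K \<in> \<T>" for K
  proof -
    have "interior K \<subseteq> interior (closure \<Omega>)" using that Union_mesh by (intro interior_mono) auto
    then show ?thesis using convex_interior_closure[OF convex_domain] open_domain by (simp add: interior_open)
  qed
  then show ?thesis by (auto simp: regular_part_def)
qed

lemma negligible_singular_part: "negligible (\<Omega> - regular_part)"
proof (rule negligible_subset)
  show "negligible (\<Union>K\<in>\<T>. frontier K)"
    using finite_mesh mesh_convex by (intro negligible_Union) (auto intro: negligible_convex_frontier)
  show "\<Omega> - regular_part \<subseteq> (\<Union>K\<in>\<T>. frontier K)"
  proof
    fix x assume x: "x \<in> \<Omega> - regular_part"
    then have "x \<in> \<Union>\<T>" using Union_mesh closure_subset by blast
    then obtain K where "K \<in> \<T>" "x \<in> K" by blast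
    then show "x \<in> (\<Union>K\<in>\<T>. frontier K)"
      using x closure_subset[of K] by (auto simp: frontier_def regular_part_def)
  qed
qed

section \<open>Linear structure, integrability and nodal values of finite element functions\<close>

lemma Vh_D:
  assumes "v \<in> V"
  shows "continuous_on (closure \<Omega>) v" "K \<in> \<T> \<Longrightarrow> \<exists>a c. \<forall>x\<in>K. v x = a \<bullet> x + c"
    "x \<notin> \<Omega> \<Longrightarrow> v x = 0"
  using assms by (auto simp: Vh_def)

lemma Vh_zero: "(\<lambda>_. 0) \<in> V"
  by (auto simp: Vh_def intro!: exI[of _ 0])

lemma Vh_lincomb:
  assumes "v \<in> V" "w \<in> V"
  shows "(\<lambda>x. s * v x + t * w x) \<in> V"
proof -
  have "\<exists>a c. \<forall>x\<in>K. s * v x + t * w x = a \<bullet> x + c" if "K \<in> \<T>" for K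
  proof -
    obtain a c where "\<forall>x\<in>K. v x = a \<bullet> x + c" using Vh_D(2)[OF assms(1) \<open>K \<in> \<T>\<close>] by blast
    moreover obtain a' c' where "\<forall>x\<in>K. w x = a' \<bullet> x + c'" using Vh_D(2)[OF assms(2) \<open>K \<in> \<T>\<close>] by blast
    ultimately show ?thesis
      by (intro exI[of _ "s *\<^sub>R a + t *\<^sub>R a'"] exI[of _ "s * c + t * c'"]) (simp add: algebra_simps)
  qed
  moreover have "continuous_on (closure \<Omega>) (\<lambda>x. s * v x + t * w x)"
    by (intro continuous_intros Vh_D(1) assms)
  ultimately show ?thesis
    using Vh_D(3)[OF assms(1)] Vh_D(3)[OF assms(2)] by (simp add: Vh_def)
qed

lemma bounded_continuous_integrable:
  fixes g :: "'a \<Rightarrow> real"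
  assumes "continuous_on (closure \<Omega>) g"
  shows "integrable (lebesgue_on \<Omega>) g" "g \<in> borel_measurable (lebesgue_on \<Omega>)"
proof -
  have c: "continuous_on \<Omega> g" using assms closure_subset continuous_on_subset by blast
  then show meas: "g \<in> borel_measurable (lebesgue_on \<Omega>)"
    by (rule continuous_imp_measurable_on_sets_lebesgue[OF _ domain_sets])
  have "bounded (g ` closure \<Omega>)"
    using assms compact_closure_domain by (intro compact_imp_bounded compact_continuous_image)
  then obtain B where B: "\<And>x. x \<in> closure \<Omega> \<Longrightarrow> norm (g x) \<le> B"
    by (auto simp: bounded_iff)
  have "g absolutely_integrable_on \<Omega>"
  proof (rule measurable_bounded_by_integrable_imp_absolutely_integrable[OF meas domain_sets])
    show "(\<lambda>_. B) integrable_on \<Omega>"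
      by (intro integrable_on_const domain_lmeasurable)
  qed (use B closure_subset in blast)
  then show "integrable (lebesgue_on \<Omega>) g"
    using domain_sets by (simp add: set_integrable_def integrable_restrict_space)
qed

lemma Vh_L2: "v \<in> V \<Longrightarrow> v \<in> L2 \<Omega>"
  unfolding L2_def
  by (intro CollectI conjI bounded_continuous_integrable continuous_on_power Vh_D(1))

lemma Vh_vanishing:
  assumes "v \<in> V" "\<And>x. x \<in> \<Omega> \<Longrightarrow> v x = 0"
  shows "v = (\<lambda>_. 0)"
  using assms Vh_D(3) by (intro ext) metis

text \<open>Turns almost everywhere statements about continuous or piecewise constant functions into
  statements without exceptions.\<close>

lemma null_set_contains_no_open:
  assumes "AE x in lebesgue_on \<Omega>. x \<notin> S" "open S" "S \<subseteq> \<Omega>"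
  shows "S = {}"
proof -
  have "AE x in lebesgue. x \<in> \<Omega> \<longrightarrow> x \<notin> S"
    using assms(1) domain_sets by (simp add: AE_restrict_space_iff)
  then obtain N where "negligible N" "{x. \<not> (x \<in> \<Omega> \<longrightarrow> x \<notin> S)} \<subseteq> N"
    unfolding eventually_ae_filter_negligible by blast
  then have "negligible S" using assms(3) by (elim negligible_subset) blast
  then show ?thesis using open_not_negligible[OF assms(2)] by blast
qed

text \<open>The form is definite on genuine functions because elements of \<open>V\<close> are
  continuous in \<Omega>, where their nonzero set is open, and vanish outside by definition.\<close>

lemma L2_inner_pos:
  assumes "v \<in> V" "v \<noteq> (\<lambda>_. 0)"
  shows "L2_inner \<Omega> v v > 0"
proof (rule ccontr)
  assume "\<not> L2_inner \<Omega> v v > 0"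
  then have "L2_inner \<Omega> v v = 0"
    using L2_inner_nonneg[of \<Omega> v] by linarith
  then have "(LINT x|lebesgue_on \<Omega>. v x * v x) = 0"
    by (simp add: L2_inner_def)
  then have "AE x in lebesgue_on \<Omega>. v x * v x = 0"
    using L2_integrable_mult[OF Vh_L2 Vh_L2, OF assms(1) assms(1)]
    by (subst (asm) integral_nonneg_eq_0_iff_AE) auto
  then have "AE x in lebesgue_on \<Omega>. x \<notin> {x \<in> \<Omega>. v x \<noteq> 0}" by eventually_elim simp
  moreover have "open {x \<in> \<Omega>. v x \<noteq> 0}"
    using continuous_open_preimage[of \<Omega> v "- {0}"] open_domain Vh_D(1)[OF assms(1)] closure_subset
    by (auto simp: vimage_def Int_def intro: continuous_on_subset)
  ultimately have "{x \<in> \<Omega>. v x \<noteq> 0} = {}" by (intro null_set_contains_no_open) auto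
  then show False using Vh_vanishing[OF assms(1)] assms(2) by blast
qed

text \<open>The nodes are the vertices of all simplices: the zero set of a nonconstant affine
  function is a hyperplane, hence convex, and so contains a simplex along with its vertices.\<close>

lemma finite_nodes:
  obtains P where "finite P" "\<And>v. v \<in> V \<Longrightarrow> (\<And>p. p \<in> P \<Longrightarrow> v p = 0) \<Longrightarrow> v = (\<lambda>_. 0)"
proof -
  have "\<exists>C. finite C \<and> K = convex hull C" if "K \<in> \<T>" for K using mesh_elem[OF that] by metis
  then obtain C where C: "\<And>K. K \<in> \<T> \<Longrightarrow> finite (C K)" "\<And>K. K \<in> \<T> \<Longrightarrow> K = convex hull (C K)" by metis
  show thesis
  proof (rule that[of "\<Union>K\<in>\<T>. C K"])
    show "finite (\<Union>K\<in>\<T>. C K)" using C finite_mesh by auto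
    fix v assume v: "v \<in> V" "\<And>p. p \<in> (\<Union>K\<in>\<T>. C K) \<Longrightarrow> v p = 0"
    show "v = (\<lambda>_. 0)"
    proof (rule Vh_vanishing[OF v(1)])
      fix x assume "x \<in> \<Omega>"
      then obtain K where K: "K \<in> \<T>" "x \<in> K" using Union_mesh closure_subset by blast
      obtain a c where ac: "\<forall>x\<in>K. v x = a \<bullet> x + c" using Vh_D(2)[OF v(1) K(1)] by blast
      have "C K \<subseteq> K" using C(2)[OF K(1)] hull_subset by metis
      then have "C K \<subseteq> {x. a \<bullet> x = - c}" using ac v(2) K(1) by force
      then have "convex hull (C K) \<subseteq> {x. a \<bullet> x = - c}" by (intro hull_minimal convex_hyperplane)
      then have "K \<subseteq> {x. a \<bullet> x = - c}" using C(2)[OF K(1)] by simp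
      then show "v x = 0" using ac K(2) by auto
    qed
  qed
qed

section \<open>Gradients of finite element functions\<close>

lemma GDERIV_unique:
  fixes v :: "'a \<Rightarrow> real"
  assumes "GDERIV v x :> D" "GDERIV v x :> D'"
  shows "D = D'"
proof -
  have "(\<lambda>h. h \<bullet> D) = (\<lambda>h. h \<bullet> D')"
    using assms has_derivative_unique unfolding gderiv_def by blast
  then show ?thesis by (metis vector_eq_ldot)
qed

lemma grad_eq:
  fixes v :: "'a \<Rightarrow> real"
  assumes "GDERIV v x :> D"
  shows "grad v x = D"
  unfolding grad_def using assms GDERIV_unique by (blast intro: the_equality)

lemma Vh_GDERIV:
  fixes v :: "'a \<Rightarrow> real"
  assumes "\<forall>y\<in>K. v y = a \<bullet> y + c" "x \<in> interior K"
  shows "GDERIV v x :> a"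
proof -
  have "((\<lambda>y. a \<bullet> y + c) has_derivative (\<lambda>h. h \<bullet> a)) (at x)"
    by (auto intro!: derivative_eq_intros simp: inner_commute)
  then have "(v has_derivative (\<lambda>h. h \<bullet> a)) (at x)"
    by (rule has_derivative_transform_within_open[OF _ open_interior assms(2)])
       (use assms(1) interior_subset[of K] in \<open>auto simp: subset_iff\<close>)
  then show ?thesis by (simp add: gderiv_def)
qed

lemma grad_const:
  assumes "v \<in> V" "K \<in> \<T>"
  obtains a c where "\<And>x. x \<in> K \<Longrightarrow> v x = a \<bullet> x + c" "\<And>x. x \<in> interior K \<Longrightarrow> grad v x = a"
  using Vh_D(2)[OF assms] Vh_GDERIV grad_eq by metis

lemma grad_lincomb:
  assumes "v \<in> V" "w \<in> V" "x \<in> regular_part"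
  shows "grad (\<lambda>x. s * v x + t * w x) x = s *\<^sub>R grad v x + t *\<^sub>R grad w x"
proof -
  obtain K where K: "K \<in> \<T>" "x \<in> interior K" using assms(3) by (auto simp: regular_part_def)
  obtain a c where a: "\<forall>x\<in>K. v x = a \<bullet> x + c" using Vh_D(2)[OF assms(1) K(1)] by blast
  obtain a' c' where a': "\<forall>x\<in>K. w x = a' \<bullet> x + c'" using Vh_D(2)[OF assms(2) K(1)] by blast
  have "\<forall>x\<in>K. s * v x + t * w x = (s *\<^sub>R a + t *\<^sub>R a') \<bullet> x + (s * c + t * c')"
    using a a' by (simp add: algebra_simps)
  from grad_eq[OF Vh_GDERIV[where v = "\<lambda>x. s * v x + t * w x", OF this K(2)]]
  show ?thesis
    using grad_eq[OF Vh_GDERIV[OF a K(2)]] grad_eq[OF Vh_GDERIV[OF a' K(2)]] by simp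
qed

lemma AE_regular_part: "AE x in lebesgue_on \<Omega>. x \<in> regular_part"
proof -
  have "AE x in lebesgue. x \<in> \<Omega> \<longrightarrow> x \<in> regular_part"
    unfolding eventually_ae_filter_negligible using negligible_singular_part by (intro exI[of _ "\<Omega> - regular_part"]) auto
  then show ?thesis using domain_sets by (simp add: AE_restrict_space_iff)
qed

text \<open>On the skeleton of the mesh \<open>grad\<close> may be an unspecified value, so
  integrability is proved for the constant pieces on the open simplices and then carried across the
  null set.\<close>

lemma grad_inner_integrable:
  assumes "v \<in> V" "w \<in> V"
  shows "integrable (lebesgue_on \<Omega>) (\<lambda>x. grad v x \<bullet> grad w x)"
proof -
  let ?g = "\<lambda>x. grad v x \<bullet> grad w x"
  have "?g absolutely_integrable_on interior K" if K: "K \<in> \<T>" for K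
  proof -
    obtain a c where a: "\<And>x. x \<in> interior K \<Longrightarrow> grad v x = a" using grad_const[OF assms(1) K] by metis
    obtain b c where b: "\<And>x. x \<in> interior K \<Longrightarrow> grad w x = b" using grad_const[OF assms(2) K] by metis
    have "interior K \<in> lmeasurable"
      using mesh_compact[OF K] bounded_subset[OF compact_imp_bounded interior_subset]
      by (intro lmeasurable_open) auto
    then have "(\<lambda>_. a \<bullet> b) absolutely_integrable_on interior K" by (rule absolutely_integrable_on_const)
    then show ?thesis
      by (rule absolutely_integrable_spike[OF _ negligible_empty]) (simp add: a b)
  qed
  then have "?g absolutely_integrable_on regular_part"
    unfolding regular_part_def using finite_mesh by (intro set_integrable_UN) auto
  moreover have "regular_part - \<Omega> = {}" using regular_part_subset by blast
  ultimately have "?g absolutely_integrable_on \<Omega>"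
    using negligible_singular_part
    by (subst absolutely_integrable_spike_set_eq[where T = regular_part]) (auto elim: negligible_subset)
  then show ?thesis using domain_sets by (simp add: set_integrable_def integrable_restrict_space)
qed

lemma grad_inner_sym: "grad_inner \<Omega> v w = grad_inner \<Omega> w v"
  by (simp add: grad_inner_def inner_commute)

lemma grad_inner_lin:
  assumes "v \<in> V" "w \<in> V" "z \<in> V"
  shows "grad_inner \<Omega> (\<lambda>x. s * v x + t * w x) z = s * grad_inner \<Omega> v z + t * grad_inner \<Omega> w z"
proof -
  have "grad_inner \<Omega> (\<lambda>x. s * v x + t * w x) z =
      (LINT x|lebesgue_on \<Omega>. s * (grad v x \<bullet> grad z x) + t * (grad w x \<bullet> grad z x))"
    unfolding grad_inner_def
  proof (rule integral_cong_AE)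
    show "AE x in lebesgue_on \<Omega>. grad (\<lambda>x. s * v x + t * w x) x \<bullet> grad z x =
        s * (grad v x \<bullet> grad z x) + t * (grad w x \<bullet> grad z x)"
      using AE_regular_part by eventually_elim (simp add: grad_lincomb assms inner_add_left)
    show "(\<lambda>x. grad (\<lambda>x. s * v x + t * w x) x \<bullet> grad z x) \<in> borel_measurable (lebesgue_on \<Omega>)"
      by (intro borel_measurable_integrable grad_inner_integrable Vh_lincomb assms)
    show "(\<lambda>x. s * (grad v x \<bullet> grad z x) + t * (grad w x \<bullet> grad z x)) \<in> borel_measurable (lebesgue_on \<Omega>)"
      by (intro borel_measurable_integrable Bochner_Integration.integrable_add integrable_mult_right
          grad_inner_integrable assms)
  qed
  also have "\<dots> = s * grad_inner \<Omega> v z + t * grad_inner \<Omega> w z"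
    unfolding grad_inner_def
    using grad_inner_integrable[OF assms(1,3)] grad_inner_integrable[OF assms(2,3)]
    by (subst Bochner_Integration.integral_add) auto
  finally show ?thesis .
qed

text \<open>A vanishing integral makes the gradient zero almost everywhere, hence \<open>v\<close>
  constant on each simplex, as its interior is not null. Then \<open>v\<close> is continuous with
  finitely many values on a connected set, therefore constant, and a bounded domain has a boundary
  point where \<open>v\<close> is zero.\<close>

lemma grad_inner_pos:
  assumes "v \<in> V" "v \<noteq> (\<lambda>_. 0)"
  shows "grad_inner \<Omega> v v > 0"
proof (rule ccontr)
  assume "\<not> grad_inner \<Omega> v v > 0"
  moreover have "grad_inner \<Omega> v v \<ge> 0" by (simp add: grad_inner_def)
  ultimately have "grad_inner \<Omega> v v = 0" by linarith
  then have "(LINT x|lebesgue_on \<Omega>. grad v x \<bullet> grad v x) = 0" by (simp add: grad_inner_def)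
  then have AE0: "AE x in lebesgue_on \<Omega>. grad v x = 0"
    using grad_inner_integrable[OF assms(1) assms(1)]
    by (subst (asm) integral_nonneg_eq_0_iff_AE) auto
  have "\<exists>c. \<forall>x\<in>K. v x = c" if K: "K \<in> \<T>" for K
  proof -
    obtain a c where a: "\<And>x. x \<in> K \<Longrightarrow> v x = a \<bullet> x + c" "\<And>x. x \<in> interior K \<Longrightarrow> grad v x = a"
      using grad_const[OF assms(1) K] by metis
    have "a = 0"
    proof (rule ccontr)
      assume "a \<noteq> 0"
      from AE0 have "AE x in lebesgue_on \<Omega>. x \<notin> interior K"
        by eventually_elim (use a(2) \<open>a \<noteq> 0\<close> in auto)
      moreover have "interior K \<subseteq> \<Omega>" using regular_part_subset K by (auto simp: regular_part_def)
      ultimately have "interior K = {}" by (intro null_set_contains_no_open) auto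
      then show False using mesh_elem[OF K] by metis
    qed
    then show ?thesis using a(1) by auto
  qed
  then obtain c where c: "\<And>K x. K \<in> \<T> \<Longrightarrow> x \<in> K \<Longrightarrow> v x = c K" by metis
  have "v ` closure \<Omega> \<subseteq> c ` \<T>" using c Union_mesh by blast
  then have "finite (v ` closure \<Omega>)" using finite_mesh by (meson finite_imageI finite_subset)
  then have "v constant_on closure \<Omega>"
    using continuous_finite_range_constant[of "closure \<Omega>" v] Vh_D(1)[OF assms(1)]
      convex_connected[OF convex_closure[OF convex_domain]] by simp
  then obtain d where d: "\<And>x. x \<in> closure \<Omega> \<Longrightarrow> v x = d" by (auto simp: constant_on_def)
  have "frontier \<Omega> \<noteq> {}"
    using bounded_domain domain_nonempty not_bounded_UNIV by (auto simp: frontier_eq_empty)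
  then obtain y where "y \<in> closure \<Omega>" "y \<notin> \<Omega>"
    using open_domain by (auto simp: frontier_def interior_open)
  then have "d = 0" using d Vh_D(3)[OF assms(1)] by metis
  then have "v = (\<lambda>_. 0)" using d closure_subset by (intro Vh_vanishing[OF assms(1)]) blast
  with assms(2) show False ..
qed

sublocale mass: inner_product_on V "L2_inner \<Omega>"
  by (unfold_locales, rule Vh_zero)
    (rule Vh_lincomb L2_inner_sym L2_inner_lin L2_inner_pos; (rule Vh_L2)?; assumption)+

sublocale stiff: inner_product_on V "grad_inner \<Omega>"
  by (unfold_locales, rule Vh_zero)
    (rule Vh_lincomb grad_inner_sym grad_inner_lin grad_inner_pos; assumption)+

end

section \<open>Coordinates in the finite element space\<close>

text \<open>Equivalence of norms in finite dimension. In coordinates with respect to a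
  \<open>k\<close>-orthonormal basis each product of two coefficients is at most
  \<open>k v v\<close>, so \<open>m v v\<close> is bounded by the sum of the entries of its Gram
  matrix times \<open>k v v\<close>.\<close>

lemma equivalent_inner_products:
  assumes "inner_product_on V m" "inner_product_on V k" "orthonormal_basis V k N e"
  obtains \<mu> where "\<mu> > 0" "\<And>v. v \<in> V \<Longrightarrow> \<mu> * m v v \<le> k v v"
proof -
  interpret m: inner_product_on V m by fact
  interpret k: inner_product_on V k by fact
  have e: "e i \<in> V" if "i < N" for i using assms(3) that by (simp add: orthonormal_basis_def)
  \<comment> \<open>The added 1 makes \<open>C\<close> positive even when the Gram matrix is
    empty.\<close>
  define C where "C = 1 + (\<Sum>i<N. \<Sum>j<N. \<bar>m (e i) (e j)\<bar>)"
  have "C > 0" unfolding C_def by (intro add_pos_nonneg sum_nonneg) auto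
  have "m v v \<le> C * k v v" if v: "v \<in> V" for v
  proof -
    define b where "b i = k v (e i)" for i
    have vb: "v = (\<lambda>x. \<Sum>i<N. b i * e i x)" using assms(3) v by (auto simp: orthonormal_basis_def b_def)
    have kv: "k v v = (\<Sum>i<N. (b i)\<^sup>2)" using k.parseval[OF assms(3) v] by (simp add: b_def)
    have bb: "\<bar>b i * b j\<bar> \<le> k v v" if "i < N" "j < N" for i j
    proof -
      have "(b i)\<^sup>2 \<le> k v v" "(b j)\<^sup>2 \<le> k v v"
        unfolding kv using that by (auto intro: member_le_sum)
      moreover have "0 \<le> (\<bar>b i\<bar> - \<bar>b j\<bar>)\<^sup>2" by simp
      then have "2 * (\<bar>b i\<bar> * \<bar>b j\<bar>) \<le> (b i)\<^sup>2 + (b j)\<^sup>2" by (simp add: power2_diff)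
      ultimately show ?thesis by (simp add: abs_mult)
    qed
    have "m v v = (\<Sum>i<N. b i * m (e i) v)" by (subst vb) (rule m.form_sum[OF e v])
    also have "\<dots> = (\<Sum>i<N. b i * (\<Sum>j<N. b j * m (e i) (e j)))"
    proof (intro sum.cong refl arg_cong2[where f = "(*)"])
      fix i assume "i \<in> {..<N}"
      then show "m (e i) v = (\<Sum>j<N. b j * m (e i) (e j))"
        by (subst vb) (intro m.form_sum' e; simp)
    qed
    also have "\<dots> = (\<Sum>i<N. \<Sum>j<N. (b i * b j) * m (e i) (e j))"
      by (simp add: sum_distrib_left mult.assoc)
    also have "\<dots> \<le> (\<Sum>i<N. \<Sum>j<N. k v v * \<bar>m (e i) (e j)\<bar>)"
    proof (intro sum_mono)
      fix i j assume "i \<in> {..<N}" "j \<in> {..<N}"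
      then have "\<bar>b i * b j\<bar> * \<bar>m (e i) (e j)\<bar> \<le> k v v * \<bar>m (e i) (e j)\<bar>"
        using bb by (intro mult_right_mono) auto
      then show "(b i * b j) * m (e i) (e j) \<le> k v v * \<bar>m (e i) (e j)\<bar>"
        using abs_ge_self[of "(b i * b j) * m (e i) (e j)"] unfolding abs_mult by linarith
    qed
    also have "\<dots> = k v v * (\<Sum>i<N. \<Sum>j<N. \<bar>m (e i) (e j)\<bar>)" by (simp add: sum_distrib_left)
    also have "\<dots> \<le> C * k v v" using k.nonneg[OF v] by (simp add: C_def algebra_simps)
    finally show ?thesis .
  qed
  then have "1 / C * m v v \<le> k v v" if "v \<in> V" for v
    using that \<open>C > 0\<close> by (simp add: divide_le_eq mult.commute)
  then show thesis using \<open>C > 0\<close> by (intro that[of "1 / C"]) auto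
qed

context mesh
begin

lemma mass_basis: "\<exists>N e. orthonormal_basis V (L2_inner \<Omega>) N e"
  using finite_nodes orthonormal_basis_exists[OF _ mass.inner_product_on_axioms] by metis

lemma stiff_basis: "\<exists>N e. orthonormal_basis V (grad_inner \<Omega>) N e"
  using finite_nodes orthonormal_basis_exists[OF _ stiff.inner_product_on_axioms] by metis

lemma poincare:
  obtains \<mu> where "\<mu> > 0" "\<And>v. v \<in> V \<Longrightarrow> \<mu> * L2_inner \<Omega> v v \<le> grad_inner \<Omega> v v"
  using stiff_basis equivalent_inner_products[OF mass.inner_product_on_axioms stiff.inner_product_on_axioms]
  by metis

lemma grad_norm_square: "(grad_norm \<Omega> v)\<^sup>2 = grad_inner \<Omega> v v"
proof -
  have "grad_inner \<Omega> v v \<ge> 0" by (simp add: grad_inner_def)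
  then show ?thesis by (simp add: grad_norm_def)
qed

section \<open>Riesz representation and the steady state\<close>

lemma riesz:
  assumes "F \<in> L2 \<Omega>"
  obtains z where "z \<in> V" "\<And>\<psi>. \<psi> \<in> V \<Longrightarrow> grad_inner \<Omega> z \<psi> = L2_inner \<Omega> F \<psi>"
proof -
  obtain N e where onb: "orthonormal_basis V (grad_inner \<Omega>) N e" using stiff_basis by blast
  then have e: "e i \<in> V" if "i < N" for i using that by (simp add: orthonormal_basis_def)
  define z where "z = (\<lambda>x. \<Sum>i<N. L2_inner \<Omega> F (e i) * e i x)"
  show thesis
  proof (rule that)
    show "z \<in> V" unfolding z_def by (rule mass.sum_mem[OF e])
    fix \<psi> assume psi: "\<psi> \<in> V"
    then have p: "\<psi> = (\<lambda>x. \<Sum>i<N. grad_inner \<Omega> \<psi> (e i) * e i x)"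
      using onb by (simp add: orthonormal_basis_def)
    have "grad_inner \<Omega> z \<psi> = (\<Sum>i<N. L2_inner \<Omega> F (e i) * grad_inner \<Omega> (e i) \<psi>)"
      unfolding z_def by (rule stiff.form_sum[OF e psi])
    also have "\<dots> = (\<Sum>i<N. grad_inner \<Omega> \<psi> (e i) * L2_inner \<Omega> F (e i))"
      by (intro sum.cong refl) (simp add: grad_inner_sym[of _ \<psi>])
    also have "\<dots> = L2_inner \<Omega> F (\<lambda>x. \<Sum>i<N. grad_inner \<Omega> \<psi> (e i) * e i x)"
      by (rule L2_inner_sum[symmetric]) (auto intro: e Vh_L2 assms)
    finally show "grad_inner \<Omega> z \<psi> = L2_inner \<Omega> F \<psi>" using p by simp
  qed
qed

lemma steady_state:
  assumes "F \<in> L2 \<Omega>"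
  obtains x where "x \<in> V"
    "\<And>\<psi>. \<psi> \<in> V \<Longrightarrow> (1 + grad_inner \<Omega> x x) * grad_inner \<Omega> x \<psi> = L2_inner \<Omega> F \<psi>"
proof -
  obtain z where z: "z \<in> V" "\<And>\<psi>. \<psi> \<in> V \<Longrightarrow> grad_inner \<Omega> z \<psi> = L2_inner \<Omega> F \<psi>"
    using riesz[OF assms] by blast
  define q where "q = grad_inner \<Omega> z z"
  have "q \<ge> 0" unfolding q_def using stiff.nonneg[OF z(1)] .
  \<comment> \<open>Inserting \<open>s z\<close> reduces the stationary equation to
    \<open>s * (1 + s\<^sup>2 * q) = 1\<close>; the left-hand side is 0 at 0 and
    \<open>1 + q \<ge> 1\<close> at 1.\<close>
  have "\<exists>s\<ge>0. s \<le> 1 \<and> (\<lambda>s. s * (1 + s\<^sup>2 * q)) s = 1"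
    using \<open>q \<ge> 0\<close> by (intro IVT') (auto intro!: continuous_intros)
  then obtain s where s: "s * (1 + s\<^sup>2 * q) = 1" by auto
  let ?x = "\<lambda>y. s * z y"
  have x: "?x \<in> V" by (rule mass.scale[OF z(1)])
  have gx: "grad_inner \<Omega> ?x \<psi> = s * grad_inner \<Omega> z \<psi>" if "\<psi> \<in> V" for \<psi>
    by (rule stiff.form_scale[OF z(1) that])
  have "grad_inner \<Omega> ?x ?x = s\<^sup>2 * q"
    using gx[OF x] gx[OF z(1)] grad_inner_sym[of z ?x] by (simp add: q_def power2_eq_square)
  then have "(1 + grad_inner \<Omega> ?x ?x) * grad_inner \<Omega> ?x \<psi> = L2_inner \<Omega> F \<psi>" if "\<psi> \<in> V" for \<psi>
  proof -
    have "(1 + grad_inner \<Omega> ?x ?x) * grad_inner \<Omega> ?x \<psi> = (s * (1 + s\<^sup>2 * q)) * grad_inner \<Omega> z \<psi>"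
      using \<open>grad_inner \<Omega> ?x ?x = _\<close> gx[OF that] by simp
    then show ?thesis using s z(2)[OF that] by simp
  qed
  then show thesis using that x by blast
qed

end

locale mesh_basis = mesh \<Omega> \<T> for \<Omega> :: "'a::euclidean_space set" and \<T> +
  fixes N :: nat and e :: "nat \<Rightarrow> 'a \<Rightarrow> real" and \<mu> :: real
  assumes basis: "orthonormal_basis V (L2_inner \<Omega>) N e"
    and mu: "\<mu> > 0" "\<And>v. v \<in> V \<Longrightarrow> \<mu> * L2_inner \<Omega> v v \<le> grad_inner \<Omega> v v"
begin

definition coord :: "('a \<Rightarrow> real) \<Rightarrow> nat \<Rightarrow> real" where "coord v i = L2_inner \<Omega> v (e i)"

definition synth :: "(nat \<Rightarrow> real) \<Rightarrow> 'a \<Rightarrow> real" where "synth c = (\<lambda>x. \<Sum>i<N. c i * e i x)"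

lemma basis_mem: "i < N \<Longrightarrow> e i \<in> V"
  using basis by (simp add: orthonormal_basis_def)

lemma basis_unit: "i < N \<Longrightarrow> L2_inner \<Omega> (e i) (e i) = 1"
  using basis by (simp add: orthonormal_basis_def)

lemma synth_mem: "synth c \<in> V"
  unfolding synth_def by (rule mass.sum_mem[OF basis_mem])

lemma coord_synth: "i < N \<Longrightarrow> coord (synth c) i = c i"
  unfolding synth_def coord_def by (rule mass.coordinate_sum[OF basis])

lemma synth_coord: "v \<in> V \<Longrightarrow> synth (coord v) = v"
  using basis unfolding synth_def coord_def orthonormal_basis_def by metis

lemma synth_cong: "(\<And>i. i < N \<Longrightarrow> c i = d i) \<Longrightarrow> synth c = synth d"
  unfolding synth_def by (intro ext sum.cong) auto

lemma coord_eqI: "v \<in> V \<Longrightarrow> w \<in> V \<Longrightarrow> (\<And>i. i < N \<Longrightarrow> coord v i = coord w i) \<Longrightarrow> v = w"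
  using synth_cong[of "coord v" "coord w"] synth_coord[of v] synth_coord[of w] by simp

lemma L2_norm_coord: "v \<in> V \<Longrightarrow> L2_norm \<Omega> v = L2_set (coord v) {..<N}"
  using mass.parseval[OF basis] by (simp add: L2_norm_def L2_set_def coord_def)

lemma coord_diff: "v \<in> V \<Longrightarrow> w \<in> V \<Longrightarrow> i < N \<Longrightarrow> coord (\<lambda>x. v x - w x) i = coord v i - coord w i"
  unfolding coord_def by (rule mass.form_diff[OF _ _ basis_mem])

lemma L2_dist_coord:
  assumes "v \<in> V" "w \<in> V"
  shows "L2_dist \<Omega> v w = L2_set (\<lambda>i. coord v i - coord w i) {..<N}"
  unfolding L2_dist_def L2_norm_coord[OF mass.diff[OF assms]]
  using assms by (intro L2_set_cong) (auto simp: coord_diff)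

sublocale kirchhoff: coercive_matrix N "\<lambda>i j. grad_inner \<Omega> (e i) (e j)" \<mu>
proof
  show "grad_inner \<Omega> (e i) (e j) = grad_inner \<Omega> (e j) (e i)" for i j by (rule grad_inner_sym)
  fix x :: "nat \<Rightarrow> real"
  have "L2_inner \<Omega> (synth x) (synth x) = (\<Sum>i<N. (coord (synth x) i)\<^sup>2)"
    unfolding coord_def by (rule mass.parseval[OF basis synth_mem])
  also have "\<dots> = (\<Sum>i<N. (x i)\<^sup>2)" by (intro sum.cong) (auto simp: coord_synth)
  finally have 1: "L2_inner \<Omega> (synth x) (synth x) = (\<Sum>i<N. (x i)\<^sup>2)" .
  have "grad_inner \<Omega> (synth x) (synth x) = (\<Sum>i<N. x i * grad_inner \<Omega> (e i) (synth x))"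
    by (subst (1) synth_def) (rule stiff.form_sum[OF basis_mem synth_mem])
  also have "\<dots> = (\<Sum>i<N. x i * (\<Sum>j<N. x j * grad_inner \<Omega> (e i) (e j)))"
    unfolding synth_def by (intro sum.cong refl arg_cong2[where f = "(*)"] stiff.form_sum' basis_mem) auto
  finally show "\<mu> * (\<Sum>i<N. (x i)\<^sup>2) \<le> (\<Sum>i<N. \<Sum>j<N. grad_inner \<Omega> (e i) (e j) * x i * x j)"
    using mu(2)[OF synth_mem[of x]] 1 by (simp add: sum_distrib_left mult_ac)
qed (fact mu(1))

lemma grad_inner_basis:
  assumes "v \<in> V" "i < N"
  shows "grad_inner \<Omega> v (e i) = kirchhoff.lin (coord v) i"
proof -
  have "grad_inner \<Omega> (synth (coord v)) (e i) = (\<Sum>j<N. coord v j * grad_inner \<Omega> (e j) (e i))"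
    unfolding synth_def by (rule stiff.form_sum[OF basis_mem basis_mem[OF assms(2)]])
  then show ?thesis
    using synth_coord[OF assms(1)] by (simp add: kirchhoff.lin_def mult.commute grad_inner_sym[of _ "e i"])
qed

lemma grad_inner_coord:
  assumes "v \<in> V"
  shows "grad_inner \<Omega> v v = kirchhoff.form (coord v) (coord v)"
proof -
  have "grad_inner \<Omega> v (synth (coord v)) = (\<Sum>j<N. coord v j * grad_inner \<Omega> v (e j))"
    unfolding synth_def by (rule stiff.form_sum'[OF basis_mem assms])
  also have "\<dots> = (\<Sum>j<N. kirchhoff.lin (coord v) j * coord v j)"
    by (intro sum.cong) (auto simp: grad_inner_basis assms)
  finally show ?thesis
    using synth_coord[OF assms] by (simp add: kirchhoff.form_lin)
qed

lemma kop_coord: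
  "v \<in> V \<Longrightarrow> i < N \<Longrightarrow> (1 + grad_inner \<Omega> v v) * grad_inner \<Omega> v (e i) = kirchhoff.kop (coord v) i"
  by (simp add: kirchhoff.kop_def grad_inner_coord grad_inner_basis)

sublocale metric: Metric_space V "L2_dist \<Omega>"
proof
  show "0 \<le> L2_dist \<Omega> v w" for v w by (simp add: L2_dist_def L2_norm_nonneg)
  show "L2_dist \<Omega> v w = L2_dist \<Omega> w v" for v w
    unfolding L2_dist_def L2_norm_def L2_inner_def by (simp add: power2_commute flip: power2_eq_square)
  show "L2_dist \<Omega> v w = 0 \<longleftrightarrow> v = w" if "v \<in> V" "w \<in> V" for v w
    using that by (auto simp: L2_dist_coord L2_set_eq_0_iff intro: coord_eqI)
  show "L2_dist \<Omega> u w \<le> L2_dist \<Omega> u v + L2_dist \<Omega> v w" if "u \<in> V" "v \<in> V" "w \<in> V" for u v w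
    using that L2_set_triangle_ineq[of "\<lambda>i. coord u i - coord v i" "\<lambda>i. coord v i - coord w i" "{..<N}"]
    by (simp add: L2_dist_coord)
qed

lemma coord_le_dist: "v \<in> V \<Longrightarrow> w \<in> V \<Longrightarrow> i < N \<Longrightarrow> \<bar>coord v i - coord w i\<bar> \<le> L2_dist \<Omega> v w"
  unfolding L2_dist_coord using member_le_L2_set[of "{..<N}" i "\<lambda>i. \<bar>coord v i - coord w i\<bar>"]
  by (simp add: L2_set_def)

lemma dist_le_coord: "v \<in> V \<Longrightarrow> w \<in> V \<Longrightarrow> L2_dist \<Omega> v w \<le> (\<Sum>i<N. \<bar>coord v i - coord w i\<bar>)"
  unfolding L2_dist_coord by (rule L2_set_le_sum_abs)

text \<open>The \<open>L\<^sup>2\<close> norm on \<open>V\<close> lies between each single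
  coordinate and the sum of all of them in absolute value, so norm differentiability is
  coordinatewise; and by linearity it suffices to test the equation with the basis.\<close>

lemma semidiscrete_eq_at_iff:
  assumes u: "\<And>s. s \<ge> 0 \<Longrightarrow> u s \<in> V" and "t > 0" and g: "g \<in> L2 \<Omega>"
  shows "semidiscrete_eq_at \<Omega> \<T> g u t \<longleftrightarrow>
    (\<forall>i<N. ((\<lambda>s. coord (u s) i) has_real_derivative (L2_inner \<Omega> g (e i) - kirchhoff.kop (coord (u t)) i)) (at t))"
proof -
  \<comment> \<open>Nothing is known about \<open>u\<close> at negative times, so the quotients
    belong to \<open>V\<close> only for times close to the positive \<open>t\<close>.\<close>
  have ev: "\<forall>\<^sub>F s in at t. 0 \<le> s"
    using eventually_at_in_open'[of "{0<..}" t] \<open>t > 0\<close> by (auto elim: eventually_mono)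
  define q where "q w s = (\<lambda>x. (u s x - u t x) / (s - t) - w x)" for w s
  have q_alt: "q w s = (\<lambda>x. (1 / (s - t)) * (u s x - u t x) + (-1) * w x)" for w s
    by (simp add: q_def)
  have ut: "u t \<in> V" using u \<open>t > 0\<close> by simp
  have q: "q w s \<in> V" if "w \<in> V" "s \<ge> 0" for w s
    unfolding q_alt by (intro mass.lincomb mass.diff u ut that)
  have qi: "coord (q w s) i = (coord (u s) i - coord (u t) i) / (s - t) - coord w i"
    if "w \<in> V" "s \<ge> 0" "i < N" for w s i
    using mass.lin[OF mass.diff[OF u[OF that(2)] ut] that(1) basis_mem[OF that(3)], of "1 / (s - t)" "-1"]
      mass.form_diff[OF u[OF that(2)] ut basis_mem[OF that(3)]]
    by (simp add: q_alt coord_def)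
  have der: "((\<lambda>s. L2_norm \<Omega> (q w s)) \<longlongrightarrow> 0) (at t) \<longleftrightarrow>
      (\<forall>i<N. ((\<lambda>s. coord (u s) i) has_real_derivative coord w i) (at t))" if w: "w \<in> V" for w
  proof
    assume lim: "((\<lambda>s. L2_norm \<Omega> (q w s)) \<longlongrightarrow> 0) (at t)"
    show "\<forall>i<N. ((\<lambda>s. coord (u s) i) has_real_derivative coord w i) (at t)"
      unfolding has_field_derivative_iff
    proof (intro allI impI)
      fix i assume "i < N"
      have "((\<lambda>s. (coord (u s) i - coord (u t) i) / (s - t) - coord w i) \<longlongrightarrow> 0) (at t)"
      proof (rule Lim_null_comparison[OF _ lim])
        show "\<forall>\<^sub>F s in at t. norm ((coord (u s) i - coord (u t) i) / (s - t) - coord w i) \<le> L2_norm \<Omega> (q w s)"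
          using ev
        proof eventually_elim
          fix s :: real assume "0 \<le> s"
          then show "norm ((coord (u s) i - coord (u t) i) / (s - t) - coord w i) \<le> L2_norm \<Omega> (q w s)"
            using abs_L2_inner_unit_le[OF Vh_L2[OF q[OF w]] Vh_L2[OF basis_mem[OF \<open>i < N\<close>]] basis_unit[OF \<open>i < N\<close>]]
              qi[OF w _ \<open>i < N\<close>] by (simp add: coord_def)
        qed
      qed
      then show "((\<lambda>s. (coord (u s) i - coord (u t) i) / (s - t)) \<longlongrightarrow> coord w i) (at t)"
        by (rule LIM_zero_cancel)
    qed
  next
    assume H: "\<forall>i<N. ((\<lambda>s. coord (u s) i) has_real_derivative coord w i) (at t)"
    have lim: "((\<lambda>s. (coord (u s) i - coord (u t) i) / (s - t) - coord w i) \<longlongrightarrow> 0) (at t)" if "i < N" for i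
      by (rule LIM_zero) (use H that in \<open>simp add: has_field_derivative_iff\<close>)
    have "((\<lambda>s. \<Sum>i<N. \<bar>(coord (u s) i - coord (u t) i) / (s - t) - coord w i\<bar>) \<longlongrightarrow> 0) (at t)"
      by (rule tendsto_null_sum, rule tendsto_rabs_zero, rule lim) simp
    then show "((\<lambda>s. L2_norm \<Omega> (q w s)) \<longlongrightarrow> 0) (at t)"
    proof (rule Lim_null_comparison[rotated])
      show "\<forall>\<^sub>F s in at t. norm (L2_norm \<Omega> (q w s)) \<le>
          (\<Sum>i<N. \<bar>(coord (u s) i - coord (u t) i) / (s - t) - coord w i\<bar>)"
        using ev
      proof eventually_elim
        fix s :: real assume "0 \<le> s"
        then have "L2_norm \<Omega> (q w s) \<le> (\<Sum>i<N. \<bar>coord (q w s) i\<bar>)"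
          unfolding L2_norm_coord[OF q[OF w \<open>0 \<le> s\<close>]] by (intro L2_set_le_sum_abs)
        also have "\<dots> = (\<Sum>i<N. \<bar>(coord (u s) i - coord (u t) i) / (s - t) - coord w i\<bar>)"
          using qi[OF w \<open>0 \<le> s\<close>] by (intro sum.cong) auto
        finally show "norm (L2_norm \<Omega> (q w s)) \<le> (\<Sum>i<N. \<bar>(coord (u s) i - coord (u t) i) / (s - t) - coord w i\<bar>)"
          by (simp add: L2_norm_nonneg)
      qed
    qed
  qed
  have eq: "(\<forall>\<psi>\<in>V. L2_inner \<Omega> w \<psi> + (1 + (grad_norm \<Omega> (u t))\<^sup>2) * grad_inner \<Omega> (u t) \<psi> = L2_inner \<Omega> g \<psi>) \<longleftrightarrow>
      (\<forall>i<N. coord w i = L2_inner \<Omega> g (e i) - kirchhoff.kop (coord (u t)) i)" if w: "w \<in> V" for w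
  proof
    assume H: "\<forall>\<psi>\<in>V. L2_inner \<Omega> w \<psi> + (1 + (grad_norm \<Omega> (u t))\<^sup>2) * grad_inner \<Omega> (u t) \<psi> = L2_inner \<Omega> g \<psi>"
    show "\<forall>i<N. coord w i = L2_inner \<Omega> g (e i) - kirchhoff.kop (coord (u t)) i"
    proof (intro allI impI)
      fix i assume i: "i < N"
      show "coord w i = L2_inner \<Omega> g (e i) - kirchhoff.kop (coord (u t)) i"
        using bspec[OF H basis_mem[OF i]] kop_coord[OF ut i] by (simp add: coord_def grad_norm_square)
    qed
  next
    assume H: "\<forall>i<N. coord w i = L2_inner \<Omega> g (e i) - kirchhoff.kop (coord (u t)) i"
    show "\<forall>\<psi>\<in>V. L2_inner \<Omega> w \<psi> + (1 + (grad_norm \<Omega> (u t))\<^sup>2) * grad_inner \<Omega> (u t) \<psi> = L2_inner \<Omega> g \<psi>"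
    proof
      fix \<psi> assume psi: "\<psi> \<in> V"
      let ?b = "coord \<psi>"
      have p: "\<psi> = (\<lambda>x. \<Sum>i<N. ?b i * e i x)" using synth_coord[OF psi] by (simp add: synth_def)
      have 1: "L2_inner \<Omega> w \<psi> = (\<Sum>i<N. ?b i * coord w i)"
        by (subst p) (unfold coord_def[of w], rule mass.form_sum'[OF basis_mem w])
      have 2: "grad_inner \<Omega> (u t) \<psi> = (\<Sum>i<N. ?b i * grad_inner \<Omega> (u t) (e i))"
        by (subst p) (rule stiff.form_sum'[OF basis_mem ut])
      have 3: "L2_inner \<Omega> g \<psi> = (\<Sum>i<N. ?b i * L2_inner \<Omega> g (e i))"
        by (subst p) (rule L2_inner_sum[OF Vh_L2[OF basis_mem] g])
      have "L2_inner \<Omega> w \<psi> + (1 + (grad_norm \<Omega> (u t))\<^sup>2) * grad_inner \<Omega> (u t) \<psi> =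
          (\<Sum>i<N. ?b i * (coord w i + (1 + grad_inner \<Omega> (u t) (u t)) * grad_inner \<Omega> (u t) (e i)))"
        by (simp add: 1 2 grad_norm_square sum_distrib_left sum.distrib distrib_left mult_ac)
      also have "\<dots> = (\<Sum>i<N. ?b i * L2_inner \<Omega> g (e i))"
        using H by (intro sum.cong) (auto simp: kop_coord[OF ut])
      finally show "L2_inner \<Omega> w \<psi> + (1 + (grad_norm \<Omega> (u t))\<^sup>2) * grad_inner \<Omega> (u t) \<psi> = L2_inner \<Omega> g \<psi>"
        using 3 by simp
    qed
  qed
  show ?thesis
  proof
    assume "semidiscrete_eq_at \<Omega> \<T> g u t"
    then obtain w where "w \<in> V" "((\<lambda>s. L2_norm \<Omega> (q w s)) \<longlongrightarrow> 0) (at t)"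
      "\<forall>\<psi>\<in>V. L2_inner \<Omega> w \<psi> + (1 + (grad_norm \<Omega> (u t))\<^sup>2) * grad_inner \<Omega> (u t) \<psi> = L2_inner \<Omega> g \<psi>"
      by (auto simp: semidiscrete_eq_at_def q_def)
    then show "\<forall>i<N. ((\<lambda>s. coord (u s) i) has_real_derivative (L2_inner \<Omega> g (e i) - kirchhoff.kop (coord (u t)) i)) (at t)"
      using der eq by metis
  next
    let ?w = "synth (\<lambda>i. L2_inner \<Omega> g (e i) - kirchhoff.kop (coord (u t)) i)"
    assume "\<forall>i<N. ((\<lambda>s. coord (u s) i) has_real_derivative (L2_inner \<Omega> g (e i) - kirchhoff.kop (coord (u t)) i)) (at t)"
    then have "\<forall>i<N. ((\<lambda>s. coord (u s) i) has_real_derivative coord ?w i) (at t)"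
      by (simp add: coord_synth)
    then have "((\<lambda>s. L2_norm \<Omega> (q ?w s)) \<longlongrightarrow> 0) (at t)"
      using der[OF synth_mem] by blast
    moreover have "\<forall>\<psi>\<in>V. L2_inner \<Omega> ?w \<psi> + (1 + (grad_norm \<Omega> (u t))\<^sup>2) * grad_inner \<Omega> (u t) \<psi> = L2_inner \<Omega> g \<psi>"
      using eq[OF synth_mem] by (simp add: coord_synth)
    ultimately show "semidiscrete_eq_at \<Omega> \<T> g u t"
      unfolding semidiscrete_eq_at_def q_def using synth_mem by blast
  qed
qed

end

text \<open>Absolute continuity is applied to a division that consists of one interval.\<close>

lemma abs_cont_real_continuous:
  assumes "abs_cont_real g"
  shows "continuous_on {0..} g"
proof (rule continuous_on_atLeastI)
  fix b :: real
  show "continuous_on {0..b} g"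
    unfolding continuous_on_iff
  proof (intro ballI allI impI)
    fix t \<epsilon> assume t: "t \<in> {0..b}" and "(\<epsilon>::real) > 0"
    \<comment> \<open>Absolute continuity is formulated for intervals of positive length, but
      \<open>b\<close> may be 0 here.\<close>
    have "b + 1 > 0" using t by simp
    from assms[unfolded locally_absolutely_continuous_def, THEN spec, THEN mp, OF this, THEN spec, THEN mp, OF \<open>\<epsilon> > 0\<close>]
    obtain \<delta> where \<delta>: "\<delta> > 0" "\<And>D. D division_of \<Union>D \<Longrightarrow> \<Union>D \<subseteq> {0..b + 1} \<Longrightarrow> (\<Sum>K\<in>D. Sup K - Inf K) < \<delta> \<Longrightarrow>
        (\<Sum>K\<in>D. \<bar>g (Inf K) - g (Sup K)\<bar>) < \<epsilon>" by blast
    show "\<exists>d>0. \<forall>s\<in>{0..b}. dist s t < d \<longrightarrow> dist (g s) (g t) < \<epsilon>"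
    proof (intro exI[of _ \<delta>] conjI ballI impI)
      fix s assume s: "s \<in> {0..b}" "dist s t < \<delta>"
      have "\<bar>g u - g v\<bar> < \<epsilon>" if "0 \<le> u" "u \<le> v" "v \<le> b" "v - u < \<delta>" for u v
      proof -
        have "{u..v} \<noteq> {}" using that by simp
        then have "{{u..v}} division_of \<Union>{{u..v}}"
          using division_of_self[of u v] by simp
        from \<delta>(2)[OF this] show ?thesis using that by simp
      qed
      from this[of s t] this[of t s] show "dist (g s) (g t) < \<epsilon>"
        using s t by (cases "s \<le> t") (auto simp: dist_real_def abs_minus_commute)
    qed (fact \<delta>(1))
  qed
qed

section \<open>Measurability of time-dependent data\<close>

lemma AE_lebesgue_on_iff_negligible:
  assumes "S \<in> sets lebesgue"
  shows "(AE x in lebesgue_on S. P x) \<longleftrightarrow> (\<exists>N. negligible N \<and> (\<forall>x\<in>S. x \<notin> N \<longrightarrow> P x))"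
proof -
  have "(AE x in lebesgue_on S. P x) \<longleftrightarrow> (AE x in lebesgue. x \<in> S \<longrightarrow> P x)"
    using assms by (simp add: AE_restrict_space_iff)
  then show ?thesis unfolding eventually_ae_filter_negligible by auto
qed

text \<open>Almost everywhere the coefficient of \<open>f t\<close> is the limit of the coefficients
  of the simple functions, by \<open>abs_L2_inner_unit_le\<close>, and these are measurable. The
  representative obeys its bounds at every time, so that later arguments need not track exceptional
  sets for them.\<close>

lemma Linf_L2_inner_representative:
  assumes f: "f \<in> Linf_L2 \<Omega>" and C: "AE t in lebesgue_on {0<..}. L2_norm \<Omega> (f t) \<le> C" "C \<ge> 0"
    and e: "e \<in> L2 \<Omega>" "L2_inner \<Omega> e e = 1"
  obtains h where "\<And>a b. h integrable_on {a..b}" "\<And>t. \<bar>h t\<bar> \<le> C"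
    "AE t in lebesgue_on {0<..}. L2_inner \<Omega> (f t) e = h t"
proof -
  let ?M = "lebesgue_on {0::real<..}"
  have fL2: "AE t in ?M. f t \<in> L2 \<Omega>" using f by (simp add: Linf_L2_def)
  obtain s where s: "\<And>n. simple_function ?M (s n)" "\<And>n. s n ` {0<..} \<subseteq> L2 \<Omega>"
    "AE t in ?M. (\<lambda>n. L2_dist \<Omega> (s n t) (f t)) \<longlonglongrightarrow> 0"
    using f by (auto simp: Linf_L2_def)
  \<comment> \<open>Where the sequence diverges \<open>lim\<close> is arbitrary, but it is
    measurable all the same.\<close>
  define g where "g t = lim (\<lambda>n. L2_inner \<Omega> (s n t) e)" for t
  have g: "g \<in> borel_measurable ?M"
    unfolding g_def
    by (intro borel_measurable_lim_metric borel_measurable_simple_function simple_function_compose1[OF s(1)])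
  have lim: "g t = L2_inner \<Omega> (f t) e"
    if "f t \<in> L2 \<Omega>" "(\<lambda>n. L2_dist \<Omega> (s n t) (f t)) \<longlonglongrightarrow> 0" "t > 0" for t
  proof -
    have sn: "s n t \<in> L2 \<Omega>" for n using s(2)[of n] \<open>t > 0\<close> by auto
    have "(\<lambda>n. L2_inner \<Omega> (s n t) e - L2_inner \<Omega> (f t) e) \<longlonglongrightarrow> 0"
    proof (rule Lim_null_comparison[OF always_eventually that(2)], intro allI)
      fix n
      have "(\<lambda>x. s n t x - f t x) \<in> L2 \<Omega>"
        using L2_lincomb[OF sn[of n] that(1), of 1 "-1"] by simp
      from abs_L2_inner_unit_le[OF this e]
      show "norm (L2_inner \<Omega> (s n t) e - L2_inner \<Omega> (f t) e) \<le> L2_dist \<Omega> (s n t) (f t)"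
        by (simp add: L2_inner_diff[OF sn that(1) e(1)] L2_dist_def)
    qed
    then show ?thesis unfolding g_def by (intro limI) (rule LIM_zero_cancel)
  qed
  \<comment> \<open>Clamping changes nothing at times where the bound on \<open>f t\<close> holds
    and enforces it elsewhere; the value 0 makes \<open>h\<close> a function on the whole
    line.\<close>
  define h where "h t = (if t \<in> {0<..} then max (- C) (min C (g t)) else 0)" for t
  show thesis
  proof (rule that[of h])
    show bound: "\<bar>h t\<bar> \<le> C" for t using C(2) by (auto simp: h_def)
    have "(\<lambda>t. max (- C) (min C (g t))) \<in> borel_measurable ?M"
      using g by measurable
    then have "h \<in> borel_measurable lebesgue"
      unfolding h_def by (subst borel_measurable_if) auto
    then have "h \<in> borel_measurable (lebesgue_on {a..b})" for a b
      by (rule measurable_restrict_space1)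
    then show "h integrable_on {a..b}" for a b
      by (rule measurable_bounded_by_integrable_imp_integrable[where g = "\<lambda>_. C"]) (use bound in auto)
    have pos: "AE t in ?M. t > 0" by (intro AE_I2) simp
    show "AE t in ?M. L2_inner \<Omega> (f t) e = h t"
      using fL2 s(3) C(1) pos
    proof eventually_elim
      fix t assume t: "f t \<in> L2 \<Omega>" "(\<lambda>n. L2_dist \<Omega> (s n t) (f t)) \<longlonglongrightarrow> 0" "L2_norm \<Omega> (f t) \<le> C" "(t::real) > 0"
      have "\<bar>L2_inner \<Omega> (f t) e\<bar> \<le> C" using abs_L2_inner_unit_le[OF t(1) e] t(3) by linarith
      then show "L2_inner \<Omega> (f t) e = h t" using lim[OF t(1,2,4)] t(4) by (auto simp: h_def)
    qed
  qed
qed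

context mesh_basis
begin

section \<open>Both notions of solution as integral equations in coordinates\<close>

lemma coord_continuous:
  fixes u :: "real \<Rightarrow> 'a \<Rightarrow> real"
  assumes "\<And>t. t \<ge> 0 \<Longrightarrow> u t \<in> V"
  shows "continuous_map (top_of_set {0..}) metric.mtopology u \<longleftrightarrow>
    (\<forall>i<N. continuous_on {0..} (\<lambda>t. coord (u t) i))"
proof
  assume cm: "continuous_map (top_of_set {0..}) metric.mtopology u"
  show "\<forall>i<N. continuous_on {0..} (\<lambda>t. coord (u t) i)"
  proof (intro allI impI)
    fix i assume i: "i < N"
    show "continuous_on {0..} (\<lambda>t. coord (u t) i)"
      unfolding continuous_on_iff
    proof (intro ballI allI impI)
      fix t \<epsilon> :: real assume t: "t \<in> {0..}" and "\<epsilon> > 0"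
      from t have "t \<in> topspace (top_of_set {0..})" by simp
      from cm[unfolded metric.continuous_map_to_metric, THEN bspec, OF this, THEN spec, THEN mp, OF \<open>\<epsilon> > 0\<close>]
      obtain U where U: "openin (top_of_set {0..}) U" "t \<in> U" "\<And>s. s \<in> U \<Longrightarrow> u s \<in> metric.mball (u t) \<epsilon>"
        by blast
      obtain d where d: "d > 0" "\<And>s. s \<in> {0..} \<Longrightarrow> dist s t < d \<Longrightarrow> s \<in> U"
        using U(1,2) unfolding openin_euclidean_subtopology_iff by blast
      have "dist (coord (u s) i) (coord (u t) i) < \<epsilon>" if "s \<in> U" for s
        using U(3)[OF that] coord_le_dist[of "u t" "u s" i] i
        by (auto simp: metric.in_mball dist_real_def abs_minus_commute)
      then show "\<exists>d>0. \<forall>s\<in>{0..}. dist s t < d \<longrightarrow> dist (coord (u s) i) (coord (u t) i) < \<epsilon>"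
        using d by blast
    qed
  qed
next
  assume c: "\<forall>i<N. continuous_on {0..} (\<lambda>t. coord (u t) i)"
  show "continuous_map (top_of_set {0..}) metric.mtopology u"
    unfolding metric.continuous_map_to_metric
  proof (intro ballI allI impI)
    fix t \<epsilon> :: real assume "t \<in> topspace (top_of_set {0..})" "\<epsilon> > 0"
    then have t: "t \<ge> 0" by simp
    let ?U = "{s \<in> {0..}. (\<Sum>i<N. \<bar>coord (u t) i - coord (u s) i\<bar>) < \<epsilon>}"
    have "continuous_on {0..} (\<lambda>s. \<Sum>i<N. \<bar>coord (u t) i - coord (u s) i\<bar>)"
      using c by (intro continuous_intros) auto
    then have "openin (top_of_set {0..}) ({0..} \<inter> (\<lambda>s. \<Sum>i<N. \<bar>coord (u t) i - coord (u s) i\<bar>) -` {..<\<epsilon>})"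
      by (rule continuous_openin_preimage_gen) simp
    moreover have "{0..} \<inter> (\<lambda>s. \<Sum>i<N. \<bar>coord (u t) i - coord (u s) i\<bar>) -` {..<\<epsilon>} = ?U" by auto
    ultimately have "openin (top_of_set {0..}) ?U" by simp
    moreover have "t \<in> ?U" using t \<open>\<epsilon> > 0\<close> by simp
    moreover have "u s \<in> metric.mball (u t) \<epsilon>" if "s \<in> ?U" for s
      using that t dist_le_coord[of "u t" "u s"] assms by (auto simp: metric.in_mball)
    ultimately show "\<exists>U. openin (top_of_set {0..}) U \<and> t \<in> U \<and> (\<forall>s\<in>U. u s \<in> metric.mball (u t) \<epsilon>)" by blast
  qed
qed

lemma kop_path_continuous:
  assumes "\<And>i. i < N \<Longrightarrow> continuous_on {0..} (\<lambda>t. coord (u t) i)" "i < N"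
  shows "continuous_on {0..} (\<lambda>t. kirchhoff.kop (coord (u t)) i)"
  using kirchhoff.kop_continuous[of "{0..}" "\<lambda>i t. coord (u t) i" i] assms by simp

lemma kop_integral_derivative:
  assumes "\<And>i. i < N \<Longrightarrow> continuous_on {0..} (\<lambda>t. coord (u t) i)" "i < N" "t > 0"
  shows "((\<lambda>s. integral {0..s} (\<lambda>t. kirchhoff.kop (coord (u t)) i)) has_real_derivative
    kirchhoff.kop (coord (u t)) i) (at t)"
proof -
  have "at t within {0..} = at t" by (rule at_within_interior) (use assms(3) in auto)
  then show ?thesis
    using integral_has_derivative_atLeast[OF kop_path_continuous[OF assms(1,2)], of t] assms(3) by simp
qed

text \<open>From the differential equation one integrates with the interior form of the fundamental
  theorem, since at time 0 only continuity is available. Conversely the integrand is continuous, so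
  the integral equation can be differentiated at every positive time.\<close>

lemma classical_solution_iff:
  assumes F: "F \<in> L2 \<Omega>"
  shows "classical_solution \<Omega> \<T> F u0 u \<longleftrightarrow> (\<forall>t\<ge>0. u t \<in> V) \<and> u 0 = u0 \<and>
    kirchhoff.solves (\<lambda>i _. L2_inner \<Omega> F (e i)) (\<lambda>i t. coord (u t) i)"
proof (cases "\<forall>t\<ge>0. u t \<in> V")
  case True
  then have u: "u t \<in> V" if "t \<ge> 0" for t using that by blast
  let ?F = "\<lambda>i. L2_inner \<Omega> F (e i)"
  let ?k = "\<lambda>i t. kirchhoff.kop (coord (u t)) i"
  have eq_iff: "semidiscrete_eq_at \<Omega> \<T> F u t \<longleftrightarrow>
      (\<forall>i<N. ((\<lambda>s. coord (u s) i) has_real_derivative (?F i - ?k i t)) (at t))" if "t > 0" for t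
    by (rule semidiscrete_eq_at_iff) (use u F that in auto)
  have cm_iff: "continuous_map (top_of_set {0..}) metric.mtopology u \<longleftrightarrow>
      (\<forall>i<N. continuous_on {0..} (\<lambda>t. coord (u t) i))"
    by (rule coord_continuous) (use u in auto)
  have "(\<forall>i<N. continuous_on {0..} (\<lambda>t. coord (u t) i)) \<and> (\<forall>t>0. semidiscrete_eq_at \<Omega> \<T> F u t) \<longleftrightarrow>
      kirchhoff.solves (\<lambda>i _. ?F i) (\<lambda>i t. coord (u t) i)"
  proof
    assume H: "(\<forall>i<N. continuous_on {0..} (\<lambda>t. coord (u t) i)) \<and> (\<forall>t>0. semidiscrete_eq_at \<Omega> \<T> F u t)"
    then have c: "continuous_on {0..} (\<lambda>t. coord (u t) i)" if "i < N" for i using that by blast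
    show "kirchhoff.solves (\<lambda>i _. ?F i) (\<lambda>i t. coord (u t) i)"
      unfolding kirchhoff.solves_def
    proof (intro allI impI conjI c)
      fix i and t :: real assume i: "i < N" and t: "t \<ge> 0"
      have kint: "?k i integrable_on {0..t}"
        using kop_path_continuous[OF c i] by (intro integrable_continuous_real) (auto intro: continuous_on_subset)
      have "((\<lambda>s. ?F i - ?k i s) has_integral (coord (u t) i - coord (u 0) i)) {0..t}"
      proof (rule fundamental_theorem_of_calculus_interior[OF t])
        show "continuous_on {0..t} (\<lambda>t. coord (u t) i)" using c[OF i] by (rule continuous_on_subset) auto
        show "((\<lambda>t. coord (u t) i) has_vector_derivative (?F i - ?k i s)) (at s)" if "s \<in> {0<..<t}" for s
        proof -
          have "s > 0" using that by simp
          then have "semidiscrete_eq_at \<Omega> \<T> F u s" using H by blast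
          then show ?thesis
            using eq_iff[OF \<open>s > 0\<close>] i
            by (simp flip: has_real_derivative_iff_has_vector_derivative)
        qed
      qed
      then have "integral {0..t} (\<lambda>s. ?F i - ?k i s) = coord (u t) i - coord (u 0) i" by (rule integral_unique)
      moreover have "integral {0..t} (\<lambda>s. ?F i - ?k i s) = integral {0..t} (\<lambda>_. ?F i) - integral {0..t} (?k i)"
        by (intro integral_diff kint) auto
      ultimately show "coord (u t) i = coord (u 0) i + integral {0..t} (\<lambda>_. ?F i) - integral {0..t} (?k i)"
        by linarith
    qed
  next
    assume H: "kirchhoff.solves (\<lambda>i _. ?F i) (\<lambda>i t. coord (u t) i)"
    then have c: "continuous_on {0..} (\<lambda>t. coord (u t) i)" if "i < N" for i
      using that unfolding kirchhoff.solves_def by blast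
    have cu: "coord (u t) i = coord (u 0) i + integral {0..t} (\<lambda>_. ?F i) - integral {0..t} (?k i)"
      if "i < N" "t \<ge> 0" for i t
      using H that unfolding kirchhoff.solves_def by blast
    have "semidiscrete_eq_at \<Omega> \<T> F u t" if t: "t > 0" for t
      unfolding eq_iff[OF t]
    proof (intro allI impI)
      fix i assume i: "i < N"
      have "((\<lambda>s. coord (u 0) i + s * ?F i - integral {0..s} (?k i)) has_real_derivative (?F i - ?k i t)) (at t)"
      proof (rule DERIV_diff)
        show "((\<lambda>s. coord (u 0) i + s * ?F i) has_real_derivative ?F i) (at t)"
          by (auto intro!: derivative_eq_intros)
      qed (rule kop_integral_derivative[OF c i t])
      then show "((\<lambda>s. coord (u s) i) has_real_derivative (?F i - ?k i t)) (at t)"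
      proof (rule DERIV_cong_ev[THEN iffD1, OF refl _ refl, rotated])
        show "\<forall>\<^sub>F s in nhds t. coord (u 0) i + s * ?F i - integral {0..s} (?k i) = coord (u s) i"
          unfolding eventually_nhds
        proof (intro exI[of _ "{0<..}"] conjI ballI)
          fix s :: real assume "s \<in> {0<..}"
          then show "coord (u 0) i + s * ?F i - integral {0..s} (?k i) = coord (u s) i"
            using cu[OF i, of s] by (auto simp: mult.commute)
        qed (use t in auto)
      qed
    qed
    then show "(\<forall>i<N. continuous_on {0..} (\<lambda>t. coord (u t) i)) \<and> (\<forall>t>0. semidiscrete_eq_at \<Omega> \<T> F u t)"
      using c by blast
  qed
  then show ?thesis
    unfolding classical_solution_def using cm_iff True by blast
qed (auto simp: classical_solution_def)

text \<open>For a solution, the difference between the coordinate and its integral expression is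
  absolutely continuous with derivative zero almost everywhere. Conversely absolute continuity is
  inherited from the two integrals, whose derivatives exist outside one common null set.\<close>

lemma caratheodory_solution_iff:
  fixes C :: real
  assumes fL2: "AE t in lebesgue_on {0<..}. f t \<in> L2 \<Omega>"
    and h: "\<And>i a b. i < N \<Longrightarrow> h i integrable_on {a..b}" "\<And>i t. i < N \<Longrightarrow> \<bar>h i t\<bar> \<le> C"
    and fh: "\<And>i. i < N \<Longrightarrow> AE t in lebesgue_on {0<..}. L2_inner \<Omega> (f t) (e i) = h i t"
  shows "caratheodory_solution \<Omega> \<T> f u0 u \<longleftrightarrow> (\<forall>t\<ge>0. u t \<in> V) \<and> u 0 = u0 \<and>
    kirchhoff.solves h (\<lambda>i t. coord (u t) i)"
proof (cases "\<forall>t\<ge>0. u t \<in> V")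
  case True
  then have u: "u t \<in> V" if "t \<ge> 0" for t using that by blast
  let ?k = "\<lambda>i t. kirchhoff.kop (coord (u t)) i"
  let ?I = "\<lambda>i t. integral {0..t} (h i)"
  let ?J = "\<lambda>i t. integral {0..t} (?k i)"
  have "AE t in lebesgue_on {0<..}. f t \<in> L2 \<Omega> \<and> (\<forall>i\<in>{..<N}. L2_inner \<Omega> (f t) (e i) = h i t)"
    using fL2 fh by (intro AE_conjI AE_finite_allI) auto
  then obtain N0 where N0: "negligible N0"
    "\<And>t. t > 0 \<Longrightarrow> t \<notin> N0 \<Longrightarrow> f t \<in> L2 \<Omega> \<and> (\<forall>i<N. L2_inner \<Omega> (f t) (e i) = h i t)"
    by (subst (asm) AE_lebesgue_on_iff_negligible) auto
  have "\<exists>S. negligible S \<and> (\<forall>t>0. t \<notin> S \<longrightarrow> (?I i has_real_derivative h i t) (at t))" if "i < N" for i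
    using indefinite_integral_ae_derivative[OF h(1)[OF that]] by metis
  then obtain S where S: "\<And>i. i < N \<Longrightarrow> negligible (S i)"
    "\<And>i t. i < N \<Longrightarrow> t > 0 \<Longrightarrow> t \<notin> S i \<Longrightarrow> (?I i has_real_derivative h i t) (at t)" by metis
  \<comment> \<open>All exceptional times that do not depend on the equation for \<open>u\<close>:
    bad values of the data and points where an indefinite integral of \<open>h\<close> fails to have
    its expected derivative.\<close>
  define Z where "Z = N0 \<union> (\<Union>i<N. S i)"
  have Z: "negligible Z" unfolding Z_def using N0 S(1) by (intro negligible_Un negligible_Union) auto
  have Iac: "abs_cont_real (?I i)" if i: "i < N" for i
  proof (rule indefinite_integral_abs_cont_real)
    show "h i integrable_on {a..b}" for a b using h(1)[OF i] .
    show "\<bar>h i t\<bar> \<le> C" for t using h(2)[OF i] .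
  qed
  have eq_iff: "semidiscrete_eq_at \<Omega> \<T> (f t) u t \<longleftrightarrow>
      (\<forall>i<N. ((\<lambda>s. coord (u s) i) has_real_derivative (h i t - ?k i t)) (at t))" if "t > 0" "t \<notin> Z" for t
  proof -
    have f: "f t \<in> L2 \<Omega>" "L2_inner \<Omega> (f t) (e i) = h i t" if "i < N" for i
      using N0(2)[of t] \<open>t > 0\<close> \<open>t \<notin> Z\<close> that by (auto simp: Z_def)
    have "f t \<in> L2 \<Omega>" using N0(2)[of t] \<open>t > 0\<close> \<open>t \<notin> Z\<close> by (auto simp: Z_def)
    then have "semidiscrete_eq_at \<Omega> \<T> (f t) u t \<longleftrightarrow>
      (\<forall>i<N. ((\<lambda>s. coord (u s) i) has_real_derivative (L2_inner \<Omega> (f t) (e i) - ?k i t)) (at t))"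
      by (intro semidiscrete_eq_at_iff) (use u that in auto)
    then show ?thesis using f(2) by simp
  qed
  have "locally_absolutely_continuous (L2_dist \<Omega>) u \<and> (AE t in lebesgue_on {0<..}. semidiscrete_eq_at \<Omega> \<T> (f t) u t) \<longleftrightarrow>
      kirchhoff.solves h (\<lambda>i t. coord (u t) i)"
  proof
    assume H: "locally_absolutely_continuous (L2_dist \<Omega>) u \<and> (AE t in lebesgue_on {0<..}. semidiscrete_eq_at \<Omega> \<T> (f t) u t)"
    then obtain Z1 where Z1: "negligible Z1" "\<And>t. t > 0 \<Longrightarrow> t \<notin> Z1 \<Longrightarrow> semidiscrete_eq_at \<Omega> \<T> (f t) u t"
      by (subst (asm) AE_lebesgue_on_iff_negligible) auto
    have cac: "abs_cont_real (\<lambda>t. coord (u t) i)" if i: "i < N" for i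
    proof (rule locally_absolutely_continuous_dominated[where I = "{()}" and d = "\<lambda>_. L2_dist \<Omega>" and f = "\<lambda>_. u"])
      show "\<exists>M\<ge>0. \<forall>s t. 0 \<le> s \<longrightarrow> s \<le> t \<longrightarrow> t \<le> b \<longrightarrow>
          \<bar>coord (u s) i - coord (u t) i\<bar> \<le> M * (\<Sum>i\<in>{()}. L2_dist \<Omega> (u s) (u t))" for b :: real
        using coord_le_dist[OF u u i] by (intro exI[of _ 1]) simp
    qed (use H in auto)
    then have c: "continuous_on {0..} (\<lambda>t. coord (u t) i)" if "i < N" for i
      using that abs_cont_real_continuous by blast
    have Jac: "abs_cont_real (?J i)" if "i < N" for i
      by (rule continuous_derivative_abs_cont_real[OF kop_path_continuous[OF c that]])
         (use integral_has_derivative_atLeast[OF kop_path_continuous[OF c that]] in auto)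
    show "kirchhoff.solves h (\<lambda>i t. coord (u t) i)"
      unfolding kirchhoff.solves_def
    proof (intro allI impI conjI c)
      fix i and t :: real assume i: "i < N" and "t \<ge> 0"
      \<comment> \<open>Used for \<sigma> = 1 and \<sigma> = -1: a function that is nonincreasing
        together with its negative is constant.\<close>
      have r: "\<sigma> * (coord (u t) i - ?I i t + ?J i t) \<le> \<sigma> * (coord (u 0) i - ?I i 0 + ?J i 0)" if "t > 0" for \<sigma> :: real
      proof (rule abs_cont_nonincreasing[of "\<lambda>t. \<sigma> * (coord (u t) i - ?I i t + ?J i t)" "Z \<union> Z1" t])
        have "abs_cont_real (\<lambda>t. \<sigma> * (coord (u t) i + (-1) * ?I i t + ?J i t))"
          by (intro abs_cont_real_mult abs_cont_real_add abs_cont_real_const cac Iac Jac i continuous_intros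
              c abs_cont_real_continuous)
        then show "abs_cont_real (\<lambda>t. \<sigma> * (coord (u t) i - ?I i t + ?J i t))" by simp
        show "negligible (Z \<union> Z1)" using Z Z1 by simp
        fix s assume s: "0 < s" "s \<notin> Z \<union> Z1"
        have "((\<lambda>s. coord (u s) i) has_real_derivative (h i s - ?k i s)) (at s)"
          using eq_iff[of s] Z1(2)[of s] s i by blast
        moreover have "(?I i has_real_derivative h i s) (at s)" using S(2)[OF i] s i by (auto simp: Z_def)
        moreover have "(?J i has_real_derivative ?k i s) (at s)"
          using kop_integral_derivative[OF c i s(1)] by simp
        ultimately have "((\<lambda>t. \<sigma> * (coord (u t) i - ?I i t + ?J i t)) has_real_derivative
            \<sigma> * ((h i s - ?k i s) - h i s + ?k i s)) (at s)"
          by (intro DERIV_cmult DERIV_add DERIV_diff)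
        then show "\<exists>D\<le>0. ((\<lambda>t. \<sigma> * (coord (u t) i - ?I i t + ?J i t)) has_real_derivative D) (at s)"
          by (intro exI[of _ 0]) simp
      qed (use that in auto)
      show "coord (u t) i = coord (u 0) i + ?I i t - ?J i t"
        using r[of 1] r[of "-1"] \<open>t \<ge> 0\<close> by (cases "t = 0") auto
    qed
  next
    assume H: "kirchhoff.solves h (\<lambda>i t. coord (u t) i)"
    then have c: "continuous_on {0..} (\<lambda>t. coord (u t) i)" if "i < N" for i
      using that unfolding kirchhoff.solves_def by blast
    have cu: "coord (u t) i = coord (u 0) i + ?I i t - ?J i t" if "i < N" "t \<ge> 0" for i t
      using H that unfolding kirchhoff.solves_def by blast
    have Jac: "abs_cont_real (?J i)" if "i < N" for i
      by (rule continuous_derivative_abs_cont_real[OF kop_path_continuous[OF c that]])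
         (use integral_has_derivative_atLeast[OF kop_path_continuous[OF c that]] in auto)
    have gac: "abs_cont_real (\<lambda>t. coord (u 0) i + ?I i t + (-1) * ?J i t)" if "i < N" for i
      by (intro abs_cont_real_mult abs_cont_real_add abs_cont_real_const Iac Jac that continuous_intros
          abs_cont_real_continuous)
    have "locally_absolutely_continuous (L2_dist \<Omega>) u"
    proof (rule locally_absolutely_continuous_dominated[where I = "{..<N}" and d = "\<lambda>_ x y. \<bar>x - y\<bar>"
          and f = "\<lambda>i t. coord (u 0) i + ?I i t + (-1) * ?J i t"])
      fix b :: real
      show "\<exists>M\<ge>0. \<forall>s t. 0 \<le> s \<longrightarrow> s \<le> t \<longrightarrow> t \<le> b \<longrightarrow> L2_dist \<Omega> (u s) (u t) \<le>
          M * (\<Sum>i<N. \<bar>coord (u 0) i + ?I i s + (-1) * ?J i s - (coord (u 0) i + ?I i t + (-1) * ?J i t)\<bar>)"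
      proof (intro exI[of _ 1] conjI allI impI)
        fix s t :: real assume st: "0 \<le> s" "s \<le> t"
        have "L2_dist \<Omega> (u s) (u t) \<le> (\<Sum>i<N. \<bar>coord (u s) i - coord (u t) i\<bar>)"
          using st by (intro dist_le_coord u) auto
        also have "\<dots> = (\<Sum>i<N. \<bar>coord (u 0) i + ?I i s + (-1) * ?J i s - (coord (u 0) i + ?I i t + (-1) * ?J i t)\<bar>)"
        proof (intro sum.cong refl arg_cong[where f = abs])
          fix i assume "i \<in> {..<N}"
          then show "coord (u s) i - coord (u t) i =
              coord (u 0) i + ?I i s + (-1) * ?J i s - (coord (u 0) i + ?I i t + (-1) * ?J i t)"
            using cu[of i s] cu[of i t] st by simp
        qed
        finally show "L2_dist \<Omega> (u s) (u t) \<le>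
          1 * (\<Sum>i<N. \<bar>coord (u 0) i + ?I i s + (-1) * ?J i s - (coord (u 0) i + ?I i t + (-1) * ?J i t)\<bar>)" by simp
      qed simp
    qed (use gac in auto)
    moreover have "semidiscrete_eq_at \<Omega> \<T> (f t) u t" if t: "t > 0" "t \<notin> Z" for t
      unfolding eq_iff[OF t]
    proof (intro allI impI)
      fix i assume i: "i < N"
      have "(?I i has_real_derivative h i t) (at t)" using S(2)[OF i] t i by (auto simp: Z_def)
      have "((\<lambda>s. coord (u 0) i + ?I i s - ?J i s) has_real_derivative (h i t - ?k i t)) (at t)"
      proof (rule DERIV_diff)
        show "((\<lambda>s. coord (u 0) i + ?I i s) has_real_derivative h i t) (at t)"
          using \<open>(?I i has_real_derivative h i t) (at t)\<close> DERIV_add[OF DERIV_const, of _ "h i t" t] by simp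
      qed (rule kop_integral_derivative[OF c i t(1)])
      then show "((\<lambda>s. coord (u s) i) has_real_derivative (h i t - ?k i t)) (at t)"
      proof (rule DERIV_cong_ev[THEN iffD1, OF refl _ refl, rotated])
        show "\<forall>\<^sub>F s in nhds t. coord (u 0) i + ?I i s - ?J i s = coord (u s) i"
          unfolding eventually_nhds
        proof (intro exI[of _ "{0<..}"] conjI ballI)
          fix s :: real assume "s \<in> {0<..}"
          then show "coord (u 0) i + ?I i s - ?J i s = coord (u s) i" using cu[OF i, of s] by auto
        qed (use t in auto)
      qed
    qed
    ultimately show "locally_absolutely_continuous (L2_dist \<Omega>) u \<and> (AE t in lebesgue_on {0<..}. semidiscrete_eq_at \<Omega> \<T> (f t) u t)"
      using Z by (subst AE_lebesgue_on_iff_negligible) auto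
  qed
  then show ?thesis unfolding caratheodory_solution_def using True by blast
qed (auto simp: caratheodory_solution_def)

end

section \<open>Attractors\<close>

context mesh_basis
begin

definition coord_box :: "real \<Rightarrow> ('a \<Rightarrow> real) set" where
  "coord_box R = {v \<in> V. \<forall>i<N. \<bar>coord v i\<bar> \<le> R}"

lemma continuous_map_synth: "continuous_map euclidean metric.mtopology synth"
  unfolding metric.continuous_map_to_metric
proof (intro ballI allI impI)
  fix x :: "nat \<Rightarrow> real" and \<epsilon> :: real assume "\<epsilon> > 0"
  let ?U = "{y. (\<Sum>i<N. \<bar>x i - y i\<bar>) < \<epsilon>}"
  have "continuous_on UNIV (\<lambda>y. \<Sum>i<N. \<bar>x i - y i\<bar>)"
    by (intro continuous_on_sum continuous_on_rabs continuous_on_diff continuous_on_const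
        continuous_on_product_coordinates)
  then have "open ?U" by (intro open_Collect_less continuous_on_const)
  moreover have "x \<in> ?U" using \<open>\<epsilon> > 0\<close> by simp
  moreover have "synth y \<in> metric.mball (synth x) \<epsilon>" if "y \<in> ?U" for y
  proof -
    have "L2_dist \<Omega> (synth x) (synth y) \<le> (\<Sum>i<N. \<bar>coord (synth x) i - coord (synth y) i\<bar>)"
      by (intro dist_le_coord synth_mem)
    also have "\<dots> = (\<Sum>i<N. \<bar>x i - y i\<bar>)"
      by (intro sum.cong) (auto simp: coord_synth)
    finally show ?thesis using that by (simp add: metric.in_mball synth_mem)
  qed
  ultimately show "\<exists>U. openin euclidean U \<and> x \<in> U \<and> (\<forall>y\<in>U. synth y \<in> metric.mball (synth x) \<epsilon>)"
    by (intro exI[of _ ?U]) simp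
qed

text \<open>By Tychonoff's theorem the box is the continuous image of a compact product.\<close>

lemma compact_coord_box: "compactin metric.mtopology (coord_box R)"
proof -
  \<comment> \<open>\<open>synth\<close> ignores coordinates beyond \<open>N\<close>; the factor
    \<open>{0}\<close> keeps the product over all of \<open>nat\<close> compact.\<close>
  define X where "X i = (if i < N then {-R..R} else {0::real})" for i :: nat
  have "compactin (product_topology (\<lambda>_. euclidean) UNIV) (PiE UNIV X)"
    by (simp add: compactin_PiE X_def)
  then have "compactin euclidean (PiE UNIV X)" by (simp only: euclidean_product_topology)
  then have "compactin metric.mtopology (synth ` PiE UNIV X)"
    by (rule image_compactin[OF _ continuous_map_synth])
  moreover have "synth ` PiE UNIV X = coord_box R"
  proof (intro equalityI subsetI)
    fix v assume "v \<in> synth ` PiE UNIV X"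
    then obtain c where c: "v = synth c" "\<And>i. c i \<in> X i" by auto
    have "\<bar>coord v i\<bar> \<le> R" if "i < N" for i
      using c(2)[of i] that by (auto simp: X_def c(1) coord_synth abs_le_iff)
    then show "v \<in> coord_box R" by (simp add: coord_box_def c(1) synth_mem)
  next
    fix v assume v: "v \<in> coord_box R"
    let ?c = "\<lambda>i. if i < N then coord v i else 0"
    have "v = synth ?c"
      using v synth_coord[of v] synth_cong[of "coord v" ?c] by (simp add: coord_box_def)
    moreover have "?c \<in> PiE UNIV X" using v by (auto simp: X_def coord_box_def abs_le_iff)
    ultimately show "v \<in> synth ` PiE UNIV X" by blast
  qed
  ultimately show ?thesis by simp
qed

text \<open>The centre \<open>v\<close> is free because the absorbing estimate measures from 0 and
  the contraction from the steady state.\<close>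

lemma mbounded_coord:
  assumes "metric.mbounded B" "v \<in> V"
  obtains b where "b \<ge> 0" "\<And>w. w \<in> B \<Longrightarrow> w \<in> V \<and> (\<Sum>i<N. (coord w i - coord v i)\<^sup>2) \<le> b"
proof -
  from assms(1) obtain y r where r: "B \<subseteq> metric.mcball y r" by (auto simp: metric.mbounded_def)
  have "w \<in> V \<and> (\<Sum>i<N. (coord w i - coord v i)\<^sup>2) \<le> (r + L2_dist \<Omega> y v)\<^sup>2" if "w \<in> B" for w
  proof -
    have w: "w \<in> V" "y \<in> V" "L2_dist \<Omega> y w \<le> r" using r that by (auto simp: metric.in_mcball)
    have "L2_dist \<Omega> w v \<le> L2_dist \<Omega> w y + L2_dist \<Omega> y v" using w assms(2) by (intro metric.triangle)
    then have "L2_dist \<Omega> w v \<le> r + L2_dist \<Omega> y v" using w by (simp add: metric.commute)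
    then have "(L2_dist \<Omega> w v)\<^sup>2 \<le> (r + L2_dist \<Omega> y v)\<^sup>2" by (intro power_mono) auto
    then show ?thesis using w assms(2) by (simp add: L2_dist_coord L2_set_def sum_nonneg)
  qed
  then show thesis using that[of "(r + L2_dist \<Omega> y v)\<^sup>2"] by simp
qed

end

text \<open>The notion of solution is kept abstract and enters only through its integral equation,
  so that both cases of the theorem are instances.\<close>

locale kirchhoff_flow = mesh_basis +
  fixes sol :: "('a \<Rightarrow> real) \<Rightarrow> (real \<Rightarrow> 'a \<Rightarrow> real) \<Rightarrow> bool" and h :: "nat \<Rightarrow> real \<Rightarrow> real" and C :: real
  assumes sol_iff: "sol u0 u \<longleftrightarrow> (\<forall>t\<ge>0. u t \<in> V) \<and> u 0 = u0 \<and> kirchhoff.solves h (\<lambda>i t. coord (u t) i)"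
    and h_integrable: "i < N \<Longrightarrow> h i integrable_on {a..b}"
    and h_bound: "i < N \<Longrightarrow> \<bar>h i t\<bar> \<le> C"
begin

abbreviation "S \<equiv> solution_operator sol"

lemma sol_exists:
  assumes "u0 \<in> V"
  obtains u where "sol u0 u"
proof -
  obtain c where c: "kirchhoff.solves h c" "\<And>i. i < N \<Longrightarrow> c i 0 = coord u0 i"
    using kirchhoff.solves_exists[where h = h and C = C and ?x0.0 = "coord u0"] h_integrable h_bound by metis
  let ?u = "\<lambda>t. synth (\<lambda>i. c i t)"
  have "?u 0 = u0" using synth_cong[of "\<lambda>i. c i 0" "coord u0"] c(2) synth_coord[OF assms] by simp
  moreover have "kirchhoff.solves h (\<lambda>i t. coord (?u t) i)"
  proof -
    have co: "coord (?u t) i = c i t" if "i < N" for i t using that by (simp add: coord_synth)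
    have kop: "(\<lambda>t. kirchhoff.kop (coord (?u t)) i) = (\<lambda>t. kirchhoff.kop (\<lambda>j. c j t) i)" for i
      by (intro ext kirchhoff.kop_cong) (rule co)
    have cc: "continuous_on {0..} (c i)" if "i < N" for i
      using c(1) that unfolding kirchhoff.solves_def by blast
    have ct: "c i t = c i 0 + integral {0..t} (h i) - integral {0..t} (\<lambda>t. kirchhoff.kop (\<lambda>j. c j t) i)"
      if "i < N" "t \<ge> 0" for i t
      using c(1) that unfolding kirchhoff.solves_def by blast
    show ?thesis
      unfolding kirchhoff.solves_def kop
    proof (intro allI impI conjI)
      fix i t assume i: "i < N"
      show "continuous_on {0..} (\<lambda>t. coord (?u t) i)" unfolding co[OF i] by (rule cc[OF i])
      assume "(t::real) \<ge> 0"
      then show "coord (?u t) i = coord (?u 0) i + integral {0..t} (h i) -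
          integral {0..t} (\<lambda>t. kirchhoff.kop (\<lambda>j. c j t) i)"
        unfolding co[OF i] by (rule ct[OF i])
    qed
  qed
  ultimately show thesis using that[of ?u] by (simp add: sol_iff synth_mem)
qed

lemma sol_unique:
  assumes "sol u0 u" "sol u0 v" "t \<ge> 0"
  shows "v t = u t"
proof (rule coord_eqI)
  show "coord (v t) i = coord (u t) i" if "i < N" for i
    using kirchhoff.solves_unique[where h = h and c = "\<lambda>i t. coord (v t) i" and e = "\<lambda>i t. coord (u t) i" and t = t and i = i]
      assms that h_integrable by (simp add: sol_iff)
qed (use assms in \<open>auto simp: sol_iff\<close>)

lemma uniquely_solvable: "uniquely_solvable V sol"
  unfolding uniquely_solvable_def using sol_exists sol_unique by metis

lemma solution_operator_eq:
  assumes "sol u0 u" "t \<ge> 0"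
  shows "S t u0 = u t"
  unfolding solution_operator_def using assms sol_unique by (intro the_equality) blast+

lemma solution_operator_contraction:
  assumes "u0 \<in> V" "v0 \<in> V" "t \<ge> 0"
  shows "L2_dist \<Omega> (S t u0) (S t v0) \<le> sqrt (exp (- \<mu> * t) * (\<Sum>i<N. (coord u0 i - coord v0 i)\<^sup>2))"
proof -
  obtain u v where u: "sol u0 u" and v: "sol v0 v" using sol_exists assms by metis
  have "(\<Sum>i<N. (coord (u t) i - coord (v t) i)\<^sup>2) \<le> exp (- \<mu> * t) * (\<Sum>i<N. (coord (u 0) i - coord (v 0) i)\<^sup>2)"
    using kirchhoff.solves_contraction[where h = h and c = "\<lambda>i t. coord (u t) i" and e = "\<lambda>i t. coord (v t) i" and t = t]
      u v assms(3) h_integrable by (simp add: sol_iff)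
  moreover have "u t \<in> V" "v t \<in> V" "u 0 = u0" "v 0 = v0" using u v assms(3) by (auto simp: sol_iff)
  ultimately show ?thesis
    using u v assms(3) by (simp add: solution_operator_eq L2_dist_coord L2_set_def)
qed

text \<open>The radius is the asymptotic bound of the energy estimate with an allowance of 1 for the
  transient part.\<close>

lemma solution_operator_absorbing:
  assumes "u0 \<in> V" "t \<ge> 0" "exp (- \<mu> * t) * (\<Sum>i<N. (coord u0 i)\<^sup>2) \<le> 1"
  shows "S t u0 \<in> coord_box (sqrt (1 + real N * C\<^sup>2 / \<mu>\<^sup>2))"
proof -
  obtain u where u: "sol u0 u" using sol_exists assms by metis
  have "(\<Sum>i<N. (coord (u t) i)\<^sup>2) \<le> exp (- \<mu> * t) * (\<Sum>i<N. (coord (u 0) i)\<^sup>2) + real N * C\<^sup>2 / \<mu>\<^sup>2"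
    using kirchhoff.solves_bound[where h = h and c = "\<lambda>i t. coord (u t) i" and t = t and C = C]
      u assms(2) h_integrable h_bound by (simp add: sol_iff)
  then have le: "(\<Sum>i<N. (coord (u t) i)\<^sup>2) \<le> 1 + real N * C\<^sup>2 / \<mu>\<^sup>2" using assms(3) u by (simp add: sol_iff)
  have "\<bar>coord (u t) i\<bar> \<le> sqrt (1 + real N * C\<^sup>2 / \<mu>\<^sup>2)" if "i < N" for i
  proof -
    have "(coord (u t) i)\<^sup>2 \<le> (\<Sum>i<N. (coord (u t) i)\<^sup>2)" using that by (intro member_le_sum) auto
    then show ?thesis using le by (intro real_le_rsqrt) simp
  qed
  then show ?thesis using u assms(2) by (simp add: solution_operator_eq coord_box_def sol_iff)
qed

lemma exp_decay: "((\<lambda>t. exp (- \<mu> * t) * b) \<longlongrightarrow> 0) at_top"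
proof -
  have "((\<lambda>t. exp (- (\<mu> * t))) \<longlongrightarrow> 0) at_top"
    using mu(1) by (intro filterlim_compose[OF exp_at_bot] filterlim_compose[OF filterlim_uminus_at_bot_at_top]
        filterlim_tendsto_pos_mult_at_top[OF tendsto_const] filterlim_ident)
  then show ?thesis using tendsto_mult_left_zero by fastforce
qed

text \<open>The time of entry depends only on the bound \<open>b\<close> of the set, and from then
  on the supremum of the distances is exactly 0.\<close>

lemma global_attractor_box: "global_attractor V (L2_dist \<Omega>) S (coord_box (sqrt (1 + real N * C\<^sup>2 / \<mu>\<^sup>2)))"
  (is "global_attractor _ _ _ ?A")
  unfolding global_attractor_def
proof (intro conjI allI impI compact_coord_box)
  fix B assume "metric.mbounded B"
  then obtain b where b: "b \<ge> 0"
    "\<And>w. w \<in> B \<Longrightarrow> w \<in> V \<and> (\<Sum>i<N. (coord w i - coord (\<lambda>_. 0) i)\<^sup>2) \<le> b"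
    using mbounded_coord[OF _ Vh_zero] by metis
  have coord0: "coord (\<lambda>_. 0) i = 0" if "i < N" for i
    unfolding coord_def by (rule mass.form_zero[OF basis_mem[OF that]])
  have "\<forall>\<^sub>F t in at_top. exp (- \<mu> * t) * b < 1"
    using exp_decay[of b] by (rule order_tendstoD(2)) simp
  then have "\<forall>\<^sub>F t in at_top. (SUP u0\<in>B. INF a\<in>?A. ennreal (L2_dist \<Omega> (S t u0) a)) = 0"
    using eventually_ge_at_top[of 0]
  proof eventually_elim
    fix t assume t: "exp (- \<mu> * t) * b < 1" "0 \<le> t"
    have "(INF a\<in>?A. ennreal (L2_dist \<Omega> (S t u0) a)) \<le> 0" if u0: "u0 \<in> B" for u0
    proof -
      have "(\<Sum>i<N. (coord u0 i)\<^sup>2) \<le> b" using b(2)[OF u0] by (simp add: coord0)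
      then have "exp (- \<mu> * t) * (\<Sum>i<N. (coord u0 i)\<^sup>2) \<le> exp (- \<mu> * t) * b" by (intro mult_left_mono) auto
      then have "exp (- \<mu> * t) * (\<Sum>i<N. (coord u0 i)\<^sup>2) \<le> 1" using t(1) by linarith
      then have in_box: "S t u0 \<in> ?A" using b(2)[OF u0] t(2) by (intro solution_operator_absorbing) auto
      then have "L2_dist \<Omega> (S t u0) (S t u0) = 0" by (simp add: coord_box_def)
      then show ?thesis using INF_lower[OF in_box, of "\<lambda>a. ennreal (L2_dist \<Omega> (S t u0) a)"] by simp
    qed
    then show "(SUP u0\<in>B. INF a\<in>?A. ennreal (L2_dist \<Omega> (S t u0) a)) = 0"
      using SUP_least[of B _ 0] by (metis (no_types, lifting) le_zero_eq)
  qed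
  then show "((\<lambda>t. SUP u0\<in>B. INF a\<in>?A. ennreal (L2_dist \<Omega> (S t u0) a)) \<longlongrightarrow> 0) at_top"
    by (rule tendsto_eventually)
qed

text \<open>Comparing any solution with the constant one at \<open>x\<close> gives a decay that is
  uniform over bounded sets.\<close>

lemma global_attractor_fixed_point:
  assumes x: "x \<in> V" "\<And>t. t \<ge> 0 \<Longrightarrow> S t x = x"
  shows "global_attractor V (L2_dist \<Omega>) S {x}"
  unfolding global_attractor_def
proof (intro conjI allI impI)
  show "compactin metric.mtopology {x}" using x(1) by (intro finite_imp_compactin) auto
  fix B assume "metric.mbounded B"
  then obtain b where b: "b \<ge> 0" "\<And>w. w \<in> B \<Longrightarrow> w \<in> V \<and> (\<Sum>i<N. (coord w i - coord x i)\<^sup>2) \<le> b"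
    using mbounded_coord[OF _ x(1)] by metis
  have "((\<lambda>t. ennreal (sqrt (exp (- \<mu> * t) * b))) \<longlongrightarrow> ennreal (sqrt 0)) at_top"
    by (intro tendsto_ennrealI tendsto_real_sqrt exp_decay)
  then have lim: "((\<lambda>t. ennreal (sqrt (exp (- \<mu> * t) * b))) \<longlongrightarrow> 0) at_top" by simp
  show "((\<lambda>t. SUP u0\<in>B. INF a\<in>{x}. ennreal (L2_dist \<Omega> (S t u0) a)) \<longlongrightarrow> 0) at_top"
  proof (rule tendsto_sandwich[OF _ _ tendsto_const lim])
    show "\<forall>\<^sub>F t in at_top. (SUP u0\<in>B. INF a\<in>{x}. ennreal (L2_dist \<Omega> (S t u0) a)) \<le> ennreal (sqrt (exp (- \<mu> * t) * b))"
      using eventually_ge_at_top[of 0]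
    proof eventually_elim
      fix t :: real assume t: "0 \<le> t"
      show "(SUP u0\<in>B. INF a\<in>{x}. ennreal (L2_dist \<Omega> (S t u0) a)) \<le> ennreal (sqrt (exp (- \<mu> * t) * b))"
      proof (rule SUP_least)
        fix u0 assume u0: "u0 \<in> B"
        have "L2_dist \<Omega> (S t u0) x \<le> sqrt (exp (- \<mu> * t) * (\<Sum>i<N. (coord u0 i - coord x i)\<^sup>2))"
          using solution_operator_contraction[of u0 x t] b(2)[OF u0] x t by simp
        also have "\<dots> \<le> sqrt (exp (- \<mu> * t) * b)"
          using b(2)[OF u0] by (intro real_sqrt_le_mono mult_left_mono) auto
        finally show "(INF a\<in>{x}. ennreal (L2_dist \<Omega> (S t u0) a)) \<le> ennreal (sqrt (exp (- \<mu> * t) * b))"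
          by (simp add: ennreal_leI)
      qed
    qed
  qed simp
qed

end

theorem theorem3p2:
  fixes \<Omega> :: "(real ^ 'n) set" and \<T> :: "(real ^ 'n) set set"
  assumes "CARD('n) = 2 \<or> CARD('n) = 3"
    and "convex_polytopal_domain \<Omega>"
    and "regular_triangulation \<Omega> \<T>"
  shows
    "(\<forall>F\<in>L2 \<Omega>.
        uniquely_solvable (Vh \<Omega> \<T>) (classical_solution \<Omega> \<T> F) \<and>
        (\<exists>A. global_attractor (Vh \<Omega> \<T>) (L2_dist \<Omega>) (solution_operator (classical_solution \<Omega> \<T> F)) A \<and>
             invariant_under (solution_operator (classical_solution \<Omega> \<T> F)) A)) \<and>
     (\<forall>f\<in>Linf_L2 \<Omega>.
        uniquely_solvable (Vh \<Omega> \<T>) (caratheodory_solution \<Omega> \<T> f) \<and>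
        (\<exists>A. global_attractor (Vh \<Omega> \<T>) (L2_dist \<Omega>) (solution_operator (caratheodory_solution \<Omega> \<T> f)) A))"
proof -
  interpret mesh \<Omega> \<T> using assms(2,3) by unfold_locales
  obtain N e where basis: "orthonormal_basis V (L2_inner \<Omega>) N e" using mass_basis by blast
  obtain \<mu> where mu: "\<mu> > 0" "\<And>v. v \<in> V \<Longrightarrow> \<mu> * L2_inner \<Omega> v v \<le> grad_inner \<Omega> v v"
    using poincare by blast
  interpret mesh_basis \<Omega> \<T> N e \<mu> using basis mu by unfold_locales
  show ?thesis
  proof (intro conjI ballI)
    fix F assume F: "F \<in> L2 \<Omega>"
    \<comment> \<open>A sum serves as common bound because, unlike a maximum, it makes sense for
      \<open>N = 0\<close>.\<close>
    let ?C = "\<Sum>i<N. \<bar>L2_inner \<Omega> F (e i)\<bar>"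
    interpret kirchhoff_flow \<Omega> \<T> N e \<mu> "classical_solution \<Omega> \<T> F" "\<lambda>i _. L2_inner \<Omega> F (e i)" ?C
    proof
      show "\<bar>L2_inner \<Omega> F (e i)\<bar> \<le> ?C" if "i < N" for i
        using that by (intro member_le_sum) auto
      show "classical_solution \<Omega> \<T> F u0 u \<longleftrightarrow> (\<forall>t\<ge>0. u t \<in> V) \<and> u 0 = u0 \<and>
          kirchhoff.solves (\<lambda>i _. L2_inner \<Omega> F (e i)) (\<lambda>i t. coord (u t) i)" for u0 u
        by (rule classical_solution_iff[OF F])
    qed auto
    show "uniquely_solvable V (classical_solution \<Omega> \<T> F)" by (rule uniquely_solvable)
    obtain x where x: "x \<in> V"
      "\<And>\<psi>. \<psi> \<in> V \<Longrightarrow> (1 + grad_inner \<Omega> x x) * grad_inner \<Omega> x \<psi> = L2_inner \<Omega> F \<psi>"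
      using steady_state[OF F] by blast
    have kx: "kirchhoff.kop (coord x) i = L2_inner \<Omega> F (e i)" if "i < N" for i
      using kop_coord[OF x(1) that] x(2)[OF basis_mem[OF that]] by simp
    have "classical_solution \<Omega> \<T> F x (\<lambda>_. x)"
      unfolding classical_solution_iff[OF F] kirchhoff.solves_def using x(1) kx by simp
    then have fixed: "S t x = x" if "t \<ge> 0" for t
      using solution_operator_eq[of x "\<lambda>_. x"] that by simp
    show "\<exists>A. global_attractor V (L2_dist \<Omega>) S A \<and> invariant_under S A"
      using global_attractor_fixed_point[OF x(1) fixed] fixed
      by (intro exI[of _ "{x}"]) (simp add: invariant_under_def)
  next
    fix f assume f: "f \<in> Linf_L2 \<Omega>"
    then have fL2: "AE t in lebesgue_on {0<..}. f t \<in> L2 \<Omega>" by (simp add: Linf_L2_def)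
    obtain C0 where "AE t in lebesgue_on {0<..}. L2_norm \<Omega> (f t) \<le> C0"
      using f by (auto simp: Linf_L2_def)
    \<comment> \<open>A nonnegative bound is needed for the clamping in
      \<open>Linf_L2_inner_representative\<close>.\<close>
    then have "AE t in lebesgue_on {0<..}. L2_norm \<Omega> (f t) \<le> max C0 0"
      by eventually_elim simp
    then obtain C where C: "AE t in lebesgue_on {0<..}. L2_norm \<Omega> (f t) \<le> C" "C \<ge> 0"
      by (meson max.cobounded2)
    have "\<exists>h. (\<forall>a b. h integrable_on {a..b}) \<and> (\<forall>t. \<bar>h t\<bar> \<le> C) \<and>
        (AE t in lebesgue_on {0<..}. L2_inner \<Omega> (f t) (e i) = h t)" if "i < N" for i
      using Linf_L2_inner_representative[OF f C Vh_L2[OF basis_mem[OF that]] basis_unit[OF that]] by metis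
    then obtain h where h: "\<And>i a b. i < N \<Longrightarrow> h i integrable_on {a..b}" "\<And>i t. i < N \<Longrightarrow> \<bar>h i t\<bar> \<le> C"
      "\<And>i. i < N \<Longrightarrow> AE t in lebesgue_on {0<..}. L2_inner \<Omega> (f t) (e i) = h i t" by metis
    interpret kirchhoff_flow \<Omega> \<T> N e \<mu> "caratheodory_solution \<Omega> \<T> f" h C
      by unfold_locales (rule caratheodory_solution_iff[OF fL2 h] h(1,2); assumption)+
    show "uniquely_solvable V (caratheodory_solution \<Omega> \<T> f)" by (rule uniquely_solvable)
    show "\<exists>A. global_attractor V (L2_dist \<Omega>) S A" using global_attractor_box by blast
  qed
qed

end
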